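(* Let $k\ge2$ be a fixed integer. Then $$\mathrm{Wass}_2\left(\hat\mu\left[\widetilde{S}^{/\!/}_N((k+1)\cdots 1)\right],\ \lambda^{Q_0}\right)\longrightarrow 0\quad\text{as }N\to\infty.$$ That is, the sequence of random measures $\hat\mu[\widetilde{S}^{/\!/}_N((k+1)\cdots 1)]$ converges weakly to $\lambda^{Q_0}$, with respect to the topology of weak convergence on the space of probability measures on the parallelogram $\diamondsuit$.
   Context: An affine permutation of size $N$ is a bijection $\sigma:\mathbb{Z}\to\mathbb{Z}$ with $\sigma(i+N)=\sigma(i)+N$ for all $i$ and $\sum_{i=1}^N\sigma(i)=\sum_{i=1}^N i$; it is bounded if $|\sigma(i)-i|<N$ for all $i$. It avoids $(k+1)\cdots 1$ if there are no integers $i_1<\cdots<i_{k+1}$ with $\sigma(i_1)>\cdots>\sigma(i_{k+1})$. $\widetilde{S}^{/\!/}_N((k+1)\cdots 1)$ is the (finite) set of bounded affine permutations of size $N$ avoiding $(k+1)\cdots1$. Let $\diamondsuit=\{(x,y)\in\mathbb{R}^2: 0\le x\le 1,\ |y-x|\le 1\}$ with Euclidean distance. $\mathrm{PM}(\chi)$ is the set of Borel probability measures on a metric space $\chi$, and $\delta_x$ is the point mass at $x$. For a metric space $(\chi,\rho)$ and $\nu_1,\nu_2\in\mathrm{PM}(\chi)$, the Wasserstein distance is $\mathrm{Wass}(\nu_1,\nu_2)=\inf\int\rho(x,y)\,\mathcal{J}(dx,dy)$, the infimum being over all probability measures $\mathcal J$ on $\chi\times\chi$ with marginals $\nu_1,\nu_2$.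 $\mathrm{PM}_1=\mathrm{PM}(\diamondsuit)$ with metric $\mathrm{Wass}_1$ (determined by Euclidean distance on $\diamondsuit$); $\mathrm{PM}_2=\mathrm{PM}(\mathrm{PM}(\diamondsuit))$ with metric $\mathrm{Wass}_2$ (determined by $\mathrm{Wass}_1$ on $\mathrm{PM}_1$). For a bounded affine permutation $\sigma$ of size $N$, $\hat\mu_\sigma=\frac1N\sum_{i=1}^N\delta_{(i/N,\sigma(i)/N)}\in\mathrm{PM}_1$. For a nonempty finite set $\mathcal{A}$ of bounded affine permutations of size $N$, $\hat\mu[\mathcal A]=\frac{1}{|\mathcal A|}\sum_{\sigma\in\mathcal A}\delta_{\hat\mu_\sigma}\in\mathrm{PM}_2$. For $z\in[-1,1]$, $\lambda_z\in\mathrm{PM}_1$ is the uniform distribution on the line segment from $(0,z)$ to $(1,1+z)$. For $\langle z\rangle=(z_1,\ldots,z_k)\in[-1,1]^k$, $\lambda\langle z\rangle=\frac1k\sum_{i=1}^k\lambda_{z_i}\in\mathrm{PM}_1$. $Q_0=\{\langle x\rangle\in[-1,1]^k:\sum_{i=1}^kx_i=0\}$, and $\lambda^{Q_0}\in\mathrm{PM}_2$ is the law of the random measure $\lambda\langle\beta\rangle$ where $\langle\beta\rangle$ is uniformly distributed on $Q_0$ (normalized $(k-1)$-dimensional Lebesgue measure on $Q_0$). *)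

theory Defs
  imports "HOL-Probability.Probability"
begin

section \<open>Bounded affine permutations avoiding a decreasing pattern\<close>

definition affine_permutation :: "nat \<Rightarrow> (int \<Rightarrow> int) \<Rightarrow> bool" where
  "affine_permutation N \<sigma> \<longleftrightarrow>
     bij \<sigma> \<and> (\<forall>i. \<sigma> (i + int N) = \<sigma> i + int N) \<and>
     (\<Sum>i = 1..int N. \<sigma> i) = (\<Sum>i = 1..int N. i)"

definition bounded_affine_permutation :: "nat \<Rightarrow> (int \<Rightarrow> int) \<Rightarrow> bool" where
  "bounded_affine_permutation N \<sigma> \<longleftrightarrow>
     affine_permutation N \<sigma> \<and> (\<forall>i. \<bar>\<sigma> i - i\<bar> < int N)"

definition avoids_decreasing :: "nat \<Rightarrow> (int \<Rightarrow> int) \<Rightarrow> bool" where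
  "avoids_decreasing m \<sigma> \<longleftrightarrow>
     \<not> (\<exists>i :: nat \<Rightarrow> int. \<forall>a\<in>{1..m}. \<forall>b\<in>{1..m}.
          a < b \<longrightarrow> i a < i b \<and> \<sigma> (i a) > \<sigma> (i b))"

definition bounded_avoiders :: "nat \<Rightarrow> nat \<Rightarrow> (int \<Rightarrow> int) set" where
  "bounded_avoiders N m = {\<sigma>. bounded_affine_permutation N \<sigma> \<and> avoids_decreasing m \<sigma>}"


section \<open>Probability measures on a metric space and the Wasserstein distance\<close>

text \<open>
  A metric space is given by a carrier set and a distance function. The definitions below make
  sense without the metric axioms, so that the Wasserstein distance can itself be used as the
  distance on a set of measures without first proving its triangle inequality.
\<close>

definition metric_open :: "'a set \<Rightarrow> ('a \<Rightarrow> 'a \<Rightarrow> real) \<Rightarrow> 'a set \<Rightarrow> bool" where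
  "metric_open M d U \<longleftrightarrow> U \<subseteq> M \<and> (\<forall>x\<in>U. \<exists>r>0. \<forall>y\<in>M. d x y < r \<longrightarrow> y \<in> U)"

definition metric_borel :: "'a set \<Rightarrow> ('a \<Rightarrow> 'a \<Rightarrow> real) \<Rightarrow> 'a measure" where
  "metric_borel M d = sigma M {U. metric_open M d U}"

definition PM :: "'a set \<Rightarrow> ('a \<Rightarrow> 'a \<Rightarrow> real) \<Rightarrow> 'a measure set" where
  "PM M d = {\<nu>. prob_space \<nu> \<and> sets \<nu> = sets (metric_borel M d)}"

text \<open>
  Couplings live on the product of the Borel \<open>\<sigma>\<close>-algebras; for a separable metric space, such as
  the two compact ones considered here, this is the Borel \<open>\<sigma>\<close>-algebra of the product space.
\<close>

definition couplings ::
  "'a set \<Rightarrow> ('a \<Rightarrow> 'a \<Rightarrow> real) \<Rightarrow> 'a measure \<Rightarrow> 'a measure \<Rightarrow> ('a \<times> 'a) measure set" where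
  "couplings M d \<nu>1 \<nu>2 =
     {J. prob_space J \<and> sets J = sets (metric_borel M d \<Otimes>\<^sub>M metric_borel M d) \<and>
         distr J (metric_borel M d) fst = \<nu>1 \<and> distr J (metric_borel M d) snd = \<nu>2}"

text \<open>
  With values in \<open>ennreal\<close> nothing is hidden: the value is \<open>\<infinity>\<close> if there is no coupling.
\<close>

definition Wass ::
  "'a set \<Rightarrow> ('a \<Rightarrow> 'a \<Rightarrow> real) \<Rightarrow> 'a measure \<Rightarrow> 'a measure \<Rightarrow> ennreal" where
  "Wass M d \<nu>1 \<nu>2 = (INF J\<in>couplings M d \<nu>1 \<nu>2. \<integral>\<^sup>+p. ennreal (d (fst p) (snd p)) \<partial>J)"

definition average_measure :: "'a measure \<Rightarrow> 'i set \<Rightarrow> ('i \<Rightarrow> 'a measure) \<Rightarrow> 'a measure" where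
  "average_measure M I \<nu> =
     measure_of (space M) (sets M) (\<lambda>A. (\<Sum>i\<in>I. emeasure (\<nu> i) A) / of_nat (card I))"


section \<open>Measures and random measures on the parallelogram\<close>

definition diamond :: "(real \<times> real) set" where
  "diamond = {(x, y). 0 \<le> x \<and> x \<le> 1 \<and> \<bar>y - x\<bar> \<le> 1}"

abbreviation diamond_borel :: "(real \<times> real) measure" where
  "diamond_borel \<equiv> metric_borel diamond dist"

abbreviation PM1 :: "(real \<times> real) measure set" where
  "PM1 \<equiv> PM diamond dist"

text \<open>
  The infimum is finite on \<^const>\<open>PM1\<close> because \<^const>\<open>diamond\<close> is bounded, so
  \<^const>\<open>enn2real\<close> loses nothing there.
\<close>

definition Wass1 :: "(real \<times> real) measure \<Rightarrow> (real \<times> real) measure \<Rightarrow> real" where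
  "Wass1 \<mu> \<nu> = enn2real (Wass diamond dist \<mu> \<nu>)"

abbreviation PM1_borel :: "(real \<times> real) measure measure" where
  "PM1_borel \<equiv> metric_borel PM1 Wass1"

definition Wass2 ::
  "(real \<times> real) measure measure \<Rightarrow> (real \<times> real) measure measure \<Rightarrow> ennreal" where
  "Wass2 = Wass PM1 Wass1"

definition mu_hat :: "nat \<Rightarrow> (int \<Rightarrow> int) \<Rightarrow> (real \<times> real) measure" where
  "mu_hat N \<sigma> = average_measure diamond_borel {1..int N}
     (\<lambda>i. return diamond_borel (real_of_int i / real N, real_of_int (\<sigma> i) / real N))"

definition mu_hat_set :: "nat \<Rightarrow> (int \<Rightarrow> int) set \<Rightarrow> (real \<times> real) measure measure" where
  "mu_hat_set N A = average_measure PM1_borel A (\<lambda>\<sigma>. return PM1_borel (mu_hat N \<sigma>))"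

definition segment_measure :: "real \<Rightarrow> (real \<times> real) measure" where
  "segment_measure z = distr (restrict_space lborel {0..1}) diamond_borel (\<lambda>t. (t, z + t))"

definition segments_measure :: "nat \<Rightarrow> (nat \<Rightarrow> real) \<Rightarrow> (real \<times> real) measure" where
  "segments_measure k z = average_measure diamond_borel {1..k} (\<lambda>i. segment_measure (z i))"


section \<open>The uniform distribution on the zero-sum slice of the cube\<close>

definition Q0 :: "nat \<Rightarrow> (nat \<Rightarrow> real) set" where
  "Q0 k = {x \<in> {1..k} \<rightarrow>\<^sub>E {-1..1}. (\<Sum>i = 1..k. x i) = 0}"

text \<open>
  The \<open>(k - 1)\<close>-dimensional Lebesgue measure on the hyperplane \<open>x\<^sub>1 + \<dots> + x\<^sub>k = 0\<close>, as the surface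
  measure of the graph of \<open>(x\<^sub>1, \<dots>, x\<^bsub>k-1\<^esub>) \<mapsto> - (x\<^sub>1 + \<dots> + x\<^bsub>k-1\<^esub>)\<close>. The Gram determinant of this
  parametrisation is \<open>det (1 + J) = k\<close>, where \<open>J\<close> is the all-ones matrix of size \<open>k - 1\<close>.
\<close>

definition hyperplane_lebesgue :: "nat \<Rightarrow> (nat \<Rightarrow> real) measure" where
  "hyperplane_lebesgue k = scale_measure (ennreal (sqrt (real k)))
     (distr (\<Pi>\<^sub>M i\<in>{1..<k}. lborel) (\<Pi>\<^sub>M i\<in>{1..k}. borel)
        (\<lambda>x. x(k := - (\<Sum>i = 1..<k. x i))))"

definition uniform_Q0 :: "nat \<Rightarrow> (nat \<Rightarrow> real) measure" where
  "uniform_Q0 k = uniform_measure (restrict_space (hyperplane_lebesgue k) (Q0 k)) (Q0 k)"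

definition lambda_Q0 :: "nat \<Rightarrow> (real \<times> real) measure measure" where
  "lambda_Q0 k = distr (uniform_Q0 k) PM1_borel (segments_measure k)"


section \<open>Weak convergence of random measures\<close>

definition weak_topology :: "(real \<times> real) measure topology" where
  "weak_topology = topology_generated_by
     {{\<mu> \<in> PM1. (\<integral>p. f p \<partial>\<mu>) \<in> U} | f U.
        continuous_on diamond f \<and> bounded (f ` diamond) \<and> open (U :: real set)}"

definition converges_weakly ::
  "(nat \<Rightarrow> (real \<times> real) measure measure) \<Rightarrow> (real \<times> real) measure measure \<Rightarrow> bool" where
  "converges_weakly P Q \<longleftrightarrow>
     (\<forall>F :: (real \<times> real) measure \<Rightarrow> real.
        continuous_map weak_topology euclideanreal F \<and> bounded (F ` PM1) \<longrightarrow>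
        (\<lambda>N. \<integral>\<mu>. F \<mu> \<partial>P N) \<longlonglongrightarrow> (\<integral>\<mu>. F \<mu> \<partial>Q))"

end

theory Submission
  imports Defs "HOL-Real_Asymp.Real_Asymp"
begin

text \<open>
  An avoider of \<open>(k+1)\<dots>1\<close> splits into \<open>k\<close> increasing periodic strands. It is encoded by a word \<open>p\<close>
  colouring the positions \<open>1..N\<close>, a word \<open>v\<close> colouring the values, with the same number of letters
  of each colour, and integer shifts \<open>s\<^sub>1, \<dots>, s\<^sub>k\<close> saying how far the enumeration of the values of
  colour \<open>j\<close> is moved against that of the positions; the condition on \<open>\<Sum> \<sigma>(i)\<close> becomes \<open>\<Sum> s\<^sub>j = 0\<close>.
  By a Chernoff bound all but an exponentially small proportion of words contain every colour with
  frequency close to \<open>1/k\<close> in every prefix, while matching letter counts cost only a polynomial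
  factor. For such words strand \<open>j\<close> lies close to the line of offset \<open>k s\<^sub>j / N\<close>, and if in addition
  the shifts are well separated and stay below \<open>N/k\<close> in absolute value by a margin, then \<open>\<sigma>\<close> is
  bounded and has exactly \<open>k!\<close> encodings, which differ by a relabelling of the colours. So a uniform avoider is asymptotically a uniform pair of words
  together with an independent uniform lattice point \<open>s\<close> of the slice. Matching \<open>s\<close> with the grid
  cell of side \<open>k/N\<close> at \<open>k s / N\<close> couples it with the uniform distribution on \<open>Q\<^sub>0\<close>; the two coupled
  measures on the parallelogram are compared by a second coupling, which pairs the \<open>m\<close>-th position
  of colour \<open>j\<close> with the \<open>m\<close>-th interval of length \<open>k/N\<close> on segment \<open>j\<close>.
\<close>

section \<open>Couplings on metric spaces\<close>

text \<open>The number of avoiders is never computed asymptotically. Two ratios suffice: good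
  encodings against \<open>fact k\<close> times the avoiders, and the share of \<open>Q0 k\<close>
  covered by the cells of good shifts; each is squeezed towards 1 by counting what is bad. Bad words
  have a share of order \<open>N * exp (- sqrt N / 2)\<close>, so even shifts ranging over a whole
  box of \<open>(2 * N + 1) ^ k\<close> points are affordable for them. A bad shift obeys one extra
  linear constraint of relative width about \<open>tolerance N\<close>, which makes its share small
  as well.

  What remains unmatched has small mass, not mass zero. Both couplings are therefore partial: a
  density whose marginals lie below the prescribed ones is completed by a product of the leftovers.
  The factor \<open>N / (N + 1)\<close> in both keeps the matched mass strictly below 1, so that the
  leftover mass can be divided by.

  The weak statement is derived from the same coupling, through exceptional sets that depend only on
  the point of the slice. These live on one fixed probability space, whereas the coupling changes
  with \<open>N\<close>.\<close>

lemma metric_open_subset: "metric_open M d U \<Longrightarrow> U \<subseteq> M"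
  by (simp add: metric_open_def)

lemma space_metric_borel [simp]: "space (metric_borel M d) = M"
  unfolding metric_borel_def by (rule space_measure_of) (auto dest: metric_open_subset)

lemma sets_metric_borel: "sets (metric_borel M d) = sigma_sets M {U. metric_open M d U}"
  unfolding metric_borel_def by (rule sets_measure_of) (auto dest: metric_open_subset)

lemma measurable_metric_borelI:
  assumes "\<And>x. x \<in> space N \<Longrightarrow> f x \<in> M"
    and "\<And>U. metric_open M d U \<Longrightarrow> f -` U \<inter> space N \<in> sets N"
  shows "f \<in> measurable N (metric_borel M d)"
  unfolding metric_borel_def
  using assms by (intro measurable_measure_of) (auto dest: metric_open_subset)

lemma space_average_measure [simp]: "space (average_measure M I \<nu>) = space M"
  unfolding average_measure_def by (rule space_measure_of) (rule sets.space_closed)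

lemma sets_average_measure [simp]: "sets (average_measure M I \<nu>) = sets M"
  unfolding average_measure_def by (rule sets.sets_measure_of_eq)

text \<open>\<open>measure_of\<close> yields the zero measure when its set function is not a
  measure, so countable additivity has to be checked before the averaging formula can be read
  off.\<close>

lemma emeasure_average_measure:
  assumes "finite I" "\<And>i. i \<in> I \<Longrightarrow> sets (\<nu> i) = sets M" and A: "A \<in> sets M"
  shows "emeasure (average_measure M I \<nu>) A = (\<Sum>i\<in>I. emeasure (\<nu> i) A) / of_nat (card I)"
  unfolding average_measure_def
proof (rule emeasure_measure_of_sigma[OF sets.sigma_algebra_axioms _ _ A])
  show "positive (sets M) (\<lambda>A. (\<Sum>i\<in>I. emeasure (\<nu> i) A) / of_nat (card I))"
    by (simp add: positive_def)
  show "countably_additive (sets M) (\<lambda>A. (\<Sum>i\<in>I. emeasure (\<nu> i) A) / of_nat (card I))"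
    unfolding countably_additive_def
  proof (intro allI impI)
    fix B :: "nat \<Rightarrow> _" assume B: "range B \<subseteq> sets M" "disjoint_family B" "\<Union> (range B) \<in> sets M"
    have "(\<Sum>n. (\<Sum>i\<in>I. emeasure (\<nu> i) (B n)) / of_nat (card I))
        = (\<Sum>n. (\<Sum>i\<in>I. emeasure (\<nu> i) (B n))) / of_nat (card I)"
      by (simp add: divide_ennreal_def)
    also have "(\<Sum>n. (\<Sum>i\<in>I. emeasure (\<nu> i) (B n))) = (\<Sum>i\<in>I. \<Sum>n. emeasure (\<nu> i) (B n))"
      by (intro suminf_sum) auto
    also have "\<dots> = (\<Sum>i\<in>I. emeasure (\<nu> i) (\<Union> (range B)))"
      using B assms(2) by (intro sum.cong refl suminf_emeasure) auto
    finally show "(\<Sum>n. (\<Sum>i\<in>I. emeasure (\<nu> i) (B n)) / of_nat (card I))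
      = (\<Sum>i\<in>I. emeasure (\<nu> i) (\<Union> (range B))) / of_nat (card I)" .
  qed
qed

text \<open>An average of point masses is the law of a map on a uniform finite space. In this form
  empirical measures can be coupled by exhibiting two random variables on one space.\<close>

lemma average_measure_return:
  assumes I: "finite I" and x: "\<And>i. i \<in> I \<Longrightarrow> x i \<in> space M"
  shows "average_measure M I (\<lambda>i. return M (x i)) = distr (uniform_count_measure I) M x"
proof (rule measure_eqI)
  fix A assume "A \<in> sets (average_measure M I (\<lambda>i. return M (x i)))"
  then have A: "A \<in> sets M" by simp
  have "emeasure (average_measure M I (\<lambda>i. return M (x i))) A
      = (\<Sum>i\<in>I. indicator A (x i)) / of_nat (card I)"
    using I A by (subst emeasure_average_measure) auto
  also have "(\<Sum>i\<in>I. indicator A (x i)) = (of_nat (card (x -` A \<inter> I)) :: ennreal)"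
    using I by (simp add: indicator_def sum.If_cases Int_def vimage_def conj_commute)
  also have "of_nat (card (x -` A \<inter> I)) / of_nat (card I)
      = emeasure (uniform_count_measure I) (x -` A \<inter> I)"
  proof (cases "I = {}")
    case False
    then have "card I > 0" using I by (simp add: card_gt_0_iff)
    then show ?thesis using I
      by (subst emeasure_uniform_count_measure)
         (auto simp: divide_ennreal ennreal_of_nat_eq_real_of_nat)
  qed auto
  also have "\<dots> = emeasure (distr (uniform_count_measure I) M x) A"
    using A x by (subst emeasure_distr)
      (auto simp: space_uniform_count_measure measurable_def sets_uniform_count_measure)
  finally show "emeasure (average_measure M I (\<lambda>i. return M (x i))) A
      = emeasure (distr (uniform_count_measure I) M x) A" .
qed simp

text \<open>
  The integrand \<open>c\<close> need not be measurable: \<open>Wass1\<close> is not known to be measurable as a function of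
  pairs of measures, so only this inequality is available for the outer Wasserstein distance.
\<close>

lemma nn_integral_distr_le:
  assumes [measurable]: "f \<in> measurable \<Omega> M"
  shows "(\<integral>\<^sup>+x. c x \<partial>distr \<Omega> M f) \<le> (\<integral>\<^sup>+w. c (f w) \<partial>\<Omega>)"
  unfolding nn_integral_def[of "distr \<Omega> M f"]
proof (rule SUP_least)
  fix g assume "g \<in> {g. simple_function (distr \<Omega> M f) g \<and> g \<le> c}"
  then have g: "simple_function (distr \<Omega> M f) g" "\<And>x. g x \<le> c x"
    by (auto simp: le_fun_def)
  have "integral\<^sup>S (distr \<Omega> M f) g = (\<integral>\<^sup>+x. g x \<partial>distr \<Omega> M f)"
    using g(1) by (simp add: nn_integral_eq_simple_integral)
  also have "\<dots> = (\<integral>\<^sup>+w. g (f w) \<partial>\<Omega>)"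
    using borel_measurable_simple_function[OF g(1)] by (intro nn_integral_distr) auto
  also have "\<dots> \<le> (\<integral>\<^sup>+w. c (f w) \<partial>\<Omega>)"
    by (intro nn_integral_mono g)
  finally show "integral\<^sup>S (distr \<Omega> M f) g \<le> (\<integral>\<^sup>+w. c (f w) \<partial>\<Omega>)" .
qed

text \<open>The law of the pair \<open>(X, Y)\<close> is a coupling. All upper bounds for
  Wasserstein distances below come from a suitable choice of \<open>\<Omega>\<close>,
  \<open>X\<close> and \<open>Y\<close>.\<close>

lemma Wass_distr_le:
  assumes "prob_space \<Omega>"
    and [measurable]: "X \<in> measurable \<Omega> (metric_borel M d)" "Y \<in> measurable \<Omega> (metric_borel M d)"
  shows "Wass M d (distr \<Omega> (metric_borel M d) X) (distr \<Omega> (metric_borel M d) Y)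
    \<le> (\<integral>\<^sup>+w. ennreal (d (X w) (Y w)) \<partial>\<Omega>)"
proof -
  interpret prob_space \<Omega> by fact
  let ?B = "metric_borel M d"
  define J where "J = distr \<Omega> (?B \<Otimes>\<^sub>M ?B) (\<lambda>w. (X w, Y w))"
  have "J \<in> couplings M d (distr \<Omega> ?B X) (distr \<Omega> ?B Y)"
    unfolding couplings_def J_def
    by (auto simp: distr_distr comp_def intro!: prob_space_distr)
  then have "Wass M d (distr \<Omega> ?B X) (distr \<Omega> ?B Y) \<le> (\<integral>\<^sup>+p. ennreal (d (fst p) (snd p)) \<partial>J)"
    unfolding Wass_def by (rule INF_lower)
  also have "\<dots> \<le> (\<integral>\<^sup>+w. ennreal (d (X w) (Y w)) \<partial>\<Omega>)"
    unfolding J_def by (rule order_trans[OF nn_integral_distr_le]) auto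
  finally show ?thesis .
qed

text \<open>
  The functions \<open>u i\<close> describe a coupling of only part of the mass \<open>m\<close> of the uniform distribution on
  \<open>I\<close> and of \<open>Q\<close>; what is left over on both sides is coupled independently.
\<close>

lemma partial_coupling:
  fixes u :: "'i \<Rightarrow> 'w \<Rightarrow> real"
  assumes I: "finite I" "I \<noteq> {}" and Q: "prob_space Q"
    and u_meas [measurable]: "\<And>i. i \<in> I \<Longrightarrow> u i \<in> borel_measurable Q"
    and u_nonneg: "\<And>i w. i \<in> I \<Longrightarrow> w \<in> space Q \<Longrightarrow> 0 \<le> u i w"
    and u_int: "\<And>i. i \<in> I \<Longrightarrow> (\<integral>w. u i w \<partial>Q) \<le> 1"
    and u_sum: "\<And>w. w \<in> space Q \<Longrightarrow> (\<Sum>i\<in>I. u i w) \<le> real (card I)"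
    and m_def: "m = (\<Sum>i\<in>I. \<integral>w. u i w \<partial>Q) / real (card I)" and m: "m < 1"
  obtains J where "prob_space J" "sets J = sets (count_space I \<Otimes>\<^sub>M Q)"
    "distr J (count_space I) fst = uniform_count_measure I" "distr J Q snd = Q"
    "emeasure J {p \<in> space J. u (fst p) (snd p) = 0} \<le> ennreal (1 - m)"
proof -
  interpret Q: prob_space Q by fact
  let ?n = "real (card I)"
  have n: "?n > 0" using I by (simp add: card_gt_0_iff)
  let ?U = "uniform_count_measure I"
  interpret U: prob_space ?U by (rule prob_space_uniform_count_measure[OF I])
  interpret P: pair_prob_space ?U Q ..
  define \<mu> where "\<mu> i = (\<integral>w. u i w \<partial>Q)" for i
  \<comment> \<open>Product of the leftover \<open>1 - \<mu> i\<close> on the side of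
    \<open>I\<close> and the leftover density on the side of \<open>Q\<close>, divided by the
    leftover mass \<open>1 - m\<close>. Then \<open>h\<close> integrates to 1 in \<open>w\<close>
    for each \<open>i\<close> and averages to 1 over \<open>i\<close> for each
    \<open>w\<close>.\<close>
  define rest where "rest i w = (1 - \<mu> i) * (1 - (\<Sum>i\<in>I. u i w) / ?n) / (1 - m)" for i w
  define h where "h i w = u i w + rest i w" for i w
  have sets_P: "sets (?U \<Otimes>\<^sub>M Q) = sets (count_space I \<Otimes>\<^sub>M Q)"
    by (rule sets_pair_measure_cong) (simp_all add: sets_uniform_count_measure)
  have meas_case: "(\<lambda>p. f (fst p) (snd p)) \<in> borel_measurable (?U \<Otimes>\<^sub>M Q)"
    if "\<And>i. i \<in> I \<Longrightarrow> f i \<in> borel_measurable Q" for f :: "'i \<Rightarrow> 'w \<Rightarrow> 'x :: topological_space"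
  proof -
    have "(\<lambda>p. f (fst p) (snd p)) \<in> borel_measurable (count_space I \<Otimes>\<^sub>M Q)"
      by (rule measurable_pair_measure_countable1) (use I that in \<open>auto simp: countable_finite\<close>)
    then show ?thesis by (simp add: measurable_cong_sets[OF sets_P refl])
  qed
  have u_le: "u i w \<le> ?n" if "i \<in> I" "w \<in> space Q" for i w
    using member_le_sum[of i I "\<lambda>i. u i w"] u_sum[of w] u_nonneg that I by fastforce
  have u_integrable: "integrable Q (u i)" if "i \<in> I" for i
    using that u_le u_nonneg by (intro Q.integrable_const_bound[where B = ?n] AE_I2) auto
  have \<mu>: "0 \<le> \<mu> i" "\<mu> i \<le> 1" if "i \<in> I" for i
    using u_int that u_nonneg unfolding \<mu>_def by (auto intro: integral_nonneg_AE)
  have rest_nonneg: "0 \<le> rest i w" if "i \<in> I" "w \<in> space Q" for i w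
    unfolding rest_def using \<mu> that u_sum[of w] m n by (intro divide_nonneg_pos mult_nonneg_nonneg) auto
  have h_nonneg: "0 \<le> h i w" if "i \<in> I" "w \<in> space Q" for i w
    unfolding h_def using rest_nonneg u_nonneg that by simp
  have rest_meas [measurable]: "rest i \<in> borel_measurable Q" for i
    unfolding rest_def by measurable
  have h_meas [measurable]: "h i \<in> borel_measurable Q" if "i \<in> I" for i
    unfolding h_def using that by measurable
  have sum_int: "(\<integral>w. (\<Sum>i\<in>I. u i w) \<partial>Q) = m * ?n"
    unfolding m_def using n u_integrable by (subst Bochner_Integration.integral_sum) auto
  have int_sum: "integrable Q (\<lambda>w. \<Sum>i\<in>I. u i w)" using u_integrable by auto
  have rest_integrable: "integrable Q (rest i)" for i
    unfolding rest_def using int_sum by auto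
  have rest_int: "(\<integral>w. rest i w \<partial>Q) = 1 - \<mu> i" for i
    unfolding rest_def using int_sum sum_int m n by (simp add: Q.prob_space)
  have h_int: "(\<integral>\<^sup>+w. ennreal (h i w) \<partial>Q) = 1" if "i \<in> I" for i
  proof -
    have "(\<integral>w. h i w \<partial>Q) = 1"
      unfolding h_def using that u_integrable rest_integrable rest_int \<mu>_def by simp
    moreover have "integrable Q (h i)"
      unfolding h_def using that u_integrable rest_integrable by simp
    ultimately show ?thesis
      using h_nonneg that by (subst nn_integral_eq_integral) auto
  qed
  have sum_\<mu>: "(\<Sum>i\<in>I. \<mu> i) = m * ?n" unfolding m_def \<mu>_def using n by simp
  have h_sum: "(\<Sum>i\<in>I. h i w) = ?n" if "w \<in> space Q" for w
  proof -
    have "(\<Sum>i\<in>I. rest i w) = (?n - m * ?n) * (1 - (\<Sum>i\<in>I. u i w) / ?n) / (1 - m)"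
      unfolding rest_def by (simp add: sum_\<mu> sum_subtractf flip: sum_distrib_right sum_divide_distrib)
    also have "?n - m * ?n = ?n * (1 - m)" by (simp add: algebra_simps)
    also have "?n * (1 - m) * (1 - (\<Sum>i\<in>I. u i w) / ?n) / (1 - m) = ?n - (\<Sum>i\<in>I. u i w)"
      using m n by (simp add: field_simps)
    finally show ?thesis unfolding h_def by (simp add: sum.distrib)
  qed
  define J where "J = density (?U \<Otimes>\<^sub>M Q) (\<lambda>p. ennreal (h (fst p) (snd p)))"
  have hm [measurable]: "(\<lambda>p. ennreal (h (fst p) (snd p))) \<in> borel_measurable (?U \<Otimes>\<^sub>M Q)"
    by (rule meas_case[of "\<lambda>i w. ennreal (h i w)"]) measurable
  have sets_J: "sets J = sets (count_space I \<Otimes>\<^sub>M Q)" unfolding J_def by (simp add: sets_P)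
  have space_J: "space J = I \<times> space Q"
    unfolding J_def by (simp add: space_pair_measure space_uniform_count_measure)
  have int_U: "(\<integral>\<^sup>+i. f i \<partial>?U) = (\<Sum>i\<in>I. f i / ?n)" for f :: "'i \<Rightarrow> ennreal"
    unfolding uniform_count_measure_def using I n
    by (subst nn_integral_point_measure_finite)
       (auto simp: divide_ennreal_def inverse_ennreal mult.commute inverse_eq_divide)
  have em: "emeasure J A = (\<Sum>i\<in>I. (\<integral>\<^sup>+w. ennreal (h i w) * indicator A (i, w) \<partial>Q) / ?n)"
    if A: "A \<in> sets J" for A
  proof -
    have A': "A \<in> sets (?U \<Otimes>\<^sub>M Q)" using A sets_J sets_P by simp
    have "emeasure J A = (\<integral>\<^sup>+p. ennreal (h (fst p) (snd p)) * indicator A p \<partial>(?U \<Otimes>\<^sub>M Q))"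
      unfolding J_def using A' by (subst emeasure_density) auto
    also have "\<dots> = (\<integral>\<^sup>+i. (\<integral>\<^sup>+w. ennreal (h i w) * indicator A (i, w) \<partial>Q) \<partial>?U)"
      using A' by (subst Q.nn_integral_fst[symmetric]) auto
    finally show ?thesis by (simp add: int_U)
  qed
  have ninv: "1 / ennreal ?n = ennreal (1 / ?n)" using n divide_ennreal[of 1 ?n] by simp
  have fst_J: "distr J (count_space I) fst = ?U"
  proof (rule measure_eqI_finite[where A = I])
    fix i assume i: "i \<in> I"
    have fm: "fst \<in> measurable J (count_space I)"
      using measurable_cong_sets[OF sets_J refl] by auto
    have eq: "fst -` {i} \<inter> space J = {i} \<times> space Q" using i space_J by auto
    have in_J: "{i} \<times> space Q \<in> sets J" using measurable_sets[OF fm, of "{i}"] eq i by simp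
    have "emeasure (distr J (count_space I) fst) {i} = emeasure J ({i} \<times> space Q)"
      using fm i eq by (subst emeasure_distr) auto
    also have "\<dots> = (\<Sum>i'\<in>I. (if i' = i then ennreal (1 / ?n) else 0))"
      unfolding em[OF in_J]
    proof (intro sum.cong refl)
      fix i' assume i': "i' \<in> I"
      have "(\<integral>\<^sup>+w. ennreal (h i' w) * indicator ({i} \<times> space Q) (i', w) \<partial>Q)
        = (if i' = i then (\<integral>\<^sup>+w. ennreal (h i' w) \<partial>Q) else 0)"
        by (auto intro!: nn_integral_cong simp: indicator_def)
      then show "(\<integral>\<^sup>+w. ennreal (h i' w) * indicator ({i} \<times> space Q) (i', w) \<partial>Q) / ennreal ?n
        = (if i' = i then ennreal (1 / ?n) else 0)"
        using h_int[OF i'] ninv by (cases "i' = i") auto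
    qed
    also have "\<dots> = ennreal (1 / ?n)" using I i by simp
    also have "\<dots> = emeasure ?U {i}" using I i
      by (subst emeasure_uniform_count_measure) (auto)
    finally show "emeasure (distr J (count_space I) fst) {i} = emeasure ?U {i}" .
  qed (auto simp: I sets_uniform_count_measure)
  have sm: "snd \<in> measurable J Q"
    using measurable_cong_sets[OF sets_J refl] by auto
  have snd_J: "distr J Q snd = Q"
  proof (rule measure_eqI)
    fix A assume "A \<in> sets (distr J Q snd)"
    then have A [measurable]: "A \<in> sets Q" by simp
    have eq: "snd -` A \<inter> space J = I \<times> A" using space_J sets.sets_into_space[OF A] by auto
    have in_J: "I \<times> A \<in> sets J" using measurable_sets[OF sm A] eq by simp
    have "emeasure (distr J Q snd) A = emeasure J (I \<times> A)"
      using sm A eq by (subst emeasure_distr) auto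
    also have "\<dots> = (\<Sum>i\<in>I. (\<integral>\<^sup>+w. ennreal (h i w) * indicator A w \<partial>Q) / ?n)"
      unfolding em[OF in_J]
      by (intro sum.cong refl arg_cong2[where f = "(/)"] nn_integral_cong) (auto simp: indicator_def)
    also have "\<dots> = (\<integral>\<^sup>+w. (\<Sum>i\<in>I. ennreal (h i w) * indicator A w / ?n) \<partial>Q)"
      using I by (simp add: nn_integral_sum nn_integral_divide)
    also have "\<dots> = (\<integral>\<^sup>+w. indicator A w \<partial>Q)"
    proof (rule nn_integral_cong)
      fix w assume w: "w \<in> space Q"
      have "(\<Sum>i\<in>I. ennreal (h i w) * indicator A w / ?n)
        = (\<Sum>i\<in>I. ennreal (h i w)) * indicator A w / ?n"
        by (simp add: sum_distrib_right divide_ennreal_def)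
      also have "(\<Sum>i\<in>I. ennreal (h i w)) = ennreal ?n"
        using h_sum[OF w] h_nonneg w by (subst sum_ennreal) auto
      also have "ennreal ?n * indicator A w / ennreal ?n = indicator A w"
        using n by (auto simp: indicator_def divide_ennreal)
      finally show "(\<Sum>i\<in>I. ennreal (h i w) * indicator A w / ?n) = indicator A w" .
    qed
    finally show "emeasure (distr J Q snd) A = emeasure Q A" by simp
  qed simp
  have prob_J: "prob_space J"
  proof -
    have "prob_space (distr J Q snd)" unfolding snd_J by fact
    then show ?thesis by (rule prob_space_distrD[OF sm])
  qed
  define Z where "Z = {p \<in> space J. u (fst p) (snd p) = 0}"
  have um: "(\<lambda>p. u (fst p) (snd p)) \<in> borel_measurable J"
    using meas_case[of u] u_meas measurable_cong_sets[OF sets_J[folded sets_P] refl] by blast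
  have Z: "Z \<in> sets J" unfolding Z_def using um by measurable
  have "emeasure J Z = (\<Sum>i\<in>I. (\<integral>\<^sup>+w. ennreal (h i w) * indicator Z (i, w) \<partial>Q) / ?n)"
    by (rule em[OF Z])
  \<comment> \<open>Where \<open>u\<close> vanishes the density \<open>h\<close> reduces to
    \<open>rest\<close>, whose total mass is \<open>1 - m\<close>.\<close>
  also have "\<dots> \<le> (\<Sum>i\<in>I. (\<integral>\<^sup>+w. ennreal (rest i w) \<partial>Q) / ?n)"
    by (intro sum_mono divide_right_mono_ennreal nn_integral_mono)
       (auto simp: indicator_def Z_def h_def)
  also have "\<dots> = (\<Sum>i\<in>I. ennreal ((1 - \<mu> i) / ?n))"
  proof (intro sum.cong refl)
    fix i assume i: "i \<in> I"
    have "(\<integral>\<^sup>+w. ennreal (rest i w) \<partial>Q) = ennreal (1 - \<mu> i)"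
      using rest_integrable rest_nonneg i rest_int by (subst nn_integral_eq_integral) auto
    then show "(\<integral>\<^sup>+w. ennreal (rest i w) \<partial>Q) / ?n = ennreal ((1 - \<mu> i) / ?n)"
      using n \<mu> i by (simp add: divide_ennreal)
  qed
  also have "\<dots> = ennreal (\<Sum>i\<in>I. (1 - \<mu> i) / ?n)"
    using \<mu> n by (intro sum_ennreal) auto
  also have "(\<Sum>i\<in>I. (1 - \<mu> i) / ?n) = 1 - m"
    using n sum_\<mu> by (simp add: sum_subtractf flip: sum_divide_distrib) (simp add: field_simps)
  finally show thesis
    using that prob_J sets_J fst_J snd_J Z_def by blast
qed

text \<open>The cost is split at the exceptional set. This serves both levels: \<open>dist\<close>
  on \<open>diamond\<close>, where \<open>Z\<close> holds the unmatched positions, and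
  \<open>Wass1\<close> on \<open>PM1\<close>, where it holds the unmatched permutations.\<close>

lemma Wass_distr_le_except:
  assumes \<Omega>: "prob_space \<Omega>"
    and X: "X \<in> measurable \<Omega> (metric_borel M d)" and Y: "Y \<in> measurable \<Omega> (metric_borel M d)"
    and close: "\<And>w. w \<in> space \<Omega> \<Longrightarrow> w \<notin> Z \<Longrightarrow> d (X w) (Y w) \<le> \<delta>"
    and diam: "\<And>w. w \<in> space \<Omega> \<Longrightarrow> d (X w) (Y w) \<le> D"
    and Z: "Z \<in> sets \<Omega>" "emeasure \<Omega> Z \<le> ennreal \<eta>"
    and nonneg: "0 \<le> \<delta>" "0 \<le> D" "0 \<le> \<eta>"
  shows "Wass M d (distr \<Omega> (metric_borel M d) X) (distr \<Omega> (metric_borel M d) Y) \<le> ennreal (\<delta> + D * \<eta>)"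
proof -
  interpret prob_space \<Omega> by fact
  have "Wass M d (distr \<Omega> (metric_borel M d) X) (distr \<Omega> (metric_borel M d) Y)
      \<le> (\<integral>\<^sup>+w. ennreal (d (X w) (Y w)) \<partial>\<Omega>)"
    by (rule Wass_distr_le[OF \<Omega> X Y])
  also have "\<dots> \<le> (\<integral>\<^sup>+w. ennreal \<delta> + ennreal D * indicator Z w \<partial>\<Omega>)"
  proof (rule nn_integral_mono)
    fix w assume w: "w \<in> space \<Omega>"
    have "ennreal (d (X w) (Y w)) \<le> ennreal D" using diam[OF w] by (rule ennreal_leI)
    also have "\<dots> \<le> ennreal \<delta> + ennreal D" by simp
    finally show "ennreal (d (X w) (Y w)) \<le> ennreal \<delta> + ennreal D * indicator Z w"
      using close[OF w] by (auto simp: indicator_def intro: ennreal_leI)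
  qed
  also have "\<dots> = ennreal \<delta> + ennreal D * emeasure \<Omega> Z"
    using Z by (simp add: nn_integral_add nn_integral_cmult emeasure_space_1)
  also have "\<dots> \<le> ennreal \<delta> + ennreal D * ennreal \<eta>"
    by (intro add_left_mono mult_left_mono Z) simp
  also have "\<dots> = ennreal (\<delta> + D * \<eta>)"
    using nonneg by (simp add: ennreal_mult ennreal_plus)
  finally show ?thesis .
qed

section \<open>Borel structure and diameter of the parallelogram\<close>

lemma metric_open_dist_iff: "metric_open A dist U \<longleftrightarrow> openin (top_of_set A) U"
  unfolding metric_open_def openin_euclidean_subtopology_iff by (simp add: dist_commute)

text \<open>Relatively open sets are traces of open sets, and a closed \<open>A\<close> is itself
  Borel, so generating and taking traces commute. This gives access to the measurability rules for
  \<open>borel\<close>.\<close>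

lemma sets_metric_borel_dist:
  fixes A :: "'a :: metric_space set"
  assumes "closed A"
  shows "sets (metric_borel A dist) = sets (restrict_space borel A)"
proof -
  have "{U. metric_open A dist U} = (\<inter>) A ` {S. open S}"
    unfolding metric_open_dist_iff openin_open by auto
  then have "sets (metric_borel A dist) = sigma_sets A ((\<inter>) A ` {S. open S})"
    by (simp add: sets_metric_borel)
  also have "\<dots> = (\<inter>) A ` sigma_sets UNIV {S. open S}"
    using borel_closed[OF assms] by (intro sigma_sets_Int[symmetric]) (auto simp: borel_def)
  also have "\<dots> = sets (restrict_space borel A)"
    by (simp add: sets_restrict_space borel_def)
  finally show ?thesis .
qed

lemma dist_prod_le: "dist p q \<le> \<bar>fst p - fst q\<bar> + \<bar>snd p - snd q\<bar>" for p q :: "real \<times> real"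
  by (cases p; cases q) (simp add: dist_Pair_Pair dist_real_def sqrt_sum_squares_le_sum_abs)

text \<open>The second coordinate ranges over \<open>[-1, 2]\<close>, so the coordinate differences
  add up to at most 1 + 3. This crude diameter is the factor 4 in later bounds.\<close>

lemma dist_diamond_le: "p \<in> diamond \<Longrightarrow> q \<in> diamond \<Longrightarrow> dist p q \<le> 4"
  by (rule order_trans[OF dist_prod_le]) (auto simp: diamond_def)

lemma compact_diamond: "compact diamond"
proof (rule compact_eq_bounded_closed[THEN iffD2], intro conjI)
  show "bounded diamond"
    unfolding bounded_any_center[where a = "(0, 0)"]
    by (rule exI[of _ 4]) (auto intro!: dist_diamond_le simp: diamond_def)
  have "diamond = {p. 0 \<le> fst p \<and> fst p \<le> 1 \<and> \<bar>snd p - fst p\<bar> \<le> 1}"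
    by (auto simp: diamond_def)
  moreover have "closed {p :: real \<times> real. 0 \<le> fst p \<and> fst p \<le> 1 \<and> \<bar>snd p - fst p\<bar> \<le> 1}"
    by (intro closed_Collect_conj closed_Collect_le continuous_intros)
  ultimately show "closed diamond" by simp
qed

lemma sets_diamond_borel: "sets diamond_borel = sets (restrict_space borel diamond)"
  by (rule sets_metric_borel_dist[OF compact_imp_closed[OF compact_diamond]])

lemma measurable_diamond_borel:
  assumes "f \<in> borel_measurable N" "\<And>x. x \<in> space N \<Longrightarrow> f x \<in> diamond"
  shows "f \<in> measurable N diamond_borel"
  unfolding measurable_cong_sets[OF refl sets_diamond_borel]
  using assms by (intro measurable_restrict_space2) auto

lemma measurable_diamond_id: "(\<lambda>x. x) \<in> measurable diamond_borel borel"
  unfolding measurable_cong_sets[OF sets_diamond_borel refl]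
  by (rule measurable_restrict_space1) simp

lemma continuous_on_diamond_measurable:
  "continuous_on diamond f \<Longrightarrow> (f :: _ \<Rightarrow> real) \<in> borel_measurable diamond_borel"
  unfolding measurable_cong_sets[OF sets_diamond_borel refl]
  by (rule borel_measurable_continuous_on_restrict)

lemma PM1_distr:
  "prob_space \<Omega> \<Longrightarrow> X \<in> measurable \<Omega> diamond_borel \<Longrightarrow> distr \<Omega> diamond_borel X \<in> PM1"
  unfolding PM_def by (simp add: prob_space.prob_space_distr)

lemma Wass1_distr_le:
  assumes "prob_space \<Omega>" "X \<in> measurable \<Omega> diamond_borel" "Y \<in> measurable \<Omega> diamond_borel"
    and "\<And>w. w \<in> space \<Omega> \<Longrightarrow> w \<notin> Z \<Longrightarrow> dist (X w) (Y w) \<le> \<delta>"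
    and "Z \<in> sets \<Omega>" "emeasure \<Omega> Z \<le> ennreal \<eta>" "0 \<le> \<delta>" "0 \<le> \<eta>"
  shows "Wass1 (distr \<Omega> diamond_borel X) (distr \<Omega> diamond_borel Y) \<le> \<delta> + 4 * \<eta>"
proof -
  have "Wass diamond dist (distr \<Omega> diamond_borel X) (distr \<Omega> diamond_borel Y) \<le> ennreal (\<delta> + 4 * \<eta>)"
    using assms measurable_space[OF assms(2)] measurable_space[OF assms(3)]
    by (intro Wass_distr_le_except[where Z = Z]) (auto intro: dist_diamond_le)
  then show ?thesis
    unfolding Wass1_def using assms by (intro enn2real_leI) auto
qed

text \<open>The independent coupling shows that the infimum is finite, so a small value of
  \<open>Wass1\<close> never comes from \<open>enn2real\<close> sending infinity to 0.\<close>

lemma Wass_diamond_le: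
  assumes "\<mu> \<in> PM1" "\<nu> \<in> PM1"
  shows "Wass diamond dist \<mu> \<nu> \<le> ennreal 4"
proof -
  interpret \<mu>: prob_space \<mu> using assms by (simp add: PM_def)
  interpret \<nu>: prob_space \<nu> using assms by (simp add: PM_def)
  interpret P: pair_prob_space \<mu> \<nu> ..
  have sets: "sets \<mu> = sets diamond_borel" "sets \<nu> = sets diamond_borel"
    using assms by (auto simp: PM_def)
  have f: "fst \<in> measurable (\<mu> \<Otimes>\<^sub>M \<nu>) diamond_borel"
    using measurable_fst[of \<mu> \<nu>] measurable_cong_sets[OF refl sets(1)] by blast
  have s: "snd \<in> measurable (\<mu> \<Otimes>\<^sub>M \<nu>) diamond_borel"
    using measurable_snd[of \<mu> \<nu>] measurable_cong_sets[OF refl sets(2)] by blast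
  have "distr (\<mu> \<Otimes>\<^sub>M \<nu>) diamond_borel fst = distr (\<mu> \<Otimes>\<^sub>M \<nu>) \<mu> fst"
    by (intro distr_cong) (simp_all add: sets)
  also have "\<dots> = \<mu>"
    by (rule \<nu>.distr_pair_fst)
  finally have 1: "distr (\<mu> \<Otimes>\<^sub>M \<nu>) diamond_borel fst = \<mu>" .
  have 2: "distr (\<mu> \<Otimes>\<^sub>M \<nu>) diamond_borel snd = \<nu>"
  proof (rule measure_eqI)
    fix A assume "A \<in> sets (distr (\<mu> \<Otimes>\<^sub>M \<nu>) diamond_borel snd)"
    then have A: "A \<in> sets \<nu>" using sets by simp
    have "snd -` A \<inter> space (\<mu> \<Otimes>\<^sub>M \<nu>) = space \<mu> \<times> A"
      using sets.sets_into_space[OF A] by (auto simp: space_pair_measure)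
    then show "emeasure (distr (\<mu> \<Otimes>\<^sub>M \<nu>) diamond_borel snd) A = emeasure \<nu> A"
      using A s sets \<nu>.emeasure_pair_measure_Times[OF sets.top A, of \<mu>]
      by (simp add: emeasure_distr \<mu>.emeasure_space_1)
  qed (simp add: sets)
  have "Wass diamond dist (distr (\<mu> \<Otimes>\<^sub>M \<nu>) diamond_borel fst) (distr (\<mu> \<Otimes>\<^sub>M \<nu>) diamond_borel snd)
      \<le> ennreal (4 + 4 * 0)"
    using measurable_space[OF f] measurable_space[OF s]
    by (intro Wass_distr_le_except[where Z = "{}"] P.prob_space_axioms f s)
       (auto intro: dist_diamond_le)
  then show ?thesis by (simp add: 1 2)
qed

lemma Wass1_le_4: "\<mu> \<in> PM1 \<Longrightarrow> \<nu> \<in> PM1 \<Longrightarrow> Wass1 \<mu> \<nu> \<le> 4"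
  unfolding Wass1_def by (rule enn2real_leI) (use Wass_diamond_le in auto)

section \<open>Empirical measures and segment measures as laws of maps\<close>

lemma mu_hat_eq:
  assumes N: "N > 0" and \<sigma>: "\<forall>i\<in>{1..int N}. \<bar>\<sigma> i - i\<bar> < int N"
  shows "mu_hat N \<sigma> = distr (uniform_count_measure {1..int N}) diamond_borel
      (\<lambda>i. (real_of_int i / real N, real_of_int (\<sigma> i) / real N))"
    and "\<And>i. i \<in> {1..int N} \<Longrightarrow> (real_of_int i / real N, real_of_int (\<sigma> i) / real N) \<in> diamond"
proof -
  show *: "(real_of_int i / real N, real_of_int (\<sigma> i) / real N) \<in> diamond" if i: "i \<in> {1..int N}" for i
  proof -
    have "\<bar>real_of_int (\<sigma> i) - real_of_int i\<bar> \<le> real N" using \<sigma>[rule_format, OF i] by linarith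
    moreover have "real_of_int (\<sigma> i) / real N - real_of_int i / real N
      = (real_of_int (\<sigma> i) - real_of_int i) / real N"
      by (simp add: diff_divide_distrib)
    moreover have "real_of_int i \<le> real N" "0 \<le> real_of_int i" using i by auto
    ultimately show ?thesis using N by (auto simp: diamond_def abs_if divide_simps)
  qed
  show "mu_hat N \<sigma> = distr (uniform_count_measure {1..int N}) diamond_borel
      (\<lambda>i. (real_of_int i / real N, real_of_int (\<sigma> i) / real N))"
    unfolding mu_hat_def using * by (intro average_measure_return) auto
qed

lemma mu_hat_PM1:
  assumes N: "N > 0" and \<sigma>: "\<forall>i\<in>{1..int N}. \<bar>\<sigma> i - i\<bar> < int N"
  shows "mu_hat N \<sigma> \<in> PM1"
  unfolding mu_hat_eq(1)[OF N \<sigma>]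
  using N mu_hat_eq(2)[OF N \<sigma>]
  by (intro PM1_distr prob_space_uniform_count_measure)
     (auto simp: measurable_def sets_uniform_count_measure space_uniform_count_measure)

definition unit_lebesgue :: "real measure" where
  "unit_lebesgue = restrict_space lborel {0..1}"

lemma prob_space_unit_lebesgue: "prob_space unit_lebesgue"
  unfolding unit_lebesgue_def by (rule prob_spaceI) (simp add: emeasure_restrict_space)

lemma space_unit_lebesgue [simp]: "space unit_lebesgue = {0..1}"
  by (simp add: unit_lebesgue_def space_restrict_space)

lemma measurable_unit_lebesgue: "f \<in> borel_measurable borel \<Longrightarrow> f \<in> borel_measurable unit_lebesgue"
  unfolding unit_lebesgue_def by (intro measurable_restrict_space1) simp

lemma measurable_count_pair:
  assumes "countable I" "\<And>i. i \<in> I \<Longrightarrow> f i \<in> measurable N K"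
  shows "(\<lambda>p. f (fst p) (snd p)) \<in> measurable (uniform_count_measure I \<Otimes>\<^sub>M N) K"
proof -
  have "sets (uniform_count_measure I \<Otimes>\<^sub>M N) = sets (count_space I \<Otimes>\<^sub>M N)"
    by (rule sets_pair_measure_cong) (simp_all add: sets_uniform_count_measure)
  moreover have "(\<lambda>p. f (fst p) (snd p)) \<in> measurable (count_space I \<Otimes>\<^sub>M N) K"
    by (rule measurable_pair_measure_countable1) (use assms in auto)
  ultimately show ?thesis using measurable_cong_sets[OF _ refl] by blast
qed

lemma segment_measurable:
  assumes "\<bar>z\<bar> \<le> 1"
  shows "(\<lambda>t. (t, z + t)) \<in> measurable unit_lebesgue diamond_borel"
  using assms by (intro measurable_diamond_borel measurable_unit_lebesgue) (auto simp: diamond_def)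

text \<open>A random colour together with an independent uniform time. It is a source space common
  to all \<open>segments_measure k z\<close>, which makes them easy to couple with each
  other.\<close>

definition strand_space :: "nat \<Rightarrow> (nat \<times> real) measure" where
  "strand_space k = uniform_count_measure {1..k} \<Otimes>\<^sub>M unit_lebesgue"

lemma space_strand_space [simp]: "space (strand_space k) = {1..k} \<times> {0..1}"
  by (simp add: strand_space_def space_pair_measure space_uniform_count_measure)

lemma prob_space_strand_space:
  assumes "k > 0" shows "prob_space (strand_space k)"
proof -
  interpret A: prob_space "uniform_count_measure {1..k}"
    using assms by (intro prob_space_uniform_count_measure) auto
  interpret B: prob_space unit_lebesgue by (rule prob_space_unit_lebesgue)
  interpret P: pair_prob_space "uniform_count_measure {1..k}" unit_lebesgue ..
  show ?thesis unfolding strand_space_def by (rule P.prob_space_axioms)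
qed

lemma strand_measurable:
  assumes "\<forall>j\<in>{1..k}. \<bar>z j\<bar> \<le> 1"
  shows "(\<lambda>p. (snd p, z (fst p) + snd p)) \<in> measurable (strand_space k) diamond_borel"
  unfolding strand_space_def
  by (rule measurable_count_pair[where f = "\<lambda>j t. (t, z j + t)"])
     (use assms in \<open>auto intro!: segment_measurable\<close>)

lemma segments_measure_eq:
  assumes k: "k > 0" and z: "\<forall>j\<in>{1..k}. \<bar>z j\<bar> \<le> 1"
  shows "segments_measure k z = distr (strand_space k) diamond_borel (\<lambda>p. (snd p, z (fst p) + snd p))"
proof (rule measure_eqI)
  interpret B: prob_space unit_lebesgue by (rule prob_space_unit_lebesgue)
  fix A assume "A \<in> sets (segments_measure k z)"
  then have A: "A \<in> sets diamond_borel" by (simp add: segments_measure_def)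
  let ?X = "\<lambda>p. (snd p, z (fst p) + snd p)"
  let ?A = "?X -` A \<inter> space (strand_space k)"
  have Am: "?A \<in> sets (strand_space k)"
    using strand_measurable[OF z] A by (rule measurable_sets)
  have "emeasure (distr (strand_space k) diamond_borel ?X) A = emeasure (strand_space k) ?A"
    using strand_measurable[OF z] A by (rule emeasure_distr)
  also have "\<dots> = (\<integral>\<^sup>+j. emeasure unit_lebesgue (Pair j -` ?A) \<partial>uniform_count_measure {1..k})"
    using Am unfolding strand_space_def by (rule B.emeasure_pair_measure_alt)
  also have "\<dots> = (\<Sum>j\<in>{1..k}. ennreal (1 / real k) * emeasure unit_lebesgue (Pair j -` ?A))"
    unfolding uniform_count_measure_def by (subst nn_integral_point_measure_finite) auto
  also have "\<dots> = (\<Sum>j\<in>{1..k}. ennreal (1 / real k) * emeasure (segment_measure (z j)) A)"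
  proof (intro sum.cong refl arg_cong2[where f = "(*)"])
    fix j assume j: "j \<in> {1..k}"
    have eq: "Pair j -` ?A = (\<lambda>t. (t, z j + t)) -` A \<inter> space unit_lebesgue" using j by auto
    show "emeasure unit_lebesgue (Pair j -` ?A) = emeasure (segment_measure (z j)) A"
      unfolding eq segment_measure_def unit_lebesgue_def[symmetric]
      by (rule emeasure_distr[symmetric, OF segment_measurable[OF z[rule_format, OF j]] A])
  qed
  also have "\<dots> = (\<Sum>j\<in>{1..k}. emeasure (segment_measure (z j)) A) / of_nat (card {1..k})"
    using k by (simp add: divide_ennreal_def sum_distrib_left[symmetric] mult.commute
        inverse_eq_divide[symmetric] inverse_ennreal[symmetric] ennreal_of_nat_eq_real_of_nat)
  also have "\<dots> = emeasure (segments_measure k z) A"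
    unfolding segments_measure_def using A
    by (subst emeasure_average_measure) (auto simp: segment_measure_def)
  finally show "emeasure (segments_measure k z) A
    = emeasure (distr (strand_space k) diamond_borel ?X) A" by simp
qed (simp add: segments_measure_def)

lemma segments_measure_PM1:
  assumes k: "k > 0" and z: "\<forall>j\<in>{1..k}. \<bar>z j\<bar> \<le> 1"
  shows "segments_measure k z \<in> PM1"
  unfolding segments_measure_eq[OF k z]
  using prob_space_strand_space[OF k] strand_measurable[OF z] by (intro PM1_distr) auto

text \<open>Using the same colour and time for both measures, the paired points differ only
  vertically, by \<open>\<bar>z j - y j\<bar>\<close>.\<close>

lemma Wass1_segments_le:
  assumes k: "k > 0" and z: "\<forall>j\<in>{1..k}. \<bar>z j\<bar> \<le> 1" and y: "\<forall>j\<in>{1..k}. \<bar>y j\<bar> \<le> 1"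
    and zy: "\<And>j. j \<in> {1..k} \<Longrightarrow> \<bar>z j - y j\<bar> \<le> \<delta>"
  shows "Wass1 (segments_measure k z) (segments_measure k y) \<le> \<delta>"
proof -
  have "0 \<le> \<delta>" using zy[of 1] k by fastforce
  then have "Wass1 (segments_measure k z) (segments_measure k y) \<le> \<delta> + 4 * 0"
    unfolding segments_measure_eq[OF k z] segments_measure_eq[OF k y]
    using prob_space_strand_space[OF k] strand_measurable[OF z] strand_measurable[OF y]
    by (intro Wass1_distr_le[where Z = "{}"])
       (auto intro!: order_trans[OF dist_prod_le] zy)
  then show ?thesis by simp
qed

section \<open>Measurability of the map from the slice to the measures\<close>

lemma sets_uniform_Q0: "sets (uniform_Q0 k) = sets (restrict_space (\<Pi>\<^sub>M i\<in>{1..k}. borel) (Q0 k))"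
  unfolding uniform_Q0_def hyperplane_lebesgue_def by (simp add: sets_restrict_space)

lemma space_uniform_Q0 [simp]: "space (uniform_Q0 k) = Q0 k"
proof -
  have "space (uniform_Q0 k) = space (restrict_space (\<Pi>\<^sub>M i\<in>{1..k}. borel) (Q0 k))"
    by (rule sets_eq_imp_space_eq[OF sets_uniform_Q0])
  also have "\<dots> = Q0 k" by (auto simp: space_restrict_space space_PiM Q0_def PiE_def)
  finally show ?thesis .
qed

lemma Q0_bounds: "x \<in> Q0 k \<Longrightarrow> j \<in> {1..k} \<Longrightarrow> \<bar>x j\<bar> \<le> 1"
  by (fastforce simp: Q0_def PiE_def Pi_def abs_le_iff)

text \<open>By \<open>Wass1_segments_le\<close> the map depends continuously on finitely many
  offsets. Clamping the offsets to \<open>[-1, 1]\<close> extends it to all functions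
  \<open>nat => real\<close>, where the preimage \<open>V\<close> of a \<open>Wass1\<close>-open set
  is open in the product topology.\<close>

lemma segments_measure_measurable:
  assumes k: "k > 0"
  shows "segments_measure k \<in> measurable (uniform_Q0 k) PM1_borel"
proof (rule measurable_metric_borelI)
  fix U assume U: "metric_open PM1 Wass1 U"
  define clamp :: "(nat \<Rightarrow> real) \<Rightarrow> nat \<Rightarrow> real" where "clamp z = (\<lambda>i. max (-1) (min 1 (z i)))" for z
  have clamp_le: "\<bar>clamp z j\<bar> \<le> 1" for z j unfolding clamp_def by auto
  have clamp_diff: "\<bar>clamp z j - clamp y j\<bar> \<le> \<bar>z j - y j\<bar>" for z y j unfolding clamp_def by auto
  define V where "V = {z. segments_measure k (clamp z) \<in> U}"
  have "open V"
  proof (subst open_subopen, intro ballI)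
    fix z assume "z \<in> V"
    then obtain r where r: "r > 0" "\<And>\<nu>. \<nu> \<in> PM1 \<Longrightarrow> Wass1 (segments_measure k (clamp z)) \<nu> < r \<Longrightarrow> \<nu> \<in> U"
      using U unfolding V_def metric_open_def by blast
    define B where "B = Pi\<^sub>E UNIV (\<lambda>i. if i \<in> {1..k} then {z i - r / 2 <..< z i + r / 2} else UNIV)"
    have "open B" unfolding B_def
      by (rule open_PiE) (auto intro: finite_subset[of _ "{1..k}"])
    moreover have "z \<in> B" using r(1) by (auto simp: B_def PiE_def Pi_def)
    moreover have "B \<subseteq> V"
    proof
      fix y assume y: "y \<in> B"
      have "\<bar>z j - y j\<bar> \<le> r / 2" if "j \<in> {1..k}" for j
      proof -
        have "y j \<in> {z j - r / 2 <..< z j + r / 2}"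
          using y that unfolding B_def PiE_def Pi_def by (auto dest!: spec[of _ j])
        then show ?thesis unfolding greaterThanLessThan_iff by linarith
      qed
      then have "Wass1 (segments_measure k (clamp z)) (segments_measure k (clamp y)) \<le> r / 2"
        using clamp_diff order_trans by (intro Wass1_segments_le k ballI clamp_le) blast
      then show "y \<in> V" unfolding V_def using r k
        by (auto intro!: r(2) segments_measure_PM1 clamp_le)
    qed
    ultimately show "\<exists>T. open T \<and> z \<in> T \<and> T \<subseteq> V" by blast
  qed
  \<comment> \<open>Passes from the product over \<open>{1..k}\<close> to the product over all of
    \<open>nat\<close>, on which the product \<open>\<sigma>\<close>-algebra coincides with the
    Borel sets of the product topology, so that openness of \<open>V\<close> gives
    measurability.\<close>
  define ext :: "(nat \<Rightarrow> real) \<Rightarrow> nat \<Rightarrow> real" where "ext x = (\<lambda>i. if i \<in> {1..k} then x i else 0)" for x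
  have ext_meas: "ext \<in> measurable (\<Pi>\<^sub>M i\<in>{1..k}. borel) borel"
  proof -
    have "ext \<in> measurable (\<Pi>\<^sub>M i\<in>{1..k}. borel) (\<Pi>\<^sub>M i\<in>UNIV. borel)"
    proof (rule measurable_PiM_single')
      fix i :: nat
      show "(\<lambda>x. ext x i) \<in> borel_measurable (\<Pi>\<^sub>M i\<in>{1..k}. borel)"
        unfolding ext_def by (cases "i \<in> {1..k}") auto
    qed auto
    then show ?thesis by (simp add: measurable_cong_sets[OF refl sets_PiM_equal_borel])
  qed
  have eq: "segments_measure k (clamp (ext x)) = segments_measure k x" if "x \<in> Q0 k" for x
  proof -
    have "clamp (ext x) j = x j" if "j \<in> {1..k}" for j
      using Q0_bounds[OF \<open>x \<in> Q0 k\<close> that] that by (auto simp: clamp_def ext_def)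
    then show ?thesis unfolding segments_measure_def average_measure_def by simp
  qed
  have "segments_measure k -` U \<inter> space (uniform_Q0 k)
    = Q0 k \<inter> (ext -` V \<inter> space (\<Pi>\<^sub>M i\<in>{1..k}. borel))"
    using eq by (auto simp: V_def Q0_def space_PiM PiE_def)
  also have "\<dots> \<in> sets (uniform_Q0 k)"
    unfolding sets_uniform_Q0 sets_restrict_space
    by (intro imageI measurable_sets[OF ext_meas] borel_open \<open>open V\<close>)
  finally show "segments_measure k -` U \<inter> space (uniform_Q0 k) \<in> sets (uniform_Q0 k)" .
qed (use k in \<open>auto intro!: segments_measure_PM1 Q0_bounds\<close>)

section \<open>Weakly open sets are open for the Wasserstein distance\<close>

lemma integral_Wass1_close:
  assumes f: "continuous_on diamond (f :: _ \<Rightarrow> real)" and e: "e > 0"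
  obtains r where "r > 0"
    "\<And>\<mu> \<nu>. \<mu> \<in> PM1 \<Longrightarrow> \<nu> \<in> PM1 \<Longrightarrow> Wass1 \<mu> \<nu> < r \<Longrightarrow> \<bar>(\<integral>p. f p \<partial>\<nu>) - (\<integral>p. f p \<partial>\<mu>)\<bar> < e"
proof -
  have "bounded (f ` diamond)"
    by (rule compact_imp_bounded[OF compact_continuous_image[OF f compact_diamond]])
  then obtain B where B: "B > 0" "\<And>p. p \<in> diamond \<Longrightarrow> \<bar>f p\<bar> \<le> B"
    unfolding bounded_pos by auto
  have "uniformly_continuous_on diamond f"
    by (rule compact_uniformly_continuous[OF f compact_diamond])
  then obtain d where d: "d > 0"
    "\<And>p q. p \<in> diamond \<Longrightarrow> q \<in> diamond \<Longrightarrow> dist q p < d \<Longrightarrow> dist (f q) (f p) < e / 2"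
    unfolding uniformly_continuous_on_def using e by (meson half_gt_zero)
  \<comment> \<open>A continuous \<open>f\<close> need not be Lipschitz, but up to an additive
    \<open>e / 2\<close> it is: below distance \<open>d\<close> by uniform continuity, beyond it
    because \<open>2 * B\<close> is at most \<open>2 * B / d\<close> times the distance. Such a
    bound can be integrated against a coupling of small cost.\<close>
  have bd: "\<bar>f q - f p\<bar> \<le> e / 2 + 2 * B / d * dist p q" if "p \<in> diamond" "q \<in> diamond" for p q
  proof (cases "dist p q < d")
    case True
    then have "\<bar>f q - f p\<bar> < e / 2" using d(2)[OF that] by (simp add: dist_real_def dist_commute)
    moreover have "0 \<le> 2 * B / d * dist p q" using B d by simp
    ultimately show ?thesis by linarith
  next
    case False
    then have "2 * B / d * d \<le> 2 * B / d * dist p q" using B d by (intro mult_left_mono) auto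
    then have "2 * B \<le> 2 * B / d * dist p q" using d by simp
    moreover have "\<bar>f q - f p\<bar> \<le> 2 * B" using B(2)[OF that(1)] B(2)[OF that(2)] by linarith
    ultimately show ?thesis using e by linarith
  qed
  \<comment> \<open>Makes the linear term \<open>2 * B / d * r\<close> equal to
    \<open>e / 2\<close>.\<close>
  define r where "r = e * d / (4 * B)"
  have r: "r > 0" unfolding r_def using e d B by simp
  have "\<bar>(\<integral>p. f p \<partial>\<nu>) - (\<integral>p. f p \<partial>\<mu>)\<bar> < e"
    if "\<mu> \<in> PM1" "\<nu> \<in> PM1" "Wass1 \<mu> \<nu> < r" for \<mu> \<nu>
  proof -
    have "Wass diamond dist \<mu> \<nu> = ennreal (Wass1 \<mu> \<nu>)"
      unfolding Wass1_def using Wass_diamond_le[OF that(1,2)]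
      by (metis ennreal_enn2real_if ennreal_neq_top neq_top_trans)
    then have "Wass diamond dist \<mu> \<nu> < ennreal r"
      using that(3) r by (simp add: ennreal_lessI)
    then obtain J where J: "J \<in> couplings diamond dist \<mu> \<nu>"
      and less: "(\<integral>\<^sup>+p. ennreal (dist (fst p) (snd p)) \<partial>J) < ennreal r"
      unfolding Wass_def INF_less_iff by blast
    interpret J: prob_space J using J by (simp add: couplings_def)
    have setsJ: "sets J = sets (diamond_borel \<Otimes>\<^sub>M diamond_borel)"
      and dJ: "distr J diamond_borel fst = \<mu>" "distr J diamond_borel snd = \<nu>"
      using J by (auto simp: couplings_def)
    have [measurable]: "fst \<in> measurable J diamond_borel" "snd \<in> measurable J diamond_borel"
      unfolding measurable_cong_sets[OF setsJ refl] by auto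
    have spaceJ: "p \<in> space J \<Longrightarrow> fst p \<in> diamond \<and> snd p \<in> diamond" for p
      by (simp add: sets_eq_imp_space_eq[OF setsJ] space_pair_measure mem_Times_iff)
    have fm [measurable]: "f \<in> borel_measurable diamond_borel"
      by (rule continuous_on_diamond_measurable[OF f])
    have fb [measurable]: "fst \<in> borel_measurable J" "snd \<in> borel_measurable J"
      using measurable_compose[OF _ measurable_diamond_id, of fst J]
        measurable_compose[OF _ measurable_diamond_id, of snd J] by auto
    have int1: "integrable J (\<lambda>p. f (fst p))" "integrable J (\<lambda>p. f (snd p))"
      using B spaceJ by (auto intro!: J.integrable_const_bound[where B = B])
    have int2: "integrable J (\<lambda>p. dist (fst p) (snd p))"
      using spaceJ dist_diamond_le
      by (intro J.integrable_const_bound[where B = 4] AE_I2) (auto simp del: split_paired_All)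
    have le: "(\<integral>p. dist (fst p) (snd p) \<partial>J) < r"
    proof -
      have "ennreal (\<integral>p. dist (fst p) (snd p) \<partial>J) < ennreal r"
        using less int2 by (subst nn_integral_eq_integral[symmetric]) auto
      then show ?thesis using r by (simp add: ennreal_less_iff)
    qed
    have "(\<integral>p. f p \<partial>\<nu>) - (\<integral>p. f p \<partial>\<mu>) = (\<integral>p. f (snd p) - f (fst p) \<partial>J)"
      using int1 by (simp add: integral_distr flip: dJ)
    also have "\<bar>\<dots>\<bar> \<le> (\<integral>p. \<bar>f (snd p) - f (fst p)\<bar> \<partial>J)"
      by (rule integral_abs_bound)
    also have "\<dots> \<le> (\<integral>p. e / 2 + 2 * B / d * dist (fst p) (snd p) \<partial>J)"
      using int1 int2 spaceJ by (intro integral_mono bd) auto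
    also have "\<dots> = e / 2 + 2 * B / d * (\<integral>p. dist (fst p) (snd p) \<partial>J)"
      using int2 by (simp add: J.prob_space)
    also have "\<dots> < e / 2 + 2 * B / d * r"
      using le B(1) d(1) by (intro add_strict_left_mono mult_strict_left_mono) auto
    also have "\<dots> = e" unfolding r_def using B d by (simp add: field_simps)
    finally show ?thesis .
  qed
  then show thesis using that r by blast
qed

lemma metric_open_PM1_basis:
  assumes f: "continuous_on diamond f" and U: "open (U :: real set)"
  shows "metric_open PM1 Wass1 {\<mu> \<in> PM1. (\<integral>p. f p \<partial>\<mu>) \<in> U}"
  unfolding metric_open_def
proof (intro conjI ballI)
  fix \<mu> assume \<mu>: "\<mu> \<in> {\<mu> \<in> PM1. (\<integral>p. f p \<partial>\<mu>) \<in> U}"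
  then obtain e where e: "e > 0" "\<And>y. dist y (\<integral>p. f p \<partial>\<mu>) < e \<Longrightarrow> y \<in> U"
    using U unfolding open_dist by blast
  obtain r where "r > 0"
    "\<And>\<mu> \<nu>. \<mu> \<in> PM1 \<Longrightarrow> \<nu> \<in> PM1 \<Longrightarrow> Wass1 \<mu> \<nu> < r \<Longrightarrow> \<bar>(\<integral>p. f p \<partial>\<nu>) - (\<integral>p. f p \<partial>\<mu>)\<bar> < e"
    using integral_Wass1_close[OF f e(1)] by blast
  then show "\<exists>r>0. \<forall>\<nu>\<in>PM1. Wass1 \<mu> \<nu> < r \<longrightarrow> \<nu> \<in> {\<mu> \<in> PM1. (\<integral>p. f p \<partial>\<mu>) \<in> U}"
    using \<mu> e(2) by (auto simp: dist_real_def intro!: exI[of _ r])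
qed auto

lemma metric_open_Int:
  assumes "metric_open M d A" "metric_open M d B"
  shows "metric_open M d (A \<inter> B)"
  unfolding metric_open_def
proof (intro conjI ballI)
  fix x assume "x \<in> A \<inter> B"
  then obtain r s where "r > 0" "\<forall>y\<in>M. d x y < r \<longrightarrow> y \<in> A" "s > 0" "\<forall>y\<in>M. d x y < s \<longrightarrow> y \<in> B"
    using assms unfolding metric_open_def by blast
  then show "\<exists>r>0. \<forall>y\<in>M. d x y < r \<longrightarrow> y \<in> A \<inter> B"
    by (intro exI[of _ "min r s"]) auto
qed (use assms in \<open>auto simp: metric_open_def\<close>)

lemma metric_open_Union:
  assumes "\<And>A. A \<in> K \<Longrightarrow> metric_open M d A"
  shows "metric_open M d (\<Union>K)"
  unfolding metric_open_def
proof (intro conjI ballI)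
  show "\<Union>K \<subseteq> M" using assms by (auto simp: metric_open_def)
  fix x assume "x \<in> \<Union>K"
  then obtain A where A: "A \<in> K" "x \<in> A" by blast
  then obtain r where "r > 0" "\<forall>y\<in>M. d x y < r \<longrightarrow> y \<in> A"
    using assms[OF A(1)] unfolding metric_open_def by blast
  then show "\<exists>r>0. \<forall>y\<in>M. d x y < r \<longrightarrow> y \<in> \<Union>K" using A by blast
qed

text \<open>The subbasic sets are metrically open and metric openness passes to finite intersections
  and unions. Weakly continuous functionals are thus measurable on \<open>PM1_borel\<close> and
  continuous for \<open>Wass1\<close>.\<close>

lemma weak_open_imp_metric_open:
  assumes "openin weak_topology W" shows "metric_open PM1 Wass1 W"
proof -
  have "generate_topology_on {{\<mu> \<in> PM1. (\<integral>p. f p \<partial>\<mu>) \<in> U} | f U.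
        continuous_on diamond f \<and> bounded (f ` diamond) \<and> open (U :: real set)} W"
    using assms unfolding weak_topology_def openin_topology_generated_by_iff .
  then show ?thesis
  proof induction
    case Empty then show ?case by (simp add: metric_open_def)
  next
    case (Int a b) then show ?case by (intro metric_open_Int)
  next
    case (UN K) then show ?case by (intro metric_open_Union) blast
  next
    case (Basis s) then show ?case using metric_open_PM1_basis by blast
  qed
qed

lemma topspace_weak_topology: "topspace weak_topology = PM1"
proof -
  have "PM1 = {\<mu> \<in> PM1. (\<integral>p. 0 \<partial>\<mu>) \<in> (UNIV :: real set)}" by simp
  moreover have "continuous_on diamond (\<lambda>_. 0 :: real)" "bounded ((\<lambda>_. 0 :: real) ` diamond)"
    by (auto simp: bounded_def)
  ultimately have "PM1 \<in> {{\<mu> \<in> PM1. (\<integral>p. f p \<partial>\<mu>) \<in> U} | f U.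
        continuous_on diamond f \<and> bounded (f ` diamond) \<and> open (U :: real set)}"
    using open_UNIV by blast
  then show ?thesis unfolding weak_topology_def topology_generated_by_topspace by blast
qed

lemma weakly_continuous_metric_open:
  assumes "continuous_map weak_topology euclideanreal F" "open V"
  shows "metric_open PM1 Wass1 {\<mu> \<in> PM1. F \<mu> \<in> V}"
proof -
  have "openin weak_topology {\<mu> \<in> topspace weak_topology. F \<mu> \<in> V}"
    using assms by (intro openin_continuous_map_preimage) auto
  then show ?thesis by (simp add: topspace_weak_topology weak_open_imp_metric_open)
qed

lemma weakly_continuous_measurable:
  assumes "continuous_map weak_topology euclideanreal F"
  shows "F \<in> borel_measurable PM1_borel"
proof (rule borel_measurableI)
  fix V :: "real set" assume "open V"
  then have "metric_open PM1 Wass1 {\<mu> \<in> PM1. F \<mu> \<in> V}"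
    by (rule weakly_continuous_metric_open[OF assms])
  then show "F -` V \<inter> space PM1_borel \<in> sets PM1_borel"
    unfolding sets_metric_borel by (auto simp: vimage_def Int_def conj_commute)
qed

lemma weakly_continuous_Wass1_close:
  assumes F: "continuous_map weak_topology euclideanreal F" and \<mu>: "\<mu> \<in> PM1" and e: "e > 0"
  obtains r where "r > 0" "\<And>\<nu>. \<nu> \<in> PM1 \<Longrightarrow> Wass1 \<mu> \<nu> < r \<Longrightarrow> \<bar>F \<nu> - F \<mu>\<bar> < e"
proof -
  have "metric_open PM1 Wass1 {\<nu> \<in> PM1. F \<nu> \<in> ball (F \<mu>) e}"
    by (rule weakly_continuous_metric_open[OF F]) simp
  moreover have "\<mu> \<in> {\<nu> \<in> PM1. F \<nu> \<in> ball (F \<mu>) e}" using \<mu> e by simp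
  ultimately obtain r where "r > 0" "\<forall>\<nu>\<in>PM1. Wass1 \<mu> \<nu> < r \<longrightarrow> \<nu> \<in> {\<nu> \<in> PM1. F \<nu> \<in> ball (F \<mu>) e}"
    unfolding metric_open_def by blast
  then show thesis using that by (auto simp: dist_real_def abs_minus_commute)
qed

section \<open>Coloured affine permutations\<close>

text \<open>Quotient and remainder with remainders in \<open>{1..N}\<close> instead of
  \<open>{0..<N}\<close>, matching the base period of an affine permutation; hence the shifts by
  1.\<close>

definition lap :: "nat \<Rightarrow> int \<Rightarrow> int" where
  "lap N x = (x - 1) div int N"

definition rep :: "nat \<Rightarrow> int \<Rightarrow> int" where
  "rep N x = (x - 1) mod int N + 1"

lemma rep_lap: "x = rep N x + int N * lap N x"
  unfolding rep_def lap_def using div_mult_mod_eq[of "x - 1" "int N"] by (simp add: mult.commute)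

lemma rep_in: "N > 0 \<Longrightarrow> rep N x \<in> {1..int N}"
  unfolding rep_def using pos_mod_bound[of "int N" "x - 1"] pos_mod_sign[of "int N" "x - 1"]
  unfolding atLeastAtMost_iff by linarith

lemma rep_lap_unique:
  assumes "r \<in> {1..int N}"
  shows "rep N (r + int N * q) = r" "lap N (r + int N * q) = q"
proof -
  have "(r - 1 + q * int N) mod int N = r - 1" "(r - 1 + q * int N) div int N = q"
    using assms by auto
  moreover have "r + int N * q - 1 = r - 1 + q * int N" by (simp add: algebra_simps)
  ultimately show "rep N (r + int N * q) = r" "lap N (r + int N * q) = q"
    unfolding rep_def lap_def by (simp_all only: diff_add_cancel)
qed

lemma rep_id: "x \<in> {1..int N} \<Longrightarrow> rep N x = x" and lap_id: "x \<in> {1..int N} \<Longrightarrow> lap N x = 0"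
  using rep_lap_unique[of x N 0] by auto

lemma rep_add_mult: "N > 0 \<Longrightarrow> rep N (x + int N * q) = rep N x"
  and lap_add_mult: "N > 0 \<Longrightarrow> lap N (x + int N * q) = lap N x + q"
proof -
  assume N: "N > 0"
  have "x + int N * q = rep N x + int N * (lap N x + q)"
    using rep_lap[of x N] by (simp add: algebra_simps)
  then show "rep N (x + int N * q) = rep N x" "lap N (x + int N * q) = lap N x + q"
    using rep_lap_unique[OF rep_in[OF N, of x], of "lap N x + q"] by simp_all
qed

lemma rep_add: "N > 0 \<Longrightarrow> rep N (x + int N) = rep N x"
  using rep_add_mult[of N x 1] by simp

lemma rep_eq_imp: "rep N x = rep N y \<Longrightarrow> x = y + int N * (lap N x - lap N y)"
  using rep_lap[of x N] rep_lap[of y N] by (simp add: algebra_simps)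

definition cnt :: "(int \<Rightarrow> nat) \<Rightarrow> nat \<Rightarrow> int \<Rightarrow> nat" where
  "cnt p j x = card {i \<in> {1..x}. p i = j}"

text \<open>
  For the word \<open>p\<close> on \<open>{1..N}\<close>, extended periodically, the signed number of letters \<open>j\<close> in
  \<open>{0<..x}\<close>.
\<close>

definition height :: "nat \<Rightarrow> (int \<Rightarrow> nat) \<Rightarrow> nat \<Rightarrow> int \<Rightarrow> int" where
  "height N p j x = int (cnt p j (int N)) * lap N x + int (cnt p j (rep N x))"

lemma finite_int_Collect [simp]:
  "finite {i :: int. a \<le> i \<and> i \<le> b \<and> P i}" "finite {i :: int. a < i \<and> i \<le> b \<and> P i}"
  by (rule finite_subset[of _ "{a..b}"]; auto)+

lemma cnt_0 [simp]: "cnt p j 0 = 0"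
  by (simp add: cnt_def)

lemma cnt_step: "0 \<le> x \<Longrightarrow> cnt p j (x + 1) = cnt p j x + (if p (x + 1) = j then 1 else 0)"
proof -
  assume x: "0 \<le> x"
  have "{i \<in> {1..x + 1}. p i = j} = {i \<in> {1..x}. p i = j} \<union> (if p (x + 1) = j then {x + 1} else {})"
    using x by (auto simp: order.order_iff_strict)
  then show ?thesis unfolding cnt_def by (simp add: card_insert_if)
qed

lemma height_step:
  assumes N: "N > 0"
  shows "height N p j (x + 1) = height N p j x + (if p (rep N (x + 1)) = j then 1 else 0)"
proof (cases "rep N x = int N")
  case True
  \<comment> \<open>At the end of a period \<open>rep\<close> restarts at 1 while \<open>lap\<close>
    grows by one, so the full count \<open>cnt p j N\<close> moves from the second summand of
    \<open>height\<close> into the first.\<close>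
  have "x + 1 = 1 + int N * (lap N x + 1)" using rep_lap[of x N] True by (simp add: algebra_simps)
  moreover have "1 \<in> {1..int N}" using N by simp
  ultimately have "rep N (x + 1) = 1" "lap N (x + 1) = lap N x + 1"
    using rep_lap_unique[of 1 N "lap N x + 1"] by metis+
  then show ?thesis unfolding height_def using True cnt_step[of 0 p j] by (simp add: algebra_simps)
next
  case False
  then have r: "rep N x + 1 \<in> {1..int N}" "0 \<le> rep N x" using rep_in[OF N, of x] by auto
  have "x + 1 = rep N x + 1 + int N * lap N x" using rep_lap[of x N] by simp
  then have "rep N (x + 1) = rep N x + 1" "lap N (x + 1) = lap N x"
    using rep_lap_unique[OF r(1), of "lap N x"] by metis+
  then show ?thesis unfolding height_def using cnt_step[OF r(2), of p j] by simp
qed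

lemma height_diff:
  assumes N: "N > 0" and "x \<le> y"
  shows "height N p j y - height N p j x = int (card {i \<in> {x<..y}. p (rep N i) = j})"
  using \<open>x \<le> y\<close>
proof (induction y rule: int_ge_induct)
  case base show ?case by simp
next
  case (step y)
  have "{i \<in> {x<..y + 1}. p (rep N i) = j}
    = {i \<in> {x<..y}. p (rep N i) = j} \<union> (if p (rep N (y + 1)) = j then {y + 1} else {})"
    using step.hyps by (auto simp: order.order_iff_strict)
  then have "card {i \<in> {x<..y + 1}. p (rep N i) = j}
    = card {i \<in> {x<..y}. p (rep N i) = j} + (if p (rep N (y + 1)) = j then 1 else 0)"
    by (simp add: card_insert_if)
  then show ?case using step height_step[OF N, of p j y] by simp
qed

lemma height_mono: "N > 0 \<Longrightarrow> x \<le> y \<Longrightarrow> height N p j x \<le> height N p j y"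
  using height_diff[of N x y p j] by simp

lemma height_strict_mono:
  assumes N: "N > 0" and "x < y" "p (rep N y) = j"
  shows "height N p j x < height N p j y"
proof -
  have "height N p j x \<le> height N p j (y - 1)" using assms by (intro height_mono) auto
  also have "\<dots> < height N p j y" using height_step[OF N, of p j "y - 1"] assms by simp
  finally show ?thesis .
qed

lemma height_inj:
  assumes N: "N > 0" and "p (rep N x) = j" "p (rep N y) = j" "height N p j x = height N p j y"
  shows "x = y"
  using height_strict_mono[OF N, of x y p j] height_strict_mono[OF N, of y x p j] assms
  by (metis less_irrefl linorder_neqE)

lemma height_add_mult:
  "N > 0 \<Longrightarrow> height N p j (x + int N * q) = height N p j x + int (cnt p j (int N)) * q"
  unfolding height_def by (simp add: rep_add_mult lap_add_mult distrib_left)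

lemma height_base: "x \<in> {1..int N} \<Longrightarrow> height N p j x = int (cnt p j x)"
  unfolding height_def by (simp add: rep_id lap_id)

text \<open>Each period raises the height by a positive amount, so it is unbounded in both
  directions, and it rises in steps of at most 1 taken at letters \<open>j\<close>. The first place
  where it reaches \<open>m\<close> is therefore a letter \<open>j\<close> of height exactly
  \<open>m\<close>. With \<open>height_inj\<close> this enumerates the letters \<open>j\<close> by
  all integers.\<close>

lemma height_surj:
  assumes N: "N > 0" and n: "cnt p j (int N) > 0"
  obtains y where "p (rep N y) = j" "height N p j y = m"
proof -
  let ?h = "height N p j"
  have h0: "?h (int N * t) = int (cnt p j (int N)) * t" for t
  proof -
    have r: "(1 :: int) \<in> {1..int N}" using N by simp
    have "int (cnt p j (0 + 1)) = ?h 0 + (if p 1 = j then 1 else 0)"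
      using height_step[OF N, of p j 0] height_base[OF r, of p j] by (simp add: rep_id[OF r])
    then have "?h 0 = 0" unfolding cnt_step[OF order_refl] by (auto split: if_splits)
    then show ?thesis using height_add_mult[OF N, of p j 0 t] by simp
  qed
  \<comment> \<open>After \<open>t\<close> periods backwards the height is at most
    \<open>- t < m\<close>, after \<open>t\<close> periods forwards it is at least
    \<open>t > m\<close>.\<close>
  define t where "t = \<bar>m\<bar> + 1"
  have t: "t \<le> int (cnt p j (int N)) * t"
    using mult_right_mono[of 1 "int (cnt p j (int N))" t] n t_def by simp
  define y0 where "y0 = int N * (- t)"
  have low: "?h y0 < m" unfolding y0_def h0 using t t_def by (subst mult_minus_right) linarith
  have "m \<le> ?h (int N * t)" using t t_def unfolding h0 by linarith
  moreover have "int N * t = y0 + int (nat (2 * int N * t))" unfolding y0_def using t_def by (simp add: algebra_simps)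
  ultimately have ex: "\<exists>d. m \<le> ?h (y0 + int d)" by metis
  define d where "d = (LEAST d. m \<le> ?h (y0 + int d))"
  have d: "m \<le> ?h (y0 + int d)" unfolding d_def by (rule LeastI_ex[OF ex])
  then have "d \<noteq> 0" using low by (intro notI) simp
  then obtain d' where d': "d = Suc d'" using not0_implies_Suc by blast
  have less: "?h (y0 + int d') < m"
    using not_less_Least[of d' "\<lambda>d. m \<le> ?h (y0 + int d)"] d' d_def by auto
  have "?h (y0 + int d) = ?h (y0 + int d') + (if p (rep N (y0 + int d)) = j then 1 else 0)"
    using height_step[OF N, of p j "y0 + int d'"] d' by (simp add: algebra_simps)
  then have "p (rep N (y0 + int d)) = j" "?h (y0 + int d) = m"
    using less d by (auto split: if_splits)
  then show thesis by (rule that)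
qed

text \<open>The counts at successive letters \<open>j\<close> are \<open>1, 2, ..., n\<close>, so
  their sum is a triangular number. It depends on the word only through \<open>n\<close>, which lets
  the sums for \<open>p\<close> and \<open>v\<close> cancel.\<close>

lemma sum_cnt:
  "2 * (\<Sum>i | i \<in> {1..int x} \<and> p i = j. int (cnt p j i)) = int (cnt p j (int x)) * (int (cnt p j (int x)) + 1)"
proof (induction x)
  case (Suc x)
  have eq: "{i. i \<in> {1..int (Suc x)} \<and> p i = j}
    = {i. i \<in> {1..int x} \<and> p i = j} \<union> (if p (int x + 1) = j then {int x + 1} else {})"
    by (auto simp: order.order_iff_strict add.commute)
  have s: "cnt p j (int (Suc x)) = cnt p j (int x) + (if p (int x + 1) = j then 1 else 0)"
    using cnt_step[of "int x" p j] by (simp add: add.commute)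
  have "(\<Sum>i | i \<in> {1..int (Suc x)} \<and> p i = j. int (cnt p j i))
    = (\<Sum>i | i \<in> {1..int x} \<and> p i = j. int (cnt p j i))
      + (if p (int x + 1) = j then int (cnt p j (int x)) + 1 else 0)"
    unfolding eq using cnt_step[of "int x" p j] by (subst sum.union_disjoint) auto
  then show ?case using Suc unfolding s by (auto simp: algebra_simps)
qed (simp add: cnt_def)

section \<open>Permutations from two words and a shift vector\<close>

definition words :: "nat \<Rightarrow> nat \<Rightarrow> (int \<Rightarrow> nat) set" where
  "words N k = {1..int N} \<rightarrow>\<^sub>E {1..k}"

text \<open>
  \<open>\<sigma>\<close> sends positions of colour \<open>j\<close> (given by \<open>p\<close>) to values of colour \<open>j\<close> (given by \<open>v\<close>), the
  \<open>m\<close>-th position to the \<open>(m + s j)\<close>-th value.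
\<close>

definition lifts :: "nat \<Rightarrow> (int \<Rightarrow> nat) \<Rightarrow> (int \<Rightarrow> nat) \<Rightarrow> (nat \<Rightarrow> int) \<Rightarrow> (int \<Rightarrow> int) \<Rightarrow> bool" where
  "lifts N p v s \<sigma> \<longleftrightarrow> (\<forall>i. v (rep N (\<sigma> i)) = p (rep N i) \<and>
     height N v (p (rep N i)) (\<sigma> i) = height N p (p (rep N i)) i + s (p (rep N i)))"

lemma lifts_unique:
  assumes "N > 0" "lifts N p v s \<sigma>" "lifts N p v s \<tau>"
  shows "\<sigma> = \<tau>"
proof
  fix i show "\<sigma> i = \<tau> i"
    by (rule height_inj[OF assms(1), of v _ "p (rep N i)"]) (use assms(2,3) in \<open>auto simp: lifts_def\<close>)
qed

lemma periodic_mult: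
  assumes "\<forall>i. f (i + int N) = f i + (c :: int)"
  shows "f (i + int N * q) = f i + c * q"
proof (induction q rule: int_induct[where k = 0])
  case (step1 q)
  have "f (i + int N * (q + 1)) = f ((i + int N * q) + int N)" by (simp add: algebra_simps)
  also have "\<dots> = f (i + int N * q) + c" using assms by blast
  finally show ?case using step1 by (simp add: algebra_simps)
next
  case (step2 q)
  have "f (i + int N * q) = f ((i + int N * (q - 1)) + int N)" by (simp add: algebra_simps)
  also have "\<dots> = f (i + int N * (q - 1)) + c" using assms by blast
  finally show ?case using step2 by (simp add: algebra_simps)
qed simp

lemma rep_bij:
  assumes N: "N > 0" and "bij \<sigma>" and per: "\<forall>i. \<sigma> (i + int N) = \<sigma> i + int N"
  shows "bij_betw (\<lambda>i. rep N (\<sigma> i)) {1..int N} {1..int N}"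
proof (rule bij_betw_imageI)
  note per' = periodic_mult[OF per]
  show "inj_on (\<lambda>i. rep N (\<sigma> i)) {1..int N}"
  proof (rule inj_onI)
    fix x y assume xy: "x \<in> {1..int N}" "y \<in> {1..int N}" "rep N (\<sigma> x) = rep N (\<sigma> y)"
    then have "\<sigma> x = \<sigma> (y + int N * (lap N (\<sigma> x) - lap N (\<sigma> y)))"
      using rep_eq_imp per' by metis
    then have "x = y + int N * (lap N (\<sigma> x) - lap N (\<sigma> y))"
      using \<open>bij \<sigma>\<close> by (metis bij_pointE)
    then show "x = y" using rep_add_mult[OF N] rep_id xy by metis
  qed
  then show "(\<lambda>i. rep N (\<sigma> i)) ` {1..int N} = {1..int N}"
    using rep_in[OF N] by (intro endo_inj_surj) auto
qed

lemma lifts_class_bij: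
  assumes N: "N > 0" and "bij \<sigma>" "\<forall>i. \<sigma> (i + int N) = \<sigma> i + int N"
    and color: "\<And>i. v (rep N (\<sigma> i)) = p (rep N i)"
  shows "bij_betw (\<lambda>i. rep N (\<sigma> i)) {i. i \<in> {1..int N} \<and> p i = j} {i. i \<in> {1..int N} \<and> v i = j}"
proof -
  note b = rep_bij[OF assms(1-3)]
  have "(\<lambda>i. rep N (\<sigma> i)) ` {i. i \<in> {1..int N} \<and> p i = j} = {i. i \<in> {1..int N} \<and> v i = j}"
  proof (intro equalityI subsetI)
    fix y assume "y \<in> (\<lambda>i. rep N (\<sigma> i)) ` {i. i \<in> {1..int N} \<and> p i = j}"
    then show "y \<in> {i. i \<in> {1..int N} \<and> v i = j}"
      using color rep_id rep_in[OF N] by auto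
  next
    fix y assume y: "y \<in> {i. i \<in> {1..int N} \<and> v i = j}"
    then obtain i where i: "i \<in> {1..int N}" "y = rep N (\<sigma> i)"
      using b unfolding bij_betw_def by blast
    then have "p i = j" using color[of i] y rep_id by simp
    then show "y \<in> (\<lambda>i. rep N (\<sigma> i)) ` {i. i \<in> {1..int N} \<and> p i = j}" using i by blast
  qed
  then show ?thesis
    using b unfolding bij_betw_def by (auto intro: inj_on_subset)
qed

text \<open>Summing the height equation over one colour class, the triangular sums on both sides
  cancel and leave \<open>n\<close> times the laps against \<open>n * c\<close>. A shift is thus the
  total number of laps made by its strand; this yields the zero sum of the shifts and also recovers
  them from \<open>\<sigma>\<close>.\<close>

lemma lifts_sum_lap:
  assumes N: "N > 0" and "bij \<sigma>" "\<forall>i. \<sigma> (i + int N) = \<sigma> i + int N"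
    and color: "\<And>i. v (rep N (\<sigma> i)) = p (rep N i)"
    and ht: "\<And>i. i \<in> {1..int N} \<Longrightarrow> p i = j \<Longrightarrow> height N v j (\<sigma> i) = height N p j i + c"
    and n: "cnt p j (int N) > 0"
  shows "(\<Sum>i | i \<in> {1..int N} \<and> p i = j. lap N (\<sigma> i)) = c" "cnt v j (int N) = cnt p j (int N)"
proof -
  let ?P = "{i. i \<in> {1..int N} \<and> p i = j}" and ?V = "{i. i \<in> {1..int N} \<and> v i = j}"
  let ?n = "int (cnt p j (int N))"
  note b = lifts_class_bij[OF assms(1-3), of v p j, OF color]
  show cv: "cnt v j (int N) = cnt p j (int N)"
    using bij_betw_same_card[OF b] unfolding cnt_def by (simp add: conj_commute)
  have "(\<Sum>i\<in>?P. height N v j (\<sigma> i)) = (\<Sum>i\<in>?P. height N p j i + c)"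
    using ht by (intro sum.cong) auto
  also have "\<dots> = (\<Sum>i\<in>?P. int (cnt p j i)) + ?n * c"
    by (simp add: sum.distrib height_base cnt_def)
  finally have 1: "(\<Sum>i\<in>?P. height N v j (\<sigma> i)) = (\<Sum>i\<in>?P. int (cnt p j i)) + ?n * c" .
  have "(\<Sum>i\<in>?P. height N v j (\<sigma> i)) = ?n * (\<Sum>i\<in>?P. lap N (\<sigma> i)) + (\<Sum>i\<in>?P. int (cnt v j (rep N (\<sigma> i))))"
    unfolding height_def cv by (simp add: sum.distrib sum_distrib_left)
  also have "(\<Sum>i\<in>?P. int (cnt v j (rep N (\<sigma> i)))) = (\<Sum>i\<in>?V. int (cnt v j i))"
    by (rule sum.reindex_bij_betw[OF b])
  also have "(\<Sum>i\<in>?V. int (cnt v j i)) = (\<Sum>i\<in>?P. int (cnt p j i))"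
    using sum_cnt[of v j N] sum_cnt[of p j N] cv by simp
  finally have "?n * (\<Sum>i\<in>?P. lap N (\<sigma> i)) = ?n * c" using 1 by simp
  then show "(\<Sum>i\<in>?P. lap N (\<sigma> i)) = c" using n by simp
qed

text \<open>A periodic bijection permutes the residues, so the representatives contribute
  \<open>1 + ... + N\<close> on both sides and only the laps remain.\<close>

lemma sum_eq_iff_sum_lap:
  assumes N: "N > 0" and "bij \<sigma>" "\<forall>i. \<sigma> (i + int N) = \<sigma> i + int N"
  shows "(\<Sum>i = 1..int N. \<sigma> i) = (\<Sum>i = 1..int N. i) \<longleftrightarrow> (\<Sum>i = 1..int N. lap N (\<sigma> i)) = 0"
proof -
  have "(\<Sum>i = 1..int N. \<sigma> i) = (\<Sum>i = 1..int N. rep N (\<sigma> i) + int N * lap N (\<sigma> i))"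
    using rep_lap by (intro sum.cong) auto
  also have "\<dots> = (\<Sum>i = 1..int N. rep N (\<sigma> i)) + int N * (\<Sum>i = 1..int N. lap N (\<sigma> i))"
    by (simp add: sum.distrib sum_distrib_left)
  also have "(\<Sum>i = 1..int N. rep N (\<sigma> i)) = (\<Sum>i = 1..int N. i)"
    by (rule sum.reindex_bij_betw[OF rep_bij[OF assms]])
  finally show ?thesis using N by simp
qed

lemma sum_classes:
  assumes "p \<in> words N k"
  shows "(\<Sum>i = 1..int N. f i) = (\<Sum>j = 1..k. \<Sum>i | i \<in> {1..int N} \<and> p i = j. f i)"
proof -
  have "p ` {1..int N} \<subseteq> {1..k}" using assms by (auto simp: words_def)
  then show ?thesis by (subst sum.group[symmetric, of _ "{1..k}" p]) (auto simp: conj_commute)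
qed

lemma words_rep: "N > 0 \<Longrightarrow> p \<in> words N k \<Longrightarrow> p (rep N i) \<in> {1..k}"
  using rep_in[of N i] by (auto simp: words_def)

text \<open>Heights enumerate the letters of each colour by the integers, so prescribing the height
  of the image determines a bijection. Equal letter counts make it periodic, and the laps of strand
  \<open>j\<close> add up to \<open>s j\<close>.\<close>

lemma lifts_exists:
  assumes N: "N > 0" and p: "p \<in> words N k" and v: "v \<in> words N k"
    and eq: "\<And>j. j \<in> {1..k} \<Longrightarrow> cnt v j (int N) = cnt p j (int N)"
    and pos: "\<And>j. j \<in> {1..k} \<Longrightarrow> cnt p j (int N) > 0"
    and s: "(\<Sum>j = 1..k. s j) = 0"
  obtains \<sigma> where "lifts N p v s \<sigma>" "affine_permutation N \<sigma>" "avoids_decreasing (k + 1) \<sigma>"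
proof -
  have ex: "\<exists>y. v (rep N y) = p (rep N i) \<and>
     height N v (p (rep N i)) y = height N p (p (rep N i)) i + s (p (rep N i))" for i
  proof -
    have "cnt v (p (rep N i)) (int N) > 0" using eq pos words_rep[OF N p] by simp
    from height_surj[OF N this] show ?thesis by metis
  qed
  then obtain \<sigma> where L: "lifts N p v s \<sigma>" unfolding lifts_def by metis
  have color: "v (rep N (\<sigma> i)) = p (rep N i)"
    and ht: "height N v (p (rep N i)) (\<sigma> i) = height N p (p (rep N i)) i + s (p (rep N i))" for i
    using L by (auto simp: lifts_def)
  have per: "\<sigma> (i + int N) = \<sigma> i + int N" for i
  proof (rule height_inj[OF N, of v _ "p (rep N i)"])
    show "v (rep N (\<sigma> (i + int N))) = p (rep N i)" "v (rep N (\<sigma> i + int N)) = p (rep N i)"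
      using color[of "i + int N"] color[of i] by (simp_all add: rep_add[OF N])
    have j: "p (rep N i) \<in> {1..k}" by (rule words_rep[OF N p])
    show "height N v (p (rep N i)) (\<sigma> (i + int N)) = height N v (p (rep N i)) (\<sigma> i + int N)"
      using ht[of "i + int N"] ht[of i] eq[OF j] height_add_mult[OF N, of v "p (rep N i)" "\<sigma> i" 1]
        height_add_mult[OF N, of p "p (rep N i)" i 1]
      by (simp add: rep_add[OF N])
  qed
  have "inj \<sigma>"
  proof (rule injI)
    fix x y assume "\<sigma> x = \<sigma> y"
    then show "x = y" using color[of x] color[of y] ht[of x] ht[of y]
      by (intro height_inj[OF N, of p x "p (rep N x)" y]) simp_all
  qed
  moreover have "surj \<sigma>"
  proof (rule surjI)
    fix y
    define j where "j = v (rep N y)"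
    have "cnt p j (int N) > 0" unfolding j_def using pos words_rep[OF N v] by simp
    from height_surj[OF N this, of "height N v j y - s j"] obtain i
      where i: "p (rep N i) = j" "height N p j i = height N v j y - s j" by blast
    have "v (rep N (\<sigma> i)) = j" using color[of i] i(1) by simp
    moreover have "height N v j (\<sigma> i) = height N v j y" using ht[of i] unfolding i by simp
    ultimately have "\<sigma> i = y" using height_inj[OF N, of v "\<sigma> i" j y] j_def by metis
    then show "\<sigma> (SOME i. \<sigma> i = y) = y" by (rule someI)
  qed
  ultimately have bij: "bij \<sigma>" by (simp add: bij_def)
  have "(\<Sum>i = 1..int N. lap N (\<sigma> i)) = (\<Sum>j = 1..k. \<Sum>i | i \<in> {1..int N} \<and> p i = j. lap N (\<sigma> i))"
    by (rule sum_classes[OF p])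
  also have "\<dots> = (\<Sum>j = 1..k. s j)"
  proof (intro sum.cong refl)
    fix j assume j: "j \<in> {1..k}"
    show "(\<Sum>i | i \<in> {1..int N} \<and> p i = j. lap N (\<sigma> i)) = s j"
    proof (rule lifts_sum_lap(1)[OF N bij])
      show "height N v j (\<sigma> i) = height N p j i + s j" if "i \<in> {1..int N}" "p i = j" for i
        using ht[of i] that by (simp add: rep_id)
    qed (use per color pos[OF j] in auto)
  qed
  finally have "(\<Sum>i = 1..int N. \<sigma> i) = (\<Sum>i = 1..int N. i)"
    using sum_eq_iff_sum_lap[OF N bij] per s by simp
  then have aff: "affine_permutation N \<sigma>" unfolding affine_permutation_def using bij per by simp
  have incr: "\<sigma> x < \<sigma> y" if "x < y" "p (rep N x) = p (rep N y)" for x y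
  proof (rule ccontr)
    let ?j = "p (rep N y)"
    assume "\<not> \<sigma> x < \<sigma> y"
    then have "height N v ?j (\<sigma> y) \<le> height N v ?j (\<sigma> x)" by (intro height_mono N) simp
    moreover have "height N p ?j x < height N p ?j y" by (rule height_strict_mono[OF N that(1) refl])
    ultimately show False using ht[of x] ht[of y] that by simp
  qed
  have "avoids_decreasing (k + 1) \<sigma>"
    unfolding avoids_decreasing_def
  proof
    assume "\<exists>i. \<forall>a\<in>{1..k + 1}. \<forall>b\<in>{1..k + 1}. a < b \<longrightarrow> i a < i b \<and> \<sigma> (i b) < \<sigma> (i a)"
    then obtain i where i: "\<And>a b. a \<in> {1..k + 1} \<Longrightarrow> b \<in> {1..k + 1} \<Longrightarrow> a < b \<Longrightarrow> i a < i b \<and> \<sigma> (i b) < \<sigma> (i a)"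
      by blast
    \<comment> \<open>Pigeonhole: among \<open>k + 1\<close> positions two share a colour, and on
      one colour \<open>\<sigma>\<close> increases.\<close>
    have "\<not> inj_on (\<lambda>a. p (rep N (i a))) {1..k + 1}"
    proof
      assume "inj_on (\<lambda>a. p (rep N (i a))) {1..k + 1}"
      then have "card {1..k + 1} \<le> card {1..k}"
        by (rule card_inj_on_le) (use words_rep[OF N p] in auto)
      then show False by simp
    qed
    then obtain a b where ab: "a \<in> {1..k + 1}" "b \<in> {1..k + 1}" "a < b" "p (rep N (i a)) = p (rep N (i b))"
      unfolding inj_on_def by (metis linorder_neqE_nat)
    show False using i[OF ab(1-3)] incr[of "i a" "i b"] ab(4) by simp
  qed
  then show thesis by (rule that[OF L aff])
qed

section \<open>Encoding a bounded avoider\<close>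

definition decreasing_to :: "(int \<Rightarrow> int) \<Rightarrow> int \<Rightarrow> nat \<Rightarrow> bool" where
  "decreasing_to \<sigma> i m \<longleftrightarrow> m \<ge> 1 \<and> (\<exists>f :: nat \<Rightarrow> int. f m = i \<and>
     (\<forall>a\<in>{1..m}. \<forall>b\<in>{1..m}. a < b \<longrightarrow> f a < f b \<and> \<sigma> (f a) > \<sigma> (f b)))"

lemma decreasing_to_Suc:
  assumes "decreasing_to \<sigma> i m" "i < i'" "\<sigma> i > \<sigma> i'"
  shows "decreasing_to \<sigma> i' (Suc m)"
proof -
  obtain f where f: "f m = i" "m \<ge> 1"
    "\<And>a b. a \<in> {1..m} \<Longrightarrow> b \<in> {1..m} \<Longrightarrow> a < b \<Longrightarrow> f a < f b \<and> \<sigma> (f a) > \<sigma> (f b)"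
    using assms(1) unfolding decreasing_to_def by blast
  define g where "g = f(Suc m := i')"
  have "g a < g b \<and> \<sigma> (g a) > \<sigma> (g b)" if "a \<in> {1..Suc m}" "b \<in> {1..Suc m}" "a < b" for a b
  proof (cases "b = Suc m")
    case True
    then have a: "a \<in> {1..m}" using that by auto
    have "f a \<le> i \<and> \<sigma> (f a) \<ge> \<sigma> i"
    proof (cases "a = m")
      case False
      then show ?thesis using f(3)[OF a, of m] f(1,2) a by force
    qed (use f in simp)
    then show ?thesis unfolding g_def using True a assms(2,3) by auto
  next
    case False
    then show ?thesis using f(3)[of a b] that unfolding g_def by auto
  qed
  then show ?thesis unfolding decreasing_to_def by (intro conjI exI[of _ g]) (auto simp: g_def)
qed

lemma decreasing_to_shift:
  assumes per: "\<forall>i. \<sigma> (i + int N) = \<sigma> i + int N" and "decreasing_to \<sigma> i m"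
  shows "decreasing_to \<sigma> (i + int N * q) m"
proof -
  obtain f where f: "f m = i" "m \<ge> 1"
    "\<forall>a\<in>{1..m}. \<forall>b\<in>{1..m}. a < b \<longrightarrow> f a < f b \<and> \<sigma> (f a) > \<sigma> (f b)"
    using assms(2) unfolding decreasing_to_def by blast
  then show ?thesis unfolding decreasing_to_def
    by (intro conjI exI[of _ "\<lambda>a. f a + int N * q"]) (auto simp: periodic_mult[OF per])
qed

text \<open>
  Colouring each position by the length of a longest decreasing subsequence ending there splits
  the permutation into at most \<open>k\<close> increasing sequences.
\<close>

lemma avoider_colouring:
  assumes per: "\<forall>i. \<sigma> (i + int N) = \<sigma> i + int N" and av: "avoids_decreasing (k + 1) \<sigma>"
    and inj: "inj \<sigma>"
  shows "\<exists>c :: int \<Rightarrow> nat. (\<forall>i. c i \<in> {1..k}) \<and> (\<forall>i q. c (i + int N * q) = c i) \<and>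
    (\<forall>i i'. i < i' \<longrightarrow> c i = c i' \<longrightarrow> \<sigma> i < \<sigma> i')"
proof -
  have le: "m \<le> k" if "decreasing_to \<sigma> i m" for i m
  proof (rule ccontr)
    assume "\<not> m \<le> k"
    then have "{1..k + 1} \<subseteq> {1..m}" by auto
    then show False using that av unfolding decreasing_to_def avoids_decreasing_def by blast
  qed
  have one: "decreasing_to \<sigma> i 1" for i unfolding decreasing_to_def by (auto intro: exI[of _ "\<lambda>_. i"])
  define c where "c i = Max {m. decreasing_to \<sigma> i m}" for i
  have fin: "finite {m. decreasing_to \<sigma> i m}" for i
    by (rule finite_subset[of _ "{..k}"]) (use le in auto)
  have c: "decreasing_to \<sigma> i (c i)" for i
    unfolding c_def using Max_in[OF fin[of i]] one[of i] by blast
  have c_ge: "m \<le> c i" if "decreasing_to \<sigma> i m" for i m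
    unfolding c_def using that fin by (intro Max_ge) auto
  show ?thesis
  proof (intro exI[of _ c] conjI allI impI)
    show "c i \<in> {1..k}" for i using c_ge[OF one] le[OF c] by simp
    show "c (i + int N * q) = c i" for i q
    proof (rule antisym)
      show "c i \<le> c (i + int N * q)" by (rule c_ge[OF decreasing_to_shift[OF per c]])
      have "decreasing_to \<sigma> (i + int N * q + int N * (- q)) (c (i + int N * q))"
        by (rule decreasing_to_shift[OF per c])
      then show "c (i + int N * q) \<le> c i" by (intro c_ge) simp
    qed
    show "\<sigma> i < \<sigma> i'" if "i < i'" "c i = c i'" for i i'
    proof (rule ccontr)
      assume "\<not> \<sigma> i < \<sigma> i'"
      moreover have "\<sigma> i \<noteq> \<sigma> i'" using inj that(1) by (auto dest: injD)
      \<comment> \<open>At a descent a longest decreasing sequence ending in \<open>i\<close> could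
        be prolonged to \<open>i'\<close>, giving \<open>i'\<close> a larger colour.\<close>
      ultimately have "Suc (c i) \<le> c i'" using decreasing_to_Suc[OF c that(1)] c_ge by simp
      then show False using that(2) by simp
    qed
  qed
qed

text \<open>A value takes the colour of its preimage. On one colour \<open>\<sigma>\<close> is an
  order isomorphism from positions to values, so the difference of the two heights is constant along
  the colour; this constant is the shift.\<close>

lemma bounded_avoider_lifts:
  assumes N: "N > 0" and \<sigma>: "\<sigma> \<in> bounded_avoiders N (k + 1)"
  obtains p v s where "p \<in> words N k" "v \<in> words N k"
    "\<And>j. cnt v j (int N) = cnt p j (int N)"
    "s \<in> {1..k} \<rightarrow>\<^sub>E {- int N..int N}" "(\<Sum>j = 1..k. s j) = 0" "lifts N p v s \<sigma>"
proof -
  have bij: "bij \<sigma>" and per: "\<forall>i. \<sigma> (i + int N) = \<sigma> i + int N"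
    and sum: "(\<Sum>i = 1..int N. \<sigma> i) = (\<Sum>i = 1..int N. i)"
    and bd: "\<And>i. \<bar>\<sigma> i - i\<bar> < int N" and av: "avoids_decreasing (k + 1) \<sigma>"
    using \<sigma> by (auto simp: bounded_avoiders_def bounded_affine_permutation_def affine_permutation_def)
  obtain c where c: "\<And>i. c i \<in> {1..k}" "\<And>i q. c (i + int N * q) = c i"
    "\<And>i i'. i < i' \<Longrightarrow> c i = c i' \<Longrightarrow> \<sigma> i < \<sigma> i'"
    using avoider_colouring[OF per av bij_is_inj[OF bij]] by blast
  define p where "p = restrict c {1..int N}"
  define v where "v = restrict (\<lambda>y. c (inv \<sigma> y)) {1..int N}"
  have c_rep: "c (rep N i) = c i" for i
    using c(2)[of "rep N i" "lap N i"] rep_lap[of i N] by simp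
  have p_rep: "p (rep N i) = c i" for i
    unfolding p_def using rep_in[OF N] c_rep by simp
  have v_rep: "v (rep N (\<sigma> i)) = c i" for i
  proof -
    have "\<sigma> (i + int N * (- lap N (\<sigma> i))) = rep N (\<sigma> i)"
      using periodic_mult[OF per, of i "- lap N (\<sigma> i)"] rep_lap[of "\<sigma> i" N] by simp
    then have "inv \<sigma> (rep N (\<sigma> i)) = i + int N * (- lap N (\<sigma> i))"
      using bij by (metis bij_inv_eq_iff)
    then show ?thesis unfolding v_def using rep_in[OF N] c(2)[of i "- lap N (\<sigma> i)"] by simp
  qed
  have color: "v (rep N (\<sigma> i)) = p (rep N i)" for i using p_rep v_rep by simp
  have pw: "p \<in> words N k" and vw: "v \<in> words N k"
    unfolding words_def p_def v_def using c(1) by auto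
  have less_iff: "\<sigma> x < \<sigma> y \<longleftrightarrow> x < y" if "c x = c y" for x y
    using c(3)[of x y] c(3)[of y x] that by (metis less_asym linorder_neqE)
  \<comment> \<open>Between \<open>a\<close> and \<open>b\<close> both heights grow by the same
    number, since \<open>\<sigma>\<close> maps the positions of this colour in
    \<open>{a<..b}\<close> onto the values of this colour in
    \<open>{\<sigma> a<..\<sigma> b}\<close>.\<close>
  have diff: "height N v (c a) (\<sigma> b) - height N p (c a) b = height N v (c a) (\<sigma> a) - height N p (c a) a"
    if "c a = c b" "a < b" for a b
  proof -
    let ?j = "c a"
    have "\<sigma> ` {i \<in> {a<..b}. p (rep N i) = ?j} = {y \<in> {\<sigma> a<..\<sigma> b}. v (rep N y) = ?j}"
    proof (intro equalityI subsetI)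
      fix y assume "y \<in> \<sigma> ` {i \<in> {a<..b}. p (rep N i) = ?j}"
      then obtain i where i: "y = \<sigma> i" "a < i" "i \<le> b" "c i = ?j" by (auto simp: p_rep)
      then show "y \<in> {y \<in> {\<sigma> a<..\<sigma> b}. v (rep N y) = ?j}"
        using less_iff[of a i] less_iff[of b i] that by (auto simp: v_rep)
    next
      fix y assume y: "y \<in> {y \<in> {\<sigma> a<..\<sigma> b}. v (rep N y) = ?j}"
      obtain i where i: "y = \<sigma> i" using bij by (metis bij_pointE)
      then show "y \<in> \<sigma> ` {i \<in> {a<..b}. p (rep N i) = ?j}"
        using y less_iff[of a i] less_iff[of b i] that by (auto simp: v_rep p_rep)
    qed
    then have "card {y \<in> {\<sigma> a<..\<sigma> b}. v (rep N y) = ?j} = card {i \<in> {a<..b}. p (rep N i) = ?j}"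
      using card_image[OF inj_on_subset[OF bij_is_inj[OF bij] subset_UNIV]] by metis
    moreover have "\<sigma> a < \<sigma> b" using less_iff that by simp
    ultimately show ?thesis
      using height_diff[OF N, of a b p ?j] height_diff[OF N, of "\<sigma> a" "\<sigma> b" v ?j] that by simp
  qed
  have const: "height N v (c a) (\<sigma> b) - height N p (c a) b = height N v (c a) (\<sigma> a) - height N p (c a) a"
    if "c a = c b" for a b
    using diff[of a b] diff[of b a] that by (cases a b rule: linorder_cases) auto
  \<comment> \<open>The value forced by \<open>lifts_sum_lap\<close>; a colour that does not occur
    gets the empty sum 0.\<close>
  define s where "s = restrict (\<lambda>j. \<Sum>i | i \<in> {1..int N} \<and> p i = j. lap N (\<sigma> i)) {1..k}"
  have cnt_eq: "cnt v j (int N) = cnt p j (int N)" for j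
    using bij_betw_same_card[OF lifts_class_bij[OF N bij per, of v p j, OF color]]
    unfolding cnt_def by (simp add: conj_commute)
  have lifts: "lifts N p v s \<sigma>"
    unfolding lifts_def
  proof (intro allI conjI color)
    fix i
    let ?j = "p (rep N i)"
    have j: "?j = c i" "?j \<in> {1..k}" using p_rep c(1) by auto
    have "rep N i \<in> {i \<in> {1..int N}. p i = ?j}" using rep_in[OF N] by simp
    then have pos: "cnt p ?j (int N) > 0" unfolding cnt_def by (subst card_gt_0_iff) auto
    have "(\<Sum>i' | i' \<in> {1..int N} \<and> p i' = ?j. lap N (\<sigma> i')) = height N v ?j (\<sigma> i) - height N p ?j i"
    proof (rule lifts_sum_lap(1)[OF N bij per color _ pos])
      fix i' assume i': "i' \<in> {1..int N}" "p i' = ?j"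
      then have "c i = c i'" using p_rep[of i'] j by (simp add: rep_id)
      then show "height N v ?j (\<sigma> i') = height N p ?j i' + (height N v ?j (\<sigma> i) - height N p ?j i)"
        using const[of i i'] j by simp
    qed
    then show "height N v ?j (\<sigma> i) = height N p ?j i + s ?j" using j by (simp add: s_def)
  qed
  \<comment> \<open>Starting in the base period and moving by less than \<open>N\<close>, a value
    lies in the base period or in an adjacent one. Summed over a colour class this confines the
    shift to \<open>{- N..N}\<close>.\<close>
  have lap1: "\<bar>lap N (\<sigma> i)\<bar> \<le> 1" if "i \<in> {1..int N}" for i
  proof -
    have a: "\<bar>\<sigma> i - i\<bar> < int N" "rep N (\<sigma> i) \<in> {1..int N}" by (rule bd, rule rep_in[OF N])
    have "int N * lap N (\<sigma> i) = \<sigma> i - rep N (\<sigma> i)" using rep_lap[of "\<sigma> i" N] by simp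
    then have "int N * lap N (\<sigma> i) < int N * 2" "int N * (-2) < int N * lap N (\<sigma> i)"
      using a that by auto
    then have "lap N (\<sigma> i) < 2" "- 2 < lap N (\<sigma> i)"
      using mult_less_cancel_left_pos[of "int N"] N by (metis of_nat_0_less_iff)+
    then show ?thesis by simp
  qed
  have s_in: "s j \<in> {- int N..int N}" if "j \<in> {1..k}" for j
  proof -
    have "\<bar>s j\<bar> \<le> (\<Sum>i | i \<in> {1..int N} \<and> p i = j. \<bar>lap N (\<sigma> i)\<bar>)"
      unfolding s_def restrict_apply'[OF that] by (rule sum_abs)
    also have "\<dots> \<le> (\<Sum>i | i \<in> {1..int N} \<and> p i = j. 1)" by (intro sum_mono lap1) auto
    also have "\<dots> \<le> (\<Sum>i\<in>{1..int N}. 1)" by (intro sum_mono2) auto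
    finally show ?thesis by auto
  qed
  have "(\<Sum>j = 1..k. s j) = (\<Sum>i = 1..int N. lap N (\<sigma> i))"
    unfolding sum_classes[OF pw] s_def by simp
  then have "(\<Sum>j = 1..k. s j) = 0" using sum sum_eq_iff_sum_lap[OF N bij per] by simp
  moreover have "s \<in> {1..k} \<rightarrow>\<^sub>E {- int N..int N}"
    using s_in unfolding s_def by (intro PiE_I) auto
  ultimately show thesis using lifts by (intro that[OF pw vw cnt_eq])
qed

section \<open>Good encodings and the displacements they produce\<close>

definition good_words :: "nat \<Rightarrow> nat \<Rightarrow> real \<Rightarrow> (int \<Rightarrow> nat) set" where
  "good_words N k e = {p \<in> words N k. \<forall>j\<in>{1..k}. \<forall>x\<in>{1..int N}.
     \<bar>real (cnt p j x) - real_of_int x / real k\<bar> \<le> e * real N}"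

definition good_pairs :: "nat \<Rightarrow> nat \<Rightarrow> real \<Rightarrow> ((int \<Rightarrow> nat) \<times> (int \<Rightarrow> nat)) set" where
  "good_pairs N k e = {(p, v). p \<in> good_words N k e \<and> v \<in> good_words N k e \<and>
     (\<forall>j\<in>{1..k}. cnt v j (int N) = cnt p j (int N))}"

text \<open>
  If both words are good with tolerance \<open>e\<close>, then the displacement of a position of colour \<open>j\<close>
  differs from \<open>k s\<^sub>j\<close> by at most \<open>slack k * e * N\<close>.
\<close>

definition slack :: "nat \<Rightarrow> real" where
  "slack k = real k * (2 * real k + 3)"

text \<open>
  The first condition forces boundedness, and the term \<open>k\<^sup>2\<close> keeps the grid cell of \<open>s\<close> inside \<open>Q\<^sub>0\<close>. By
  the second one the displacements of different colours form disjoint clusters, so that the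
  permutation determines its colouring up to relabelling.
\<close>

definition good_shifts :: "nat \<Rightarrow> nat \<Rightarrow> real \<Rightarrow> (nat \<Rightarrow> int) set" where
  "good_shifts N k e = {s \<in> {1..k} \<rightarrow>\<^sub>E UNIV. (\<Sum>j = 1..k. s j) = 0 \<and>
     (\<forall>j\<in>{1..k}. real k * \<bar>real_of_int (s j)\<bar> + slack k * e * real N + real k ^ 2 < real N) \<and>
     (\<forall>i\<in>{1..k}. \<forall>j\<in>{1..k}. i \<noteq> j \<longrightarrow>
        4 * slack k * e * real N < real k * \<bar>real_of_int (s i) - real_of_int (s j)\<bar>)}"

text \<open>The margin is taken outwards here, for two reasons: it must admit the shifts of every
  bounded avoider with good words, and also the rounding of every point of \<open>Q0 k\<close>,
  which may overshoot by \<open>k ^ 2\<close>.\<close>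

definition all_shifts :: "nat \<Rightarrow> nat \<Rightarrow> real \<Rightarrow> (nat \<Rightarrow> int) set" where
  "all_shifts N k e = {s \<in> {1..k} \<rightarrow>\<^sub>E UNIV. (\<Sum>j = 1..k. s j) = 0 \<and>
     (\<forall>j\<in>{1..k}. real k * \<bar>real_of_int (s j)\<bar> \<le> real N + slack k * e * real N + real k ^ 2)}"

definition good_triples ::
  "nat \<Rightarrow> nat \<Rightarrow> real \<Rightarrow> ((int \<Rightarrow> nat) \<times> (int \<Rightarrow> nat) \<times> (nat \<Rightarrow> int)) set" where
  "good_triples N k e = {(p, v, s). (p, v) \<in> good_pairs N k e \<and> s \<in> good_shifts N k e}"

definition perm_of :: "nat \<Rightarrow> (int \<Rightarrow> nat) \<times> (int \<Rightarrow> nat) \<times> (nat \<Rightarrow> int) \<Rightarrow> int \<Rightarrow> int" where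
  "perm_of N = (\<lambda>(p, v, s). THE \<sigma>. lifts N p v s \<sigma>)"

lemma perm_of_eq: "N > 0 \<Longrightarrow> lifts N p v s \<sigma> \<Longrightarrow> perm_of N (p, v, s) = \<sigma>"
  unfolding perm_of_def using lifts_unique by (auto intro!: the_equality)

lemma finite_words [simp]: "finite (words N k)"
  by (simp add: words_def finite_PiE)

lemma finite_good_pairs [simp]: "finite (good_pairs N k e)"
  by (rule finite_subset[of _ "words N k \<times> words N k"]) (auto simp: good_pairs_def good_words_def)

lemma good_words_words: "p \<in> good_words N k e \<Longrightarrow> p \<in> words N k"
  by (simp add: good_words_def)

lemma good_wordD:
  "p \<in> good_words N k e \<Longrightarrow> j \<in> {1..k} \<Longrightarrow> x \<in> {1..int N} \<Longrightarrow>
    \<bar>real (cnt p j x) - real_of_int x / real k\<bar> \<le> e * real N"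
  unfolding good_words_def by blast

lemma cnt_mono: "x \<le> y \<Longrightarrow> cnt p j x \<le> cnt p j y"
  unfolding cnt_def by (intro card_mono) auto

text \<open>A tolerance of at most half the expected frequency \<open>1 / k\<close> leaves the other
  half. It ensures that every colour occurs and that a bounded shift means boundedly many
  laps.\<close>

lemma good_word_cnt_ge:
  assumes "p \<in> good_words N k e" "j \<in> {1..k}" "N > 0" "e \<le> 1 / (2 * real k)"
  shows "real N \<le> 2 * real k * real (cnt p j (int N))"
proof -
  have k: "real k > 0" using assms(2) by simp
  have "\<bar>real (cnt p j (int N)) - real N / real k\<bar> \<le> e * real N"
    using good_wordD[OF assms(1,2), of "int N"] assms(3) by simp
  also have "\<dots> \<le> 1 / (2 * real k) * real N" using assms(4) by (intro mult_right_mono) auto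
  finally have "real N / real k - 1 / (2 * real k) * real N \<le> real (cnt p j (int N))" by linarith
  then show ?thesis using k by (simp add: field_simps)
qed

lemma good_word_cnt_pos:
  assumes "p \<in> good_words N k e" "j \<in> {1..k}" "N > 0" "e \<le> 1 / (2 * real k)"
  shows "cnt p j (int N) > 0"
proof (rule ccontr)
  assume "\<not> cnt p j (int N) > 0"
  then show False using good_word_cnt_ge[OF assms] assms(3) by simp
qed

lemma good_word_ex:
  assumes "p \<in> good_words N k e" "j \<in> {1..k}" "N > 0" "e \<le> 1 / (2 * real k)"
  obtains i where "i \<in> {1..int N}" "p i = j"
proof -
  have "{i \<in> {1..int N}. p i = j} \<noteq> {}"
    using good_word_cnt_pos[OF assms] unfolding cnt_def by (metis card.empty less_irrefl)
  then obtain i where "i \<in> {1..int N}" "p i = j" by blast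
  then show thesis by (rule that)
qed

text \<open>The prefix error \<open>e * N\<close> is incurred once for the partial period and once
  more for each full lap.\<close>

lemma good_height:
  assumes p: "p \<in> good_words N k e" and j: "j \<in> {1..k}" and N: "N > 0"
  shows "\<bar>real_of_int (height N p j x) - real_of_int x / real k\<bar> \<le> e * real N * (1 + \<bar>real_of_int (lap N x)\<bar>)"
proof -
  let ?L = "real_of_int (lap N x)" and ?r = "real_of_int (rep N x)" and ?n = "real (cnt p j (int N))"
  have k: "real k > 0" using j by simp
  have n: "\<bar>?n - real N / real k\<bar> \<le> e * real N"
    using good_wordD[OF p j, of "int N"] N by simp
  have c: "\<bar>real (cnt p j (rep N x)) - ?r / real k\<bar> \<le> e * real N"
    by (rule good_wordD[OF p j rep_in[OF N]])
  have "real_of_int x = ?r + real N * ?L"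
    using rep_lap[of x N] by (metis of_int_add of_int_mult of_int_of_nat_eq)
  then have "real_of_int (height N p j x) - real_of_int x / real k
    = (?n - real N / real k) * ?L + (real (cnt p j (rep N x)) - ?r / real k)"
    unfolding height_def using k by (simp add: field_simps)
  also have "\<bar>\<dots>\<bar> \<le> \<bar>?n - real N / real k\<bar> * \<bar>?L\<bar> + \<bar>real (cnt p j (rep N x)) - ?r / real k\<bar>"
    using abs_triangle_ineq abs_mult by metis
  also have "\<dots> \<le> e * real N * \<bar>?L\<bar> + e * real N"
    using n c by (intro add_mono mult_right_mono) auto
  finally show ?thesis by (simp add: algebra_simps)
qed

text \<open>In good words a height is its position divided by \<open>k\<close> up to a small error,
  so the height equation becomes \<open>\<sigma> i / k = i / k + s j\<close> approximately. A class
  has at least \<open>N / (2 * k)\<close> letters, hence at most \<open>1 + 2 * k\<close> laps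
  occur; the errors \<open>(2 + 2 * k) * e * N\<close> for the value and \<open>e * N\<close> for
  the position, multiplied by \<open>k\<close>, give \<open>slack k * e * N\<close>.\<close>

lemma lifts_displacement:
  assumes N: "N > 0" and pv: "(p, v) \<in> good_pairs N k e" and e: "e \<le> 1 / (2 * real k)" "0 \<le> e"
    and L: "lifts N p v s \<sigma>" and s: "\<And>j. j \<in> {1..k} \<Longrightarrow> \<bar>s j\<bar> \<le> int N"
    and i: "i \<in> {1..int N}"
  shows "\<bar>real_of_int (\<sigma> i) - real_of_int i - real k * real_of_int (s (p i))\<bar> \<le> slack k * e * real N"
proof -
  have p: "p \<in> good_words N k e" and v: "v \<in> good_words N k e"
    and eq: "\<And>j. j \<in> {1..k} \<Longrightarrow> cnt v j (int N) = cnt p j (int N)"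
    using pv by (auto simp: good_pairs_def)
  define j where "j = p i"
  have j: "j \<in> {1..k}" using words_rep[OF N good_words_words[OF p], of i] i by (simp add: rep_id j_def)
  have k: "real k > 0" using j by simp
  let ?L = "lap N (\<sigma> i)" and ?n = "cnt p j (int N)"
  have n: "?n > 0" by (rule good_word_cnt_pos[OF p j N e(1)])
  have hv: "height N v j (\<sigma> i) = int (cnt p j i) + s j"
    using L i unfolding lifts_def j_def by (metis height_base rep_id)
  have hp: "\<bar>real (cnt p j i) - real_of_int i / real k\<bar> \<le> e * real N"
    by (rule good_wordD[OF p j i])
  have "\<bar>int ?n * ?L\<bar> \<le> int ?n + int N"
  proof -
    have "int ?n * ?L = int (cnt p j i) + s j - int (cnt v j (rep N (\<sigma> i)))"
      using hv eq[OF j] unfolding height_def by simp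
    moreover have "cnt p j i \<le> ?n" "cnt v j (rep N (\<sigma> i)) \<le> ?n"
      using cnt_mono[of i "int N" p j] cnt_mono[of "rep N (\<sigma> i)" "int N" v j] i rep_in[OF N, of "\<sigma> i"] eq[OF j]
      by auto
    ultimately show ?thesis using s[OF j] by linarith
  qed
  then have "real_of_int \<bar>int ?n * ?L\<bar> \<le> real_of_int (int ?n + int N)" by linarith
  then have "real ?n * \<bar>real_of_int ?L\<bar> \<le> real ?n + real N" by (simp add: abs_mult)
  also have "\<dots> \<le> real ?n + 2 * real k * real ?n"
    using good_word_cnt_ge[OF p j N e(1)] by simp
  also have "\<dots> = real ?n * (1 + 2 * real k)" by (simp add: algebra_simps)
  finally have Lb: "\<bar>real_of_int ?L\<bar> \<le> 1 + 2 * real k" using n by simp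
  have "\<bar>real_of_int (height N v j (\<sigma> i)) - real_of_int (\<sigma> i) / real k\<bar> \<le> e * real N * (1 + \<bar>real_of_int ?L\<bar>)"
    by (rule good_height[OF v j N])
  also have "\<dots> \<le> e * real N * (2 + 2 * real k)" using Lb e(2) by (intro mult_left_mono) auto
  finally have "\<bar>real_of_int (height N v j (\<sigma> i)) - real_of_int (\<sigma> i) / real k\<bar> \<le> e * real N * (2 + 2 * real k)" .
  then have "\<bar>(real_of_int (\<sigma> i) - real_of_int i) / real k - real_of_int (s j)\<bar>
    \<le> e * real N * (2 + 2 * real k) + e * real N"
    using hp unfolding hv diff_divide_distrib by simp
  also have "\<dots> = e * real N * (3 + 2 * real k)" by (simp add: algebra_simps)
  finally have "real k * \<bar>(real_of_int (\<sigma> i) - real_of_int i) / real k - real_of_int (s j)\<bar>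
    \<le> real k * (e * real N * (3 + 2 * real k))" using k by simp
  also have "real k * \<bar>(real_of_int (\<sigma> i) - real_of_int i) / real k - real_of_int (s j)\<bar>
    = \<bar>real k * ((real_of_int (\<sigma> i) - real_of_int i) / real k - real_of_int (s j))\<bar>"
    using k by (simp add: abs_mult)
  also have "real k * ((real_of_int (\<sigma> i) - real_of_int i) / real k - real_of_int (s j))
    = real_of_int (\<sigma> i) - real_of_int i - real k * real_of_int (s j)"
    using k by (subst right_diff_distrib) simp
  finally show ?thesis unfolding slack_def j_def by (simp add: algebra_simps)
qed

lemma slack_nonneg: "0 \<le> slack k"
  by (simp add: slack_def)

lemma good_shifts_le:
  assumes "s \<in> good_shifts N k e" "j \<in> {1..k}" "0 \<le> e"
  shows "\<bar>s j\<bar> \<le> int N"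
proof -
  have "real k * \<bar>real_of_int (s j)\<bar> + slack k * e * real N + real k ^ 2 < real N"
    using assms by (auto simp: good_shifts_def)
  moreover have "0 \<le> slack k * e * real N" using assms(3) slack_nonneg by simp
  moreover have "1 * \<bar>real_of_int (s j)\<bar> \<le> real k * \<bar>real_of_int (s j)\<bar>"
    using assms(2) by (intro mult_right_mono) auto
  moreover have "0 \<le> real k ^ 2" by simp
  ultimately have "\<bar>real_of_int (s j)\<bar> < real N" by linarith
  then show ?thesis by linarith
qed

lemma finite_good_shifts:
  assumes "0 \<le> e" shows "finite (good_shifts N k e)"
proof (rule finite_subset)
  show "good_shifts N k e \<subseteq> {1..k} \<rightarrow>\<^sub>E {- int N..int N}"
  proof
    fix s assume s: "s \<in> good_shifts N k e"
    then have "s j \<in> {- int N..int N}" if "j \<in> {1..k}" for j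
      using good_shifts_le[OF s that assms] by (simp add: abs_le_iff)
    then show "s \<in> {1..k} \<rightarrow>\<^sub>E {- int N..int N}" using s by (auto simp: good_shifts_def PiE_def)
  qed
qed (simp add: finite_PiE)

text \<open>Only boundedness is new compared with \<open>lifts_exists\<close>: in the base period
  the displacement is at most \<open>k * \<bar>s j\<bar>\<close> plus the slack, which
  \<open>good_shifts\<close> keeps below \<open>N\<close>, and periodicity spreads this to all
  positions.\<close>

lemma good_triple_perm:
  assumes N: "N > 0" and e: "e \<le> 1 / (2 * real k)" "0 \<le> e" and t: "(p, v, s) \<in> good_triples N k e"
  shows "lifts N p v s (perm_of N (p, v, s))" "perm_of N (p, v, s) \<in> bounded_avoiders N (k + 1)"
proof -
  have pv: "(p, v) \<in> good_pairs N k e" and s: "s \<in> good_shifts N k e"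
    using t by (auto simp: good_triples_def)
  have p: "p \<in> good_words N k e" and v: "v \<in> good_words N k e"
    and eq: "\<And>j. j \<in> {1..k} \<Longrightarrow> cnt v j (int N) = cnt p j (int N)"
    using pv by (auto simp: good_pairs_def)
  have "(\<Sum>j = 1..k. s j) = 0" using s by (simp add: good_shifts_def)
  then obtain \<sigma> where \<sigma>: "lifts N p v s \<sigma>" "affine_permutation N \<sigma>" "avoids_decreasing (k + 1) \<sigma>"
    using lifts_exists[OF N good_words_words[OF p] good_words_words[OF v] eq good_word_cnt_pos[OF p _ N e(1)]]
    by metis
  have base: "\<bar>\<sigma> i - i\<bar> < int N" if i: "i \<in> {1..int N}" for i
  proof -
    have j: "p i \<in> {1..k}" using good_words_words[OF p] i by (auto simp: words_def)
    have "real k * \<bar>real_of_int (s (p i))\<bar> + slack k * e * real N + real k ^ 2 < real N"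
      using s j by (auto simp: good_shifts_def)
    moreover have "\<bar>real_of_int (\<sigma> i) - real_of_int i - real k * real_of_int (s (p i))\<bar> \<le> slack k * e * real N"
      using good_shifts_le[OF s _ e(2)] by (intro lifts_displacement[OF N pv e \<sigma>(1) _ i])
    moreover have "\<bar>real k * real_of_int (s (p i))\<bar> = real k * \<bar>real_of_int (s (p i))\<bar>" by (simp add: abs_mult)
    moreover have "0 \<le> real k ^ 2" by simp
    ultimately have "\<bar>real_of_int (\<sigma> i) - real_of_int i\<bar> < real N" by linarith
    then show ?thesis by linarith
  qed
  have per: "\<forall>i. \<sigma> (i + int N) = \<sigma> i + int N" using \<sigma>(2) by (simp add: affine_permutation_def)
  have "\<bar>\<sigma> i - i\<bar> < int N" for i
  proof -
    have "\<sigma> i = \<sigma> (rep N i) + int N * lap N i"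
      using periodic_mult[OF per, of "rep N i" "lap N i"] rep_lap[of i N] by simp
    then have "\<sigma> i - i = \<sigma> (rep N i) - rep N i" using rep_lap[of i N] by simp
    then show ?thesis using base[OF rep_in[OF N]] by simp
  qed
  then have "\<sigma> \<in> bounded_avoiders N (k + 1)"
    using \<sigma> by (simp add: bounded_avoiders_def bounded_affine_permutation_def)
  then show "lifts N p v s (perm_of N (p, v, s))" "perm_of N (p, v, s) \<in> bounded_avoiders N (k + 1)"
    using perm_of_eq[OF N \<sigma>(1)] \<sigma>(1) by simp_all
qed

definition bad_pairs :: "nat \<Rightarrow> nat \<Rightarrow> real \<Rightarrow> ((int \<Rightarrow> nat) \<times> (int \<Rightarrow> nat)) set" where
  "bad_pairs N k e = {(p, v). p \<in> words N k \<and> v \<in> words N k \<and> \<not> (p \<in> good_words N k e \<and> v \<in> good_words N k e)}"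

text \<open>An overcount. For bad words neither equal letter counts nor the zero sum of the shifts
  is kept, as their exponential rarity pays for that; for good words only the shifts in the thin
  layer outside \<open>good_shifts\<close> are listed.\<close>

definition bad_triples ::
  "nat \<Rightarrow> nat \<Rightarrow> real \<Rightarrow> ((int \<Rightarrow> nat) \<times> (int \<Rightarrow> nat) \<times> (nat \<Rightarrow> int)) set" where
  "bad_triples N k e =
     {(p, v, s). (p, v) \<in> bad_pairs N k e \<and> s \<in> {1..k} \<rightarrow>\<^sub>E {- int N..int N}} \<union>
     {(p, v, s). (p, v) \<in> good_pairs N k e \<and> s \<in> all_shifts N k e - good_shifts N k e}"

text \<open>With good words every colour occurs, and the displacement of one of its positions, being
  below \<open>N\<close>, bounds the shift of that colour from above.\<close>

lemma bounded_avoiders_subset: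
  assumes N: "N > 0" and e: "e \<le> 1 / (2 * real k)" "0 \<le> e"
  shows "bounded_avoiders N (k + 1) \<subseteq> perm_of N ` good_triples N k e \<union> perm_of N ` bad_triples N k e"
proof
  fix \<sigma> assume \<sigma>: "\<sigma> \<in> bounded_avoiders N (k + 1)"
  obtain p v s where t: "p \<in> words N k" "v \<in> words N k"
    "\<And>j. cnt v j (int N) = cnt p j (int N)"
    "s \<in> {1..k} \<rightarrow>\<^sub>E {- int N..int N}" "(\<Sum>j = 1..k. s j) = 0" "lifts N p v s \<sigma>"
    using bounded_avoider_lifts[OF N \<sigma>] by metis
  have "(p, v, s) \<in> good_triples N k e \<union> bad_triples N k e"
  proof (cases "p \<in> good_words N k e \<and> v \<in> good_words N k e")
    case False
    then show ?thesis using t by (auto simp: bad_triples_def bad_pairs_def)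
  next
    case True
    then have pv: "(p, v) \<in> good_pairs N k e" using t(3) by (auto simp: good_pairs_def)
    have "s \<in> all_shifts N k e"
      unfolding all_shifts_def
    proof (intro CollectI conjI ballI)
      fix j assume j: "j \<in> {1..k}"
      obtain i where i: "i \<in> {1..int N}" "p i = j"
        using good_word_ex[OF conjunct1[OF True] j N e(1)] by metis
      have "\<bar>real_of_int (\<sigma> i) - real_of_int i - real k * real_of_int (s (p i))\<bar> \<le> slack k * e * real N"
      proof (rule lifts_displacement[OF N pv e t(6) _ i(1)])
        fix j assume "j \<in> {1..k}"
        then have "s j \<in> {- int N..int N}" using t(4) by (auto simp: PiE_def)
        then show "\<bar>s j\<bar> \<le> int N" by auto
      qed
      moreover have "\<bar>\<sigma> i - i\<bar> < int N"
        using \<sigma> by (auto simp: bounded_avoiders_def bounded_affine_permutation_def)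
      then have "\<bar>real_of_int (\<sigma> i) - real_of_int i\<bar> < real N" by linarith
      moreover have "\<bar>real k * real_of_int (s j)\<bar> = real k * \<bar>real_of_int (s j)\<bar>" by (simp add: abs_mult)
      moreover have "0 \<le> real k ^ 2" by simp
      ultimately show "real k * \<bar>real_of_int (s j)\<bar> \<le> real N + slack k * e * real N + real k ^ 2"
        unfolding i(2) by linarith
    qed (use t in \<open>auto simp: PiE_def\<close>)
    then show ?thesis using pv by (auto simp: good_triples_def bad_triples_def)
  qed
  then show "\<sigma> \<in> perm_of N ` good_triples N k e \<union> perm_of N ` bad_triples N k e"
    using perm_of_eq[OF N t(6)] by blast
qed

section \<open>Relabelling the colours\<close>

definition relabel :: "nat \<Rightarrow> nat \<Rightarrow> (nat \<Rightarrow> nat) \<Rightarrow>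
    (int \<Rightarrow> nat) \<times> (int \<Rightarrow> nat) \<times> (nat \<Rightarrow> int) \<Rightarrow> (int \<Rightarrow> nat) \<times> (int \<Rightarrow> nat) \<times> (nat \<Rightarrow> int)" where
  "relabel N k \<pi> = (\<lambda>(p, v, s). (restrict (\<pi> \<circ> p) {1..int N}, restrict (\<pi> \<circ> v) {1..int N},
     restrict (s \<circ> inv \<pi>) {1..k}))"

lemma cnt_relabel:
  assumes "inj \<pi>" "x \<le> int N"
  shows "cnt (restrict (\<pi> \<circ> p) {1..int N}) (\<pi> j) x = cnt p j x"
proof -
  have "{i \<in> {1..x}. restrict (\<pi> \<circ> p) {1..int N} i = \<pi> j} = {i \<in> {1..x}. p i = j}"
    by (rule Collect_cong) (use assms in \<open>auto simp: inj_eq\<close>)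
  then show ?thesis by (simp only: cnt_def)
qed

lemma height_relabel:
  assumes "inj \<pi>" "N > 0"
  shows "height N (restrict (\<pi> \<circ> p) {1..int N}) (\<pi> j) x = height N p j x"
  unfolding height_def using rep_in[OF assms(2), of x] by (simp add: cnt_relabel[OF assms(1)])

lemma good_words_relabel:
  assumes \<pi>: "\<pi> permutes {1..k}" and p: "p \<in> good_words N k e"
  shows "restrict (\<pi> \<circ> p) {1..int N} \<in> good_words N k e"
  unfolding good_words_def
proof (intro CollectI conjI ballI)
  show "restrict (\<pi> \<circ> p) {1..int N} \<in> words N k"
    using good_words_words[OF p] permutes_in_image[OF \<pi>] by (auto simp: words_def)
  fix j x assume j: "j \<in> {1..k}" and x: "x \<in> {1..int N}"
  have "inv \<pi> j \<in> {1..k}" using permutes_in_image[OF permutes_inv[OF \<pi>]] j by blast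
  moreover have "cnt (restrict (\<pi> \<circ> p) {1..int N}) j x = cnt p (inv \<pi> j) x"
    using cnt_relabel[OF permutes_inj[OF \<pi>], of x N p "inv \<pi> j"] x permutes_inverses(1)[OF \<pi>] by simp
  ultimately show "\<bar>real (cnt (restrict (\<pi> \<circ> p) {1..int N}) j x) - real_of_int x / real k\<bar> \<le> e * real N"
    using p x by (auto simp: good_words_def)
qed

lemma good_triples_relabel:
  assumes \<pi>: "\<pi> permutes {1..k}" and t: "(p, v, s) \<in> good_triples N k e"
  shows "relabel N k \<pi> (p, v, s) \<in> good_triples N k e"
proof -
  have inv_in: "inv \<pi> j \<in> {1..k}" if "j \<in> {1..k}" for j
    using permutes_in_image[OF permutes_inv[OF \<pi>]] that by blast
  have inv_eq: "inv \<pi> i = inv \<pi> j \<longleftrightarrow> i = j" for i j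
    using permutes_inj[OF permutes_inv[OF \<pi>]] by (auto dest: injD)
  have pv: "p \<in> good_words N k e" "v \<in> good_words N k e"
    and eq: "\<And>j. j \<in> {1..k} \<Longrightarrow> cnt v j (int N) = cnt p j (int N)" and s: "s \<in> good_shifts N k e"
    using t by (auto simp: good_triples_def good_pairs_def)
  have "cnt (restrict (\<pi> \<circ> v) {1..int N}) j (int N) = cnt (restrict (\<pi> \<circ> p) {1..int N}) j (int N)"
    if "j \<in> {1..k}" for j
    using cnt_relabel[OF permutes_inj[OF \<pi>], of "int N" N p "inv \<pi> j"]
      cnt_relabel[OF permutes_inj[OF \<pi>], of "int N" N v "inv \<pi> j"]
      permutes_inverses(1)[OF \<pi>] eq[OF inv_in[OF that]] by simp
  then have "(restrict (\<pi> \<circ> p) {1..int N}, restrict (\<pi> \<circ> v) {1..int N}) \<in> good_pairs N k e"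
    using good_words_relabel[OF \<pi>] pv by (auto simp: good_pairs_def)
  moreover have "restrict (s \<circ> inv \<pi>) {1..k} \<in> good_shifts N k e"
    unfolding good_shifts_def
  proof (intro CollectI conjI ballI impI)
    have "(\<Sum>j = 1..k. restrict (s \<circ> inv \<pi>) {1..k} j) = (\<Sum>j = 1..k. (s \<circ> inv \<pi>) j)"
      by (intro sum.cong) auto
    also have "\<dots> = (\<Sum>j = 1..k. s j)" by (rule sum.permute[OF permutes_inv[OF \<pi>], symmetric])
    finally show "(\<Sum>j = 1..k. restrict (s \<circ> inv \<pi>) {1..k} j) = 0"
      using s by (simp add: good_shifts_def)
  next
    fix j assume "j \<in> {1..k}"
    then show "real k * \<bar>real_of_int (restrict (s \<circ> inv \<pi>) {1..k} j)\<bar> + slack k * e * real N + real k ^ 2 < real N"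
      using s inv_in[of j] by (auto simp: good_shifts_def)
  next
    fix i j assume "i \<in> {1..k}" "j \<in> {1..k}" "i \<noteq> j"
    then show "4 * slack k * e * real N < real k *
        \<bar>real_of_int (restrict (s \<circ> inv \<pi>) {1..k} i) - real_of_int (restrict (s \<circ> inv \<pi>) {1..k} j)\<bar>"
      using s inv_in[of i] inv_in[of j] inv_eq by (auto simp: good_shifts_def)
  qed auto
  ultimately show ?thesis by (simp add: relabel_def good_triples_def)
qed

text \<open>Strands and their heights are untouched, only their names change: colour
  \<open>\<pi> j\<close> now carries the shift of \<open>j\<close>, which is why the shift component
  is composed with \<open>inv \<pi>\<close>.\<close>

lemma lifts_relabel:
  assumes N: "N > 0" and \<pi>: "\<pi> permutes {1..k}" and p: "p \<in> words N k" and L: "lifts N p v s \<sigma>"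
  shows "lifts N (restrict (\<pi> \<circ> p) {1..int N}) (restrict (\<pi> \<circ> v) {1..int N}) (restrict (s \<circ> inv \<pi>) {1..k}) \<sigma>"
  unfolding lifts_def
proof (intro allI)
  fix i
  have c: "restrict (\<pi> \<circ> p) {1..int N} (rep N i) = \<pi> (p (rep N i))" for p i
    using rep_in[OF N] by simp
  have j: "\<pi> (p (rep N i)) \<in> {1..k}" using words_rep[OF N p] permutes_in_image[OF \<pi>] by blast
  show "restrict (\<pi> \<circ> v) {1..int N} (rep N (\<sigma> i)) = restrict (\<pi> \<circ> p) {1..int N} (rep N i) \<and>
    height N (restrict (\<pi> \<circ> v) {1..int N}) (restrict (\<pi> \<circ> p) {1..int N} (rep N i)) (\<sigma> i)
    = height N (restrict (\<pi> \<circ> p) {1..int N}) (restrict (\<pi> \<circ> p) {1..int N} (rep N i)) i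
      + restrict (s \<circ> inv \<pi>) {1..k} (restrict (\<pi> \<circ> p) {1..int N} (rep N i))"
    unfolding c height_relabel[OF permutes_inj[OF \<pi>] N]
    using L j permutes_inverses(2)[OF \<pi>] by (simp add: lifts_def)
qed

text \<open>Two positions of one \<open>p\<close>-colour have displacements at most
  \<open>2 * slack k * e * N\<close> apart. If their \<open>p'\<close>-colours differed, their
  displacements would be more than \<open>(4 - 2) * slack k * e * N\<close> apart; this is the
  origin of the factor 4 in \<open>good_shifts\<close>.\<close>

lemma good_triple_partition:
  assumes N: "N > 0" and e: "e \<le> 1 / (2 * real k)" "0 \<le> e"
    and t: "(p, v, s) \<in> good_triples N k e" and t': "(p', v', s') \<in> good_triples N k e"
    and L: "lifts N p v s \<sigma>" and L': "lifts N p' v' s' \<sigma>"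
    and i: "i \<in> {1..int N}" "i' \<in> {1..int N}" "p i = p i'"
  shows "p' i = p' i'"
proof (rule ccontr)
  assume ne: "p' i \<noteq> p' i'"
  have s: "s \<in> good_shifts N k e" "s' \<in> good_shifts N k e"
    and pv: "(p, v) \<in> good_pairs N k e" "(p', v') \<in> good_pairs N k e"
    using t t' by (auto simp: good_triples_def)
  have D: "\<bar>real_of_int (\<sigma> i) - real_of_int i - real k * real_of_int (s (p i))\<bar> \<le> slack k * e * real N"
    if "i \<in> {1..int N}" for i
    using good_shifts_le[OF s(1) _ e(2)] by (intro lifts_displacement[OF N pv(1) e L _ that])
  have D': "\<bar>real_of_int (\<sigma> i) - real_of_int i - real k * real_of_int (s' (p' i))\<bar> \<le> slack k * e * real N"
    if "i \<in> {1..int N}" for i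
    using good_shifts_le[OF s(2) _ e(2)] by (intro lifts_displacement[OF N pv(2) e L' _ that])
  have "p' \<in> words N k" using pv by (auto simp: good_pairs_def good_words_def)
  then have "p' i \<in> {1..k}" "p' i' \<in> {1..k}" using i unfolding words_def by blast+
  then have "4 * slack k * e * real N < real k * \<bar>real_of_int (s' (p' i)) - real_of_int (s' (p' i'))\<bar>"
    using s(2) ne by (auto simp: good_shifts_def)
  also have "\<dots> = \<bar>real k * real_of_int (s' (p' i)) - real k * real_of_int (s' (p' i'))\<bar>"
    by (simp add: abs_mult flip: right_diff_distrib)
  finally show False using D[OF i(1)] D[OF i(2)] D'[OF i(1)] D'[OF i(2)] unfolding i(3) by linarith
qed

text \<open>A fibre is one free orbit of the symmetric group. Freeness holds because every colour
  occurs; transitivity because two encodings partition the positions equally, so they differ by a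
  permutation of names, and this permutation determines the value word and the shifts.\<close>

lemma card_fibre:
  assumes N: "N > 0" and e: "e \<le> 1 / (2 * real k)" "0 \<le> e"
    and \<sigma>: "\<sigma> \<in> perm_of N ` good_triples N k e"
  shows "card {t \<in> good_triples N k e. perm_of N t = \<sigma>} = fact k"
proof -
  obtain p v s where t: "(p, v, s) \<in> good_triples N k e" "\<sigma> = perm_of N (p, v, s)"
    using \<sigma> by auto
  have L: "lifts N p v s \<sigma>" using good_triple_perm(1)[OF N e t(1)] t(2) by simp
  have pg: "p \<in> good_words N k e" and pw: "p \<in> words N k" and vw: "v \<in> words N k"
    and sE: "s \<in> extensional {1..k}"
    using t(1) by (auto simp: good_triples_def good_pairs_def good_words_def good_shifts_def PiE_def)
  have "bij_betw (\<lambda>\<pi>. relabel N k \<pi> (p, v, s)) {\<pi>. \<pi> permutes {1..k}}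
      {t \<in> good_triples N k e. perm_of N t = \<sigma>}"
  proof (rule bij_betw_imageI)
    show "inj_on (\<lambda>\<pi>. relabel N k \<pi> (p, v, s)) {\<pi>. \<pi> permutes {1..k}}"
    proof (rule inj_onI, rule ext)
      fix \<pi> \<pi>' j
      assume \<pi>: "\<pi> \<in> {\<pi>. \<pi> permutes {1..k}}" "\<pi>' \<in> {\<pi>. \<pi> permutes {1..k}}"
        and eq: "relabel N k \<pi> (p, v, s) = relabel N k \<pi>' (p, v, s)"
      show "\<pi> j = \<pi>' j"
      proof (cases "j \<in> {1..k}")
        case True
        then obtain i where i: "i \<in> {1..int N}" "p i = j"
          using good_word_ex[OF pg _ N e(1)] by metis
        have "restrict (\<pi> \<circ> p) {1..int N} i = restrict (\<pi>' \<circ> p) {1..int N} i"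
          using eq by (simp add: relabel_def)
        then show ?thesis using i by simp
      next
        case False
        then show ?thesis using \<pi> by (simp add: permutes_def)
      qed
    qed
    show "(\<lambda>\<pi>. relabel N k \<pi> (p, v, s)) ` {\<pi>. \<pi> permutes {1..k}}
      = {t \<in> good_triples N k e. perm_of N t = \<sigma>}"
    proof (intro equalityI subsetI)
      fix u assume "u \<in> (\<lambda>\<pi>. relabel N k \<pi> (p, v, s)) ` {\<pi>. \<pi> permutes {1..k}}"
      then obtain \<pi> where \<pi>: "\<pi> permutes {1..k}" "u = relabel N k \<pi> (p, v, s)" by blast
      have "perm_of N u = \<sigma>"
        unfolding \<pi>(2) relabel_def using perm_of_eq[OF N lifts_relabel[OF N \<pi>(1) pw L]] by simp
      then show "u \<in> {t \<in> good_triples N k e. perm_of N t = \<sigma>}"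
        using good_triples_relabel[OF \<pi>(1) t(1)] \<pi>(2) by simp
    next
      fix u assume u: "u \<in> {t \<in> good_triples N k e. perm_of N t = \<sigma>}"
      obtain p' v' s' where u': "u = (p', v', s')" by (cases u)
      have t': "(p', v', s') \<in> good_triples N k e" using u u' by simp
      have L': "lifts N p' v' s' \<sigma>" using good_triple_perm(1)[OF N e t'] u u' by simp
      have pw': "p' \<in> words N k" "v' \<in> words N k" and sE': "s' \<in> extensional {1..k}"
        using t' by (auto simp: good_triples_def good_pairs_def good_words_def good_shifts_def PiE_def)
      have part: "p i = p i' \<longleftrightarrow> p' i = p' i'" if "i \<in> {1..int N}" "i' \<in> {1..int N}" for i i'
        using good_triple_partition[OF N e t(1) t' L L' that]
          good_triple_partition[OF N e t' t(1) L' L that] by blast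
      \<comment> \<open>Reads off the new name of \<open>j\<close> at any position of colour
        \<open>j\<close>; by \<open>part\<close> the choice of the position is immaterial.\<close>
      define \<pi> where "\<pi> j = (if j \<in> {1..k} then p' (SOME i. i \<in> {1..int N} \<and> p i = j) else j)" for j
      have some: "(SOME i. i \<in> {1..int N} \<and> p i = j) \<in> {1..int N} \<and> p (SOME i. i \<in> {1..int N} \<and> p i = j) = j"
        if j: "j \<in> {1..k}" for j
      proof -
        obtain i where "i \<in> {1..int N} \<and> p i = j" using good_word_ex[OF pg j N e(1)] by metis
        then show ?thesis by (rule someI)
      qed
      have \<pi>p: "\<pi> (p i) = p' i" if i: "i \<in> {1..int N}" for i
      proof -
        have j: "p i \<in> {1..k}" using pw i unfolding words_def by blast
        show ?thesis using part[OF conjunct1[OF some[OF j]] i] some[OF j] j unfolding \<pi>_def by simp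
      qed
      have "inj_on \<pi> {1..k}"
      proof (rule inj_onI)
        fix j j' assume jj: "j \<in> {1..k}" "j' \<in> {1..k}" "\<pi> j = \<pi> j'"
        obtain i i' where i: "i \<in> {1..int N}" "p i = j" "i' \<in> {1..int N}" "p i' = j'"
          using some[OF jj(1)] some[OF jj(2)] by metis
        then have "p' i = p' i'" using \<pi>p[OF i(1)] \<pi>p[OF i(3)] jj(3) by simp
        then show "j = j'" using part[OF i(1,3)] i by simp
      qed
      moreover have "\<pi> ` {1..k} \<subseteq> {1..k}"
        using some pw'(1) unfolding \<pi>_def words_def by auto
      ultimately have "bij_betw \<pi> {1..k} {1..k}"
        by (simp add: bij_betw_def endo_inj_surj)
      then have \<pi>: "\<pi> permutes {1..k}"
        unfolding \<pi>_def by (rule bij_imp_permutes) (rule if_not_P)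
      have "restrict (\<pi> \<circ> p) {1..int N} = p'"
        using pw'(1) \<pi>p unfolding words_def by (intro extensionalityI[of _ "{1..int N}"]) (auto simp: PiE_def)
      moreover have "restrict (\<pi> \<circ> v) {1..int N} = v'"
      proof (rule extensionalityI[of _ "{1..int N}"])
        fix y assume y: "y \<in> {1..int N}"
        have bij: "bij \<sigma>" using good_triple_perm(2)[OF N e t(1)] t(2)
          by (simp add: bounded_avoiders_def bounded_affine_permutation_def affine_permutation_def)
        then obtain i where i: "y = \<sigma> i" by (metis bij_pointE)
        have "v (rep N (\<sigma> i)) = p (rep N i)" "v' (rep N (\<sigma> i)) = p' (rep N i)"
          using L L' unfolding lifts_def by blast+
        then have "v y = p (rep N i)" "v' y = p' (rep N i)"
          unfolding i[symmetric] rep_id[OF y] .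
        then show "restrict (\<pi> \<circ> v) {1..int N} y = v' y"
          using \<pi>p[OF rep_in[OF N]] y by simp
      qed (use pw'(2) in \<open>auto simp: words_def PiE_def\<close>)
      moreover have "restrict (s \<circ> inv \<pi>) {1..k} = s'"
      proof (rule extensionalityI[of _ "{1..k}"])
        fix j' assume j': "j' \<in> {1..k}"
        then have "inv \<pi> j' \<in> {1..k}" using permutes_in_image[OF permutes_inv[OF \<pi>]] by blast
        then obtain i where i: "i \<in> {1..int N}" "p i = inv \<pi> j'"
          using good_word_ex[OF pg _ N e(1)] by metis
        have pi': "p' i = j'" using \<pi>p[OF i(1)] i(2) permutes_inverses(1)[OF \<pi>] by simp
        have "height N v' j' (\<sigma> i) = height N p' j' i + s' j'"
          using L'[unfolded lifts_def, rule_format, of i] by (simp add: pi' rep_id[OF i(1)])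
        moreover have "height N v (inv \<pi> j') (\<sigma> i) = height N p (inv \<pi> j') i + s (inv \<pi> j')"
          using L[unfolded lifts_def, rule_format, of i] by (simp add: i(2) rep_id[OF i(1)])
        \<comment> \<open>Heights are invariant under renaming, so the height equations of both
          encodings at \<open>i\<close> differ only in their shifts.\<close>
        moreover have "height N v' j' (\<sigma> i) = height N v (inv \<pi> j') (\<sigma> i)"
          "height N p' j' i = height N p (inv \<pi> j') i"
          using height_relabel[OF permutes_inj[OF \<pi>] N, of v "inv \<pi> j'" "\<sigma> i"]
            height_relabel[OF permutes_inj[OF \<pi>] N, of p "inv \<pi> j'" i]
            permutes_inverses(1)[OF \<pi>]
          by (simp_all add: \<open>restrict (\<pi> \<circ> v) {1..int N} = v'\<close> \<open>restrict (\<pi> \<circ> p) {1..int N} = p'\<close>)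
        ultimately show "restrict (s \<circ> inv \<pi>) {1..k} j' = s' j'" using j' by simp
      qed (use sE' in auto)
      ultimately have "u = relabel N k \<pi> (p, v, s)" using u' by (simp add: relabel_def)
      then show "u \<in> (\<lambda>\<pi>. relabel N k \<pi> (p, v, s)) ` {\<pi>. \<pi> permutes {1..k}}" using \<pi> by blast
    qed
  qed
  then have "card {t \<in> good_triples N k e. perm_of N t = \<sigma>} = card {\<pi>. \<pi> permutes {1..k}}"
    by (rule bij_betw_same_card[symmetric])
  also have "\<dots> = fact k" by (rule card_permutations) auto
  finally show ?thesis .
qed

section \<open>Counting words and shifts\<close>

lemma real_card_Un_le: "real (card (A \<union> B)) \<le> real (card A) + real (card B)"
  by (simp only: of_nat_add[symmetric] of_nat_le_iff card_Un_le)

lemma card_words: "card (words N k) = k ^ N"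
  by (simp add: words_def card_PiE)

section \<open>Chernoff bound for words\<close>

lemma exp_le_quadratic:
  fixes t :: real
  assumes "\<bar>t\<bar> \<le> 1" shows "exp t \<le> 1 + t + t\<^sup>2"
proof (cases "0 \<le> t")
  case True
  then show ?thesis using assms by (intro exp_bound) auto
next
  case False
  define u where "u = - t"
  have u: "0 < u" "u \<le> 1" using False assms by (auto simp: u_def)
  \<comment> \<open>The product is \<open>1 + u ^ 3\<close>, so \<open>1 - u + u ^ 2\<close>
    dominates the inverse of \<open>1 + u\<close> and hence that of \<open>exp u\<close>.\<close>
  have "1 \<le> (1 + u) * (1 - u + u\<^sup>2)" using u by (simp add: algebra_simps power2_eq_square)
  also have "\<dots> \<le> exp u * (1 - u + u\<^sup>2)"
    using u by (intro mult_right_mono exp_ge_add_one_self) (auto simp: power2_eq_square)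
  finally have "exp (- u) * 1 \<le> exp (- u) * (exp u * (1 - u + u\<^sup>2))" by (intro mult_left_mono) auto
  then show ?thesis by (simp add: u_def flip: mult.assoc exp_add)
qed

text \<open>The sum over words factorises over positions. A position up to \<open>x\<close>
  contributes \<open>k - 1 + exp t\<close>, at most \<open>k * exp ((t + t ^ 2) / k)\<close>, any
  other contributes \<open>k\<close>. Centring cancels the linear term, and the quadratic one is
  estimated by \<open>x \<le> N\<close>.\<close>

lemma sum_exp_cnt_le:
  assumes j: "j \<in> {1..k}" and x: "x \<in> {1..int N}" and t: "\<bar>t\<bar> \<le> 1"
  shows "(\<Sum>p\<in>words N k. exp (t * (real (cnt p j x) - real_of_int x / real k)))
    \<le> real k ^ N * exp (real N * t\<^sup>2 / real k)"
proof -
  have k: "real k > 0" using j by simp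
  define f :: "int \<Rightarrow> nat \<Rightarrow> real" where "f i c = (if i \<le> x \<and> c = j then exp t else 1)" for i c
  have expand: "exp (t * real (cnt p j x)) = (\<Prod>i\<in>{1..int N}. f i (p i))" for p
  proof -
    have "{1..int N} \<inter> {i. i \<le> x \<and> p i = j} = {i \<in> {1..x}. p i = j}" using x by auto
    then have "(\<Prod>i\<in>{1..int N}. f i (p i)) = exp t ^ cnt p j x"
      unfolding f_def cnt_def by (simp add: prod.If_cases)
    then show ?thesis by (simp add: exp_of_nat_mult[symmetric] mult.commute)
  qed
  have factor: "(\<Sum>c\<in>{1..k}. f i c) \<le> real k * (if i \<le> x then exp ((t + t\<^sup>2) / real k) else 1)" for i
  proof (cases "i \<le> x")
    case True
    have "(\<Sum>c\<in>{1..k}. f i c) = (\<Sum>c\<in>{1..k}. 1 + (if c = j then exp t - 1 else 0))"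
      unfolding f_def using True by (intro sum.cong) auto
    also have "\<dots> = real k + (exp t - 1)" using j by (simp add: sum.distrib)
    also have "\<dots> \<le> real k + (t + t\<^sup>2)" using exp_le_quadratic[OF t] by simp
    also have "\<dots> = real k * (1 + (t + t\<^sup>2) / real k)" using k by (subst distrib_left) simp
    also have "\<dots> \<le> real k * exp ((t + t\<^sup>2) / real k)"
      using k by (intro mult_left_mono exp_ge_add_one_self) auto
    finally show ?thesis using True by simp
  qed (simp add: f_def)
  have "(\<Sum>p\<in>words N k. exp (t * real (cnt p j x))) = (\<Prod>i\<in>{1..int N}. \<Sum>c\<in>{1..k}. f i c)"
    unfolding expand words_def by (rule prod_sum_PiE[symmetric]) auto
  also have "\<dots> \<le> (\<Prod>i\<in>{1..int N}. real k * (if i \<le> x then exp ((t + t\<^sup>2) / real k) else 1))"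
    using factor by (intro prod_mono conjI sum_nonneg) (auto simp: f_def)
  also have "\<dots> = real k ^ N * (\<Prod>i\<in>{1..int N}. if i \<le> x then exp ((t + t\<^sup>2) / real k) else 1)"
    by (simp add: prod.distrib)
  also have "(\<Prod>i\<in>{1..int N}. if i \<le> x then exp ((t + t\<^sup>2) / real k) else 1)
    = exp ((t + t\<^sup>2) / real k) ^ nat x"
  proof -
    have "{1..int N} \<inter> {i. i \<le> x} = {1..x}" using x by auto
    then show ?thesis by (simp add: prod.If_cases)
  qed
  also have "\<dots> = exp (real_of_int x * ((t + t\<^sup>2) / real k))"
    using x by (simp add: exp_of_nat_mult[symmetric])
  finally have *: "(\<Sum>p\<in>words N k. exp (t * real (cnt p j x)))
    \<le> real k ^ N * exp (real_of_int x * ((t + t\<^sup>2) / real k))" .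
  have "(\<Sum>p\<in>words N k. exp (t * (real (cnt p j x) - real_of_int x / real k)))
    = (\<Sum>p\<in>words N k. exp (t * real (cnt p j x))) * exp (- (t * (real_of_int x / real k)))"
    by (simp add: sum_distrib_right right_diff_distrib exp_diff exp_minus divide_inverse)
  also have "\<dots> \<le> real k ^ N * exp (real_of_int x * ((t + t\<^sup>2) / real k)) * exp (- (t * (real_of_int x / real k)))"
    by (intro mult_right_mono *) auto
  also have "\<dots> = real k ^ N * exp (real_of_int x * t\<^sup>2 / real k)"
    by (simp add: mult.assoc flip: exp_add) (simp add: add_divide_distrib algebra_simps)
  also have "\<dots> \<le> real k ^ N * exp (real N * t\<^sup>2 / real k)"
    using x k by (intro mult_left_mono) (auto intro!: divide_right_mono mult_right_mono)
  finally show ?thesis .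
qed

text \<open>Markov's inequality for the exponential moment; the sign of \<open>t\<close> selects the
  upper or the lower tail. Since \<open>k \<ge> 2\<close>, the moment costs at most half of the
  exponent \<open>e ^ 2 * N\<close> gained at the threshold.\<close>

lemma card_tail_le:
  assumes j: "j \<in> {1..k}" and x: "x \<in> {1..int N}" and k: "k \<ge> 2" and e: "0 < e" "e \<le> 1" and t: "\<bar>t\<bar> = e"
  shows "real (card {p \<in> words N k. e * real N * e < t * (real (cnt p j x) - real_of_int x / real k)})
    \<le> real k ^ N * exp (- (e\<^sup>2 * real N / 2))"
proof -
  let ?S = "{p \<in> words N k. e * real N * e < t * (real (cnt p j x) - real_of_int x / real k)}"
  have "real (card ?S) * exp (e\<^sup>2 * real N) = (\<Sum>p\<in>?S. exp (e * real N * e))"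
    by (simp add: power2_eq_square mult_ac)
  also have "\<dots> \<le> (\<Sum>p\<in>?S. exp (t * (real (cnt p j x) - real_of_int x / real k)))"
    by (intro sum_mono) auto
  also have "\<dots> \<le> (\<Sum>p\<in>words N k. exp (t * (real (cnt p j x) - real_of_int x / real k)))"
    by (intro sum_mono2) auto
  also have "\<dots> \<le> real k ^ N * exp (real N * t\<^sup>2 / real k)"
    using t e by (intro sum_exp_cnt_le[OF j x]) auto
  also have "t\<^sup>2 = e\<^sup>2" using t by (metis power2_abs)
  also have "real k ^ N * exp (real N * e\<^sup>2 / real k) \<le> real k ^ N * exp (real N * e\<^sup>2 / 2)"
  proof -
    have "real N * e\<^sup>2 / real k \<le> real N * e\<^sup>2 / 2" by (rule frac_le) (use k in simp_all)
    then show ?thesis by (intro mult_left_mono) auto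
  qed
  finally have "real (card ?S) * exp (e\<^sup>2 * real N) * exp (- (e\<^sup>2 * real N))
    \<le> real k ^ N * exp (real N * e\<^sup>2 / 2) * exp (- (e\<^sup>2 * real N))"
    by (intro mult_right_mono) auto
  then show ?thesis unfolding mult.assoc exp_add[symmetric] by (simp add: mult.commute)
qed

text \<open>Union bound over \<open>k\<close> letters, \<open>N\<close> prefixes and two
  tails.\<close>

lemma card_bad_words_le:
  assumes k: "k \<ge> 2" and e: "0 < e" "e \<le> 1"
  shows "real (card (words N k - good_words N k e))
    \<le> 2 * real k * real N * real k ^ N * exp (- (e\<^sup>2 * real N / 2))"
proof -
  let ?T = "\<lambda>t j x. {p \<in> words N k. e * real N * e < t * (real (cnt p j x) - real_of_int x / real k)}"
  let ?E = "real k ^ N * exp (- (e\<^sup>2 * real N / 2))"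
  have "words N k - good_words N k e \<subseteq> (\<Union>z\<in>{1..k} \<times> {1..int N}. ?T e (fst z) (snd z) \<union> ?T (- e) (fst z) (snd z))"
  proof
    fix p assume "p \<in> words N k - good_words N k e"
    then obtain j x where p: "p \<in> words N k" "j \<in> {1..k}" "x \<in> {1..int N}"
      "e * real N < \<bar>real (cnt p j x) - real_of_int x / real k\<bar>"
      unfolding good_words_def by force
    have "e * (e * real N) < e * \<bar>real (cnt p j x) - real_of_int x / real k\<bar>"
      using p(4) e(1) by (rule mult_strict_left_mono)
    then have "p \<in> ?T e j x \<union> ?T (- e) j x"
      using p(1) by (cases "real (cnt p j x) - real_of_int x / real k \<ge> 0")
        (simp_all add: mult.commute mult.left_commute mult.assoc right_diff_distrib del: diff_ge_0_iff_ge)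
    then show "p \<in> (\<Union>z\<in>{1..k} \<times> {1..int N}. ?T e (fst z) (snd z) \<union> ?T (- e) (fst z) (snd z))"
      using p(2,3) by force
  qed
  then have "card (words N k - good_words N k e)
    \<le> card (\<Union>z\<in>{1..k} \<times> {1..int N}. ?T e (fst z) (snd z) \<union> ?T (- e) (fst z) (snd z))"
    by (intro card_mono) auto
  also have "\<dots> \<le> (\<Sum>z\<in>{1..k} \<times> {1..int N}. card (?T e (fst z) (snd z) \<union> ?T (- e) (fst z) (snd z)))"
    by (intro card_UN_le) auto
  finally have "real (card (words N k - good_words N k e))
    \<le> (\<Sum>z\<in>{1..k} \<times> {1..int N}. real (card (?T e (fst z) (snd z) \<union> ?T (- e) (fst z) (snd z))))"
    by (simp only: of_nat_sum[symmetric] of_nat_le_iff)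
  also have "\<dots> \<le> (\<Sum>z\<in>{1..k} \<times> {1..int N}. ?E + ?E)"
  proof (intro sum_mono)
    fix z assume "z \<in> {1..k} \<times> {1..int N}"
    then have z: "fst z \<in> {1..k}" "snd z \<in> {1..int N}" by auto
    have "real (card (?T e (fst z) (snd z) \<union> ?T (- e) (fst z) (snd z)))
      \<le> real (card (?T e (fst z) (snd z))) + real (card (?T (- e) (fst z) (snd z)))"
      by (rule real_card_Un_le)
    also have "\<dots> \<le> ?E + ?E"
      using e by (intro add_mono card_tail_le[OF z k e]) auto
    finally show "real (card (?T e (fst z) (snd z) \<union> ?T (- e) (fst z) (snd z))) \<le> ?E + ?E" .
  qed
  also have "\<dots> = 2 * real k * real N * real k ^ N * exp (- (e\<^sup>2 * real N / 2))"
    by (simp add: card_cartesian_product)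
  finally show ?thesis .
qed

section \<open>Pairs of words with equal letter counts\<close>

lemma finite_good_words [simp]: "finite (good_words N k e)"
  by (rule finite_subset[of _ "words N k"]) (auto simp: good_words_def)

text \<open>Good words are classified by their vector of letter counts, of which there are at most
  \<open>(N + 1) ^ k\<close>. Good pairs are pairs within a class, and by Cauchy-Schwarz the sum of
  the squared class sizes is at least the square of their sum over the number of classes.\<close>

lemma card_good_pairs_ge:
  "real (card (good_words N k e)) ^ 2 \<le> real (card (good_pairs N k e)) * real (N + 1) ^ k"
proof -
  define q where "q p = restrict (\<lambda>j. cnt p j (int N)) {1..k}" for p :: "int \<Rightarrow> nat"
  define T where "T = {1..k} \<rightarrow>\<^sub>E {0..N}"
  have T: "finite T" "card T = (N + 1) ^ k" unfolding T_def by (auto simp: finite_PiE card_PiE)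
  have qT: "q p \<in> T" for p
  proof -
    have "cnt p j (int N) \<le> card {1..int N}" for j unfolding cnt_def by (intro card_mono) auto
    then show ?thesis unfolding q_def T_def by auto
  qed
  define G where "G c = {p \<in> good_words N k e. q p = c}" for c
  have q_eq: "q v = q p \<longleftrightarrow> (\<forall>j\<in>{1..k}. cnt v j (int N) = cnt p j (int N))" for p v
  proof
    assume eq: "q v = q p"
    show "\<forall>j\<in>{1..k}. cnt v j (int N) = cnt p j (int N)"
    proof
      fix j assume j: "j \<in> {1..k}"
      have "q v j = q p j" by (simp only: eq)
      then show "cnt v j (int N) = cnt p j (int N)" using j by (simp add: q_def)
    qed
  qed (auto simp: q_def intro!: restrict_ext)
  have "card (good_words N k e) = (\<Sum>c\<in>T. card (G c))"
    using sum.group[of "good_words N k e" T q "\<lambda>_. 1 :: nat"] T image_subsetI[of "good_words N k e" q T, OF qT]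
    unfolding G_def by simp
  then have "real (card (good_words N k e)) ^ 2 = (\<Sum>c\<in>T. real (card (G c))) ^ 2" by simp
  also have "\<dots> \<le> (\<Sum>c\<in>T. real (card (G c)) ^ 2) * real (card T)"
    by (rule sum_squared_le_sum_of_squares)
  also have "(\<Sum>c\<in>T. real (card (G c)) ^ 2) = real (card (good_pairs N k e))"
  proof -
    have "card (good_pairs N k e) = (\<Sum>c\<in>T. card {z \<in> good_pairs N k e. q (fst z) = c})"
      using sum.group[of "good_pairs N k e" T "\<lambda>z. q (fst z)" "\<lambda>_. 1 :: nat"] T
        image_subsetI[of "good_pairs N k e" "\<lambda>z. q (fst z)" T, OF qT] by simp
    also have "\<dots> = (\<Sum>c\<in>T. card (G c \<times> G c))"
      by (intro sum.cong refl arg_cong[where f = card]) (auto simp: good_pairs_def G_def q_eq)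
    finally show ?thesis by (simp add: card_cartesian_product power2_eq_square)
  qed
  finally show ?thesis using T by simp
qed

lemma card_bad_pairs_le:
  "real (card (bad_pairs N k e)) \<le> 2 * real k ^ N * real (card (words N k - good_words N k e))"
proof -
  let ?B = "words N k - good_words N k e"
  have "card (bad_pairs N k e) \<le> card (?B \<times> words N k \<union> words N k \<times> ?B)"
    by (intro card_mono) (auto simp: bad_pairs_def)
  also have "\<dots> \<le> card (?B \<times> words N k) + card (words N k \<times> ?B)"
    by (rule card_Un_le)
  also have "\<dots> = 2 * k ^ N * card ?B"
    by (simp add: card_cartesian_product card_words)
  finally have "real (card (bad_pairs N k e)) \<le> real (2 * k ^ N * card ?B)" by (simp only: of_nat_le_iff)
  then show ?thesis by simp
qed

section \<open>Shift vectors near the boundary\<close>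

lemma card_int_interval_le:
  fixes a b :: real
  assumes "a \<le> b"
  shows "finite {x :: int. a \<le> real_of_int x \<and> real_of_int x \<le> b}"
    "real (card {x :: int. a \<le> real_of_int x \<and> real_of_int x \<le> b}) \<le> b - a + 1"
proof -
  have eq: "{x :: int. a \<le> real_of_int x \<and> real_of_int x \<le> b} = {\<lceil>a\<rceil>..\<lfloor>b\<rfloor>}"
    by (auto simp: le_floor_iff ceiling_le_iff)
  then show "finite {x :: int. a \<le> real_of_int x \<and> real_of_int x \<le> b}" by simp
  have "real_of_int \<lfloor>b\<rfloor> - real_of_int \<lceil>a\<rceil> \<le> b - a" by (intro diff_mono) auto
  then show "real (card {x :: int. a \<le> real_of_int x \<and> real_of_int x \<le> b}) \<le> b - a + 1"
    unfolding eq using assms by (cases "\<lfloor>b\<rfloor> - \<lceil>a\<rceil> + 1 \<ge> 0") auto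
qed

text \<open>Given the \<open>k - 2\<close> other entries, the zero sum fixes
  \<open>s i + s j\<close>, and together with the value of \<open>g\<close> this fixes both. It is
  applied with \<open>g\<close> the second entry and with \<open>g\<close> the difference, so that
  one constraint lowers the count by one dimension.\<close>

lemma card_shifts_constraint_le:
  assumes ij: "i \<in> {1..k}" "j \<in> {1..k}" "i \<noteq> j" and T: "finite T"
    and g: "\<And>a b a' b'. a + b = a' + b' \<Longrightarrow> g a b = g a' b' \<Longrightarrow> a = a' \<and> b = (b' :: int)"
  shows "card {s \<in> {1..k} \<rightarrow>\<^sub>E {- int N..int N}. (\<Sum>j = 1..k. s j) = 0 \<and> g (s i) (s j) \<in> T}
    \<le> (2 * N + 1) ^ (k - 2) * card T"
proof -
  let ?S = "{s \<in> {1..k} \<rightarrow>\<^sub>E {- int N..int N}. (\<Sum>j = 1..k. s j) = 0 \<and> g (s i) (s j) \<in> T}"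
  let ?R = "{1..k} - {i, j}"
  let ?f = "\<lambda>s. (restrict s ?R, g (s i) (s j))"
  have "inj_on ?f ?S"
  proof (rule inj_onI)
    fix s s' assume s: "s \<in> ?S" "s' \<in> ?S" and eq: "?f s = ?f s'"
    have eq1: "restrict s ?R = restrict s' ?R" and eq2: "g (s i) (s j) = g (s' i) (s' j)"
      using eq by simp_all
    have R: "s a = s' a" if "a \<in> ?R" for a
      using fun_cong[OF eq1, of a] that by simp
    have split: "(\<Sum>a = 1..k. s a) = s i + s j + (\<Sum>a\<in>?R. s a)" for s :: "nat \<Rightarrow> int"
    proof -
      have "{1..k} = insert i (insert j ?R)" using ij by auto
      then have "(\<Sum>a = 1..k. s a) = (\<Sum>a\<in>insert i (insert j ?R). s a)" by simp
      also have "\<dots> = s i + s j + (\<Sum>a\<in>?R. s a)" using ij by (subst sum.insert; simp)+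
      finally show ?thesis .
    qed
    have "(\<Sum>a\<in>?R. s a) = (\<Sum>a\<in>?R. s' a)" by (intro sum.cong refl R)
    moreover have "(\<Sum>a = 1..k. s a) = 0" "(\<Sum>a = 1..k. s' a) = 0" using s by blast+
    ultimately have "s i + s j = s' i + s' j" using split[of s] split[of s'] by linarith
    then have ij': "s i = s' i" "s j = s' j" using g[OF _ eq2] by simp_all
    show "s = s'"
    proof (rule extensionalityI[of _ "{1..k}"])
      show "s \<in> extensional {1..k}" "s' \<in> extensional {1..k}" using s by (auto simp: PiE_def)
      show "s a = s' a" if "a \<in> {1..k}" for a
        using R ij' that by (cases "a = i"; cases "a = j") auto
    qed
  qed
  moreover have "?f ` ?S \<subseteq> (?R \<rightarrow>\<^sub>E {- int N..int N}) \<times> T" by (auto simp: PiE_def Pi_def)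
  ultimately have "card ?S \<le> card ((?R \<rightarrow>\<^sub>E {- int N..int N}) \<times> T)"
    using T by (intro card_inj_on_le) (auto simp: finite_PiE)
  also have "\<dots> = (2 * N + 1) ^ card ?R * card T"
  proof -
    have "card {- int N..int N} = 2 * N + 1" by simp
    then show ?thesis by (simp only: card_cartesian_product card_PiE finite_Diff finite_atLeastAtMost prod_constant)
  qed
  also have "card ?R = k - 2" using ij by (simp add: card_Diff_subset)
  finally show ?thesis .
qed

text \<open>If \<open>s\<close> is not good, then some \<open>k * \<bar>s j\<bar>\<close> lies
  within \<open>D\<close> of \<open>N\<close>, or two entries differ by at most
  \<open>4 * D\<close>. The first confines an entry to two intervals with at most
  \<open>4 * D + 2\<close> integers, the second a difference to at most \<open>8 * D + 1\<close>;
  together \<open>12 * D + 3\<close>, for at most \<open>k ^ 2\<close> pairs of indices.\<close>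

lemma card_boundary_shifts_le:
  assumes k: "k \<ge> 2" and D: "D = slack k * e * real N + real k ^ 2" "0 \<le> e" and DN: "D \<le> real N"
  shows "finite (all_shifts N k e)"
    "real (card (all_shifts N k e - good_shifts N k e)) \<le> real k ^ 2 * (2 * real N + 1) ^ (k - 2) * (12 * D + 3)"
proof -
  have D0: "0 \<le> D" unfolding D using D(2) slack_nonneg by simp
  have box: "s \<in> {1..k} \<rightarrow>\<^sub>E {- int N..int N}" if s: "s \<in> all_shifts N k e" for s
  proof (rule PiE_I)
    fix j assume j: "j \<in> {1..k}"
    \<comment> \<open>The factor \<open>k \<ge> 2\<close> makes up for the enlarged bound
      \<open>N + D\<close>, which is at most \<open>2 * N\<close>.\<close>
    have "2 * \<bar>real_of_int (s j)\<bar> \<le> real k * \<bar>real_of_int (s j)\<bar>" using k by (intro mult_right_mono) auto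
    also have "\<dots> \<le> real N + D" using s j by (auto simp: all_shifts_def D add.assoc)
    finally have "\<bar>real_of_int (s j)\<bar> \<le> real N" using DN by simp
    then show "s j \<in> {- int N..int N}" by (auto simp: abs_le_iff)
  qed (use s in \<open>auto simp: all_shifts_def PiE_def extensional_def\<close>)
  have fin_box: "finite ({1..k} \<rightarrow>\<^sub>E {- int N..int N})" by (simp add: finite_PiE)
  show "finite (all_shifts N k e)" by (rule finite_subset[OF _ fin_box]) (use box in blast)
  define T1 where "T1 = {x :: int. (real N - D) / real k \<le> real_of_int x \<and> real_of_int x \<le> (real N + D) / real k}
    \<union> {x :: int. (- real N - D) / real k \<le> real_of_int x \<and> real_of_int x \<le> (- real N + D) / real k}"
  define T2 where "T2 = {x :: int. - (4 * D) \<le> real_of_int x \<and> real_of_int x \<le> 4 * D}"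
  have kp: "real k \<ge> 1" using k by simp
  have w: "2 * D / real k \<le> 2 * D" using kp D0 by (simp add: divide_le_eq mult_le_cancel_left1)
  have le1: "(real N - D) / real k \<le> (real N + D) / real k" "(- real N - D) / real k \<le> (- real N + D) / real k"
    using D0 by (intro divide_right_mono; simp)+
  have d1: "(real N + D) / real k - (real N - D) / real k = 2 * D / real k"
    "(- real N + D) / real k - (- real N - D) / real k = 2 * D / real k"
    by (simp_all flip: diff_divide_distrib)
  have T1: "finite T1" "real (card T1) \<le> 4 * D + 2"
  proof -
    show "finite T1" unfolding T1_def using card_int_interval_le(1) le1 by blast
    have "real (card T1) \<le> real (card {x :: int. (real N - D) / real k \<le> real_of_int x \<and> real_of_int x \<le> (real N + D) / real k})
      + real (card {x :: int. (- real N - D) / real k \<le> real_of_int x \<and> real_of_int x \<le> (- real N + D) / real k})"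
      unfolding T1_def by (rule real_card_Un_le)
    also have "\<dots> \<le> (2 * D / real k + 1) + (2 * D / real k + 1)"
      using card_int_interval_le(2)[OF le1(1)] card_int_interval_le(2)[OF le1(2)] unfolding d1 by (rule add_mono)
    finally show "real (card T1) \<le> 4 * D + 2" using w by simp
  qed
  have T2: "finite T2" "real (card T2) \<le> 8 * D + 1"
    unfolding T2_def using card_int_interval_le[of "- (4 * D)" "4 * D"] D0 by simp_all
  define P where "P = {(i, j). i \<in> {1..k} \<and> j \<in> {1..k} \<and> i \<noteq> j}"
  define S1 where "S1 z = {s \<in> {1..k} \<rightarrow>\<^sub>E {- int N..int N}. (\<Sum>j = 1..k. s j) = 0 \<and> s (snd z) \<in> T1}" for z :: "nat \<times> nat"
  define S2 where "S2 z = {s \<in> {1..k} \<rightarrow>\<^sub>E {- int N..int N}. (\<Sum>j = 1..k. s j) = 0 \<and> s (fst z) - s (snd z) \<in> T2}" for z :: "nat \<times> nat"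
  have sub: "all_shifts N k e - good_shifts N k e \<subseteq> (\<Union>z\<in>P. S1 z \<union> S2 z)"
  proof
    fix s assume s: "s \<in> all_shifts N k e - good_shifts N k e"
    have sb: "s \<in> {1..k} \<rightarrow>\<^sub>E {- int N..int N}" "(\<Sum>j = 1..k. s j) = 0"
      using box s by (auto simp: all_shifts_def)
    have up: "real k * \<bar>real_of_int (s j)\<bar> \<le> real N + D" if "j \<in> {1..k}" for j
      using s that by (auto simp: all_shifts_def D add.assoc)
    have "(\<exists>j\<in>{1..k}. real N - D \<le> real k * \<bar>real_of_int (s j)\<bar>) \<or>
      (\<exists>i\<in>{1..k}. \<exists>j\<in>{1..k}. i \<noteq> j \<and> real k * \<bar>real_of_int (s i) - real_of_int (s j)\<bar> \<le> 4 * slack k * e * real N)"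
      using s unfolding all_shifts_def good_shifts_def D(1) by (auto simp: not_less algebra_simps)
    then show "s \<in> (\<Union>z\<in>P. S1 z \<union> S2 z)"
    proof (elim disjE bexE conjE)
      fix j assume j: "j \<in> {1..k}" "real N - D \<le> real k * \<bar>real_of_int (s j)\<bar>"
      \<comment> \<open>The counting lemma works with a pair of indices, the second entry absorbing
        the zero sum; any index other than \<open>j\<close> serves, and \<open>k \<ge> 2\<close>
        provides one.\<close>
      define i where "i = (if j = 1 then 2 else 1 :: nat)"
      have "(i, j) \<in> P" using j k by (auto simp: P_def i_def)
      moreover have "s j \<in> T1"
        using j(2) up[OF j(1)] kp unfolding T1_def
        by (cases "s j \<ge> 0") (auto simp: field_simps)
      ultimately show ?thesis using sb by (force simp: S1_def)
    next
      fix i j assume ij: "i \<in> {1..k}" "j \<in> {1..k}" "i \<noteq> j"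
        "real k * \<bar>real_of_int (s i) - real_of_int (s j)\<bar> \<le> 4 * slack k * e * real N"
      have "1 * \<bar>real_of_int (s i) - real_of_int (s j)\<bar> \<le> real k * \<bar>real_of_int (s i) - real_of_int (s j)\<bar>"
        using kp by (intro mult_right_mono) auto
      also have "\<dots> \<le> 4 * D" using ij(4) zero_le_power2[of "real k"] unfolding D(1) distrib_left mult.assoc by linarith
      finally have "s i - s j \<in> T2" unfolding T2_def by (auto simp: abs_le_iff)
      then show ?thesis using sb ij by (force simp: S2_def P_def)
    qed
  qed
  have finP: "finite P" "card P \<le> k ^ 2"
  proof -
    have "P \<subseteq> {1..k} \<times> {1..k}" by (auto simp: P_def)
    then show "finite P" "card P \<le> k ^ 2"
      using card_mono[of "{1..k} \<times> {1..k}" P] by (auto intro: finite_subset simp: card_cartesian_product power2_eq_square)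
  qed
  have c: "real (card (S1 z \<union> S2 z)) \<le> (2 * real N + 1) ^ (k - 2) * (12 * D + 3)" if "z \<in> P" for z
  proof -
    have z: "fst z \<in> {1..k}" "snd z \<in> {1..k}" "fst z \<noteq> snd z" using that by (auto simp: P_def)
    have 1: "card (S1 z) \<le> (2 * N + 1) ^ (k - 2) * card T1"
      using card_shifts_constraint_le[OF z T1(1), of "\<lambda>a b. b" N] unfolding S1_def by simp
    have 2: "card (S2 z) \<le> (2 * N + 1) ^ (k - 2) * card T2"
      using card_shifts_constraint_le[OF z T2(1), of "\<lambda>a b. a - b" N] unfolding S2_def by simp
    have "card (S1 z \<union> S2 z) \<le> (2 * N + 1) ^ (k - 2) * (card T1 + card T2)"
      using card_Un_le[of "S1 z" "S2 z"] 1 2 by (simp add: distrib_left)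
    then have "real (card (S1 z \<union> S2 z)) \<le> real ((2 * N + 1) ^ (k - 2) * (card T1 + card T2))"
      by (simp only: of_nat_le_iff)
    also have "\<dots> = (2 * real N + 1) ^ (k - 2) * (real (card T1) + real (card T2))" by (simp add: add.commute)
    also have "\<dots> \<le> (2 * real N + 1) ^ (k - 2) * (12 * D + 3)"
      using T1(2) T2(2) by (intro mult_left_mono) auto
    finally show ?thesis .
  qed
  have finS: "finite (S1 z \<union> S2 z)" for z
    by (rule finite_subset[OF _ fin_box]) (auto simp: S1_def S2_def)
  have "card (all_shifts N k e - good_shifts N k e) \<le> card (\<Union>z\<in>P. S1 z \<union> S2 z)"
    using finP finS by (intro card_mono sub) blast
  also have "\<dots> \<le> (\<Sum>z\<in>P. card (S1 z \<union> S2 z))" by (rule card_UN_le[OF finP(1)])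
  finally have "real (card (all_shifts N k e - good_shifts N k e)) \<le> (\<Sum>z\<in>P. real (card (S1 z \<union> S2 z)))"
    by (simp only: of_nat_sum[symmetric] of_nat_le_iff)
  also have "\<dots> \<le> (\<Sum>z\<in>P. (2 * real N + 1) ^ (k - 2) * (12 * D + 3))" by (intro sum_mono c)
  also have "\<dots> = real (card P) * ((2 * real N + 1) ^ (k - 2) * (12 * D + 3))" by simp
  also have "\<dots> \<le> real k ^ 2 * ((2 * real N + 1) ^ (k - 2) * (12 * D + 3))"
    using finP(2) D0 by (intro mult_right_mono) (auto simp flip: of_nat_power)
  finally show "real (card (all_shifts N k e - good_shifts N k e))
    \<le> real k ^ 2 * (2 * real N + 1) ^ (k - 2) * (12 * D + 3)" by (simp add: mult.assoc)
qed

section \<open>Cells of the zero-sum slice\<close>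

definition slice_base :: "nat \<Rightarrow> (nat \<Rightarrow> real) measure" where
  "slice_base k = (\<Pi>\<^sub>M i\<in>{1..<k}. lborel)"

definition slice_embed :: "nat \<Rightarrow> (nat \<Rightarrow> real) \<Rightarrow> nat \<Rightarrow> real" where
  "slice_embed k x = x(k := - (\<Sum>i = 1..<k. x i))"

definition slice_preimage :: "nat \<Rightarrow> (nat \<Rightarrow> real) set \<Rightarrow> (nat \<Rightarrow> real) set" where
  "slice_preimage k B = slice_embed k -` B \<inter> space (slice_base k)"

definition slice_volume :: "nat \<Rightarrow> real" where
  "slice_volume k = measure (slice_base k) (slice_preimage k (Q0 k))"

lemma space_slice_base: "space (slice_base k) = {1..<k} \<rightarrow>\<^sub>E UNIV"
  by (simp add: slice_base_def space_PiM)

lemma insert_atLeastLessThan: "k \<ge> 1 \<Longrightarrow> {1..k :: nat} = {1..<k} \<union> {k}"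
  by auto

lemma slice_embed_measurable:
  assumes "k \<ge> 1"
  shows "slice_embed k \<in> measurable (slice_base k) (\<Pi>\<^sub>M i\<in>{1..k}. borel)"
proof -
  have c: "(\<lambda>x. x i) \<in> borel_measurable (slice_base k)" if "i \<in> {1..<k}" for i
    unfolding slice_base_def using measurable_component_singleton[OF that, of "\<lambda>_. lborel"] by simp
  have "(\<lambda>x. slice_embed k x) \<in> measurable (slice_base k) (\<Pi>\<^sub>M i\<in>{1..k}. borel)"
  proof (rule measurable_PiM_single')
    fix i assume i: "i \<in> {1..k}"
    show "(\<lambda>x. slice_embed k x i) \<in> borel_measurable (slice_base k)"
    proof (cases "i = k")
      case True
      have "(\<lambda>x. - (\<Sum>i = 1..<k. x i)) \<in> borel_measurable (slice_base k)"
        using c by (intro borel_measurable_uminus borel_measurable_sum)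
      then show ?thesis using True by (simp add: slice_embed_def)
    next
      case False
      then have "(\<lambda>x. slice_embed k x i) = (\<lambda>x. x i)" by (simp add: slice_embed_def)
      then show ?thesis using c[of i] i False by simp
    qed
  qed (use assms in \<open>auto simp: slice_embed_def space_slice_base PiE_def extensional_def\<close>)
  then show ?thesis by simp
qed

lemma component_measurable:
  "i \<in> I \<Longrightarrow> (\<lambda>x. x i) \<in> borel_measurable (\<Pi>\<^sub>M i\<in>I. (borel :: real measure))"
  by (rule measurable_component_singleton)

lemma Q0_sets: "Q0 k \<in> sets (\<Pi>\<^sub>M i\<in>{1..k}. borel)"
proof -
  let ?M = "\<Pi>\<^sub>M i\<in>{1..k}. (borel :: real measure)"
  note [measurable] = component_measurable
  have "Q0 k = {x \<in> space ?M. (\<forall>i\<in>{1..k}. -1 \<le> x i \<and> x i \<le> 1) \<and> (\<Sum>i = 1..k. x i) = 0}"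
    by (auto simp: Q0_def space_PiM PiE_def Pi_def)
  also have "\<dots> \<in> sets ?M" by measurable
  finally show ?thesis .
qed

lemma slice_preimage_sets:
  "k \<ge> 1 \<Longrightarrow> B \<in> sets (\<Pi>\<^sub>M i\<in>{1..k}. borel) \<Longrightarrow> slice_preimage k B \<in> sets (slice_base k)"
  unfolding slice_preimage_def using slice_embed_measurable by (rule measurable_sets)

lemma emeasure_slice_box:
  assumes "\<And>i. i \<in> {1..<k} \<Longrightarrow> a i \<le> b i"
  shows "emeasure (slice_base k) (\<Pi>\<^sub>E i\<in>{1..<k}. {a i..b i}) = ennreal (\<Prod>i\<in>{1..<k}. b i - a i)"
    "emeasure (slice_base k) (\<Pi>\<^sub>E i\<in>{1..<k}. {a i..<b i}) = ennreal (\<Prod>i\<in>{1..<k}. b i - a i)"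
proof -
  interpret product_sigma_finite "\<lambda>_ :: nat. lborel :: real measure" ..
  have p: "(\<Prod>i\<in>{1..<k}. ennreal (b i - a i)) = ennreal (\<Prod>i\<in>{1..<k}. b i - a i)"
    using assms by (intro prod_ennreal) auto
  show "emeasure (slice_base k) (\<Pi>\<^sub>E i\<in>{1..<k}. {a i..b i}) = ennreal (\<Prod>i\<in>{1..<k}. b i - a i)"
    unfolding slice_base_def p[symmetric] using assms by (subst emeasure_PiM) (auto intro!: prod.cong)
  show "emeasure (slice_base k) (\<Pi>\<^sub>E i\<in>{1..<k}. {a i..<b i}) = ennreal (\<Prod>i\<in>{1..<k}. b i - a i)"
    unfolding slice_base_def p[symmetric] using assms by (subst emeasure_PiM) (auto intro!: prod.cong)
qed

lemma box_sets [measurable]: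
  "(\<Pi>\<^sub>E i\<in>{1..<k}. {a i..b i}) \<in> sets (slice_base k)" "(\<Pi>\<^sub>E i\<in>{1..<k}. {a i..<b i}) \<in> sets (slice_base k)"
  unfolding slice_base_def by (auto intro!: sets_PiM_I_finite)

lemma sum_slice_embed: "k \<ge> 1 \<Longrightarrow> (\<Sum>i = 1..k. slice_embed k x i) = 0"
  unfolding insert_atLeastLessThan by (simp add: slice_embed_def)

lemma slice_preimage_Q0_finite:
  assumes k: "k \<ge> 1" shows "emeasure (slice_base k) (slice_preimage k (Q0 k)) < \<infinity>"
proof -
  have "slice_preimage k (Q0 k) \<subseteq> (\<Pi>\<^sub>E i\<in>{1..<k}. {-1..1})"
  proof
    fix x assume x: "x \<in> slice_preimage k (Q0 k)"
    then have "slice_embed k x \<in> Q0 k" by (simp add: slice_preimage_def)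
    then have b: "\<bar>slice_embed k x i\<bar> \<le> 1" if "i \<in> {1..k}" for i using Q0_bounds that by blast
    show "x \<in> (\<Pi>\<^sub>E i\<in>{1..<k}. {-1..1})"
    proof (rule PiE_I)
      fix i assume "i \<in> {1..<k}"
      then show "x i \<in> {-1..1}" using b[of i] by (auto simp: slice_embed_def abs_le_iff)
    qed (use x in \<open>auto simp: slice_preimage_def space_slice_base PiE_def extensional_def\<close>)
  qed
  then have "emeasure (slice_base k) (slice_preimage k (Q0 k)) \<le> emeasure (slice_base k) (\<Pi>\<^sub>E i\<in>{1..<k}. {-1..1})"
    by (intro emeasure_mono) measurable
  also have "\<dots> < \<infinity>" by (subst emeasure_slice_box(1)) auto
  finally show ?thesis .
qed

lemma emeasure_slice_preimage_Q0:
  assumes k: "k \<ge> 1"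
  shows "emeasure (slice_base k) (slice_preimage k (Q0 k)) = ennreal (slice_volume k)" "slice_volume k > 0"
proof -
  show 1: "emeasure (slice_base k) (slice_preimage k (Q0 k)) = ennreal (slice_volume k)"
    unfolding slice_volume_def using slice_preimage_Q0_finite[OF k] by (intro emeasure_eq_ennreal_measure) auto
  \<comment> \<open>A small box inside the slice shows positive volume: free coordinates in
    \<open>[0, 1 / k]\<close> keep the last coordinate in \<open>[-1, 0]\<close>.\<close>
  let ?B = "\<Pi>\<^sub>E i\<in>{1..<k}. {0..1 / real k}"
  have "?B \<subseteq> slice_preimage k (Q0 k)"
  proof
    fix x assume x: "x \<in> ?B"
    then have xi: "0 \<le> x i" "x i \<le> 1 / real k" if "i \<in> {1..<k}" for i using that by (auto simp: PiE_def Pi_def)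
    have "(\<Sum>i = 1..<k. x i) \<le> (\<Sum>i = 1..<k. 1 / real k)" by (intro sum_mono xi)
    also have "\<dots> \<le> 1" using k by (simp add: field_simps)
    finally have s: "(\<Sum>i = 1..<k. x i) \<le> 1" .
    have s0: "0 \<le> (\<Sum>i = 1..<k. x i)" by (intro sum_nonneg xi)
    have le1: "1 / real k \<le> 1" using k by simp
    have "slice_embed k x i \<in> {-1..1}" if "i \<in> {1..k}" for i
    proof (cases "i = k")
      case False
      then have "i \<in> {1..<k}" using that by auto
      then have "0 \<le> x i" "x i \<le> 1" using xi[of i] le1 by linarith+
      then show ?thesis using False by (simp add: slice_embed_def)
    qed (use s s0 in \<open>auto simp: slice_embed_def\<close>)
    moreover have "slice_embed k x \<in> extensional {1..k}"
      using x k by (auto simp: slice_embed_def PiE_def extensional_def)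
    ultimately have "slice_embed k x \<in> Q0 k"
      using sum_slice_embed[OF k, of x] by (simp add: Q0_def PiE_def)
    then show "x \<in> slice_preimage k (Q0 k)"
      using x by (auto simp: slice_preimage_def space_slice_base PiE_def)
  qed
  then have "emeasure (slice_base k) ?B \<le> emeasure (slice_base k) (slice_preimage k (Q0 k))"
    using slice_preimage_sets[OF k Q0_sets] by (intro emeasure_mono)
  moreover have "emeasure (slice_base k) ?B = ennreal ((1 / real k) ^ (k - 1))"
    by (subst emeasure_slice_box(1)) auto
  ultimately have "ennreal ((1 / real k) ^ (k - 1)) \<le> ennreal (slice_volume k)" unfolding 1 by simp
  moreover have "0 < (1 / real k) ^ (k - 1)" using k by simp
  ultimately have "(1 / real k) ^ (k - 1) \<le> slice_volume k" by (simp add: ennreal_le_iff2)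
  then show "slice_volume k > 0" using \<open>0 < (1 / real k) ^ (k - 1)\<close> by linarith
qed

text \<open>The surface factor \<open>sqrt k\<close> occurs in numerator and denominator and
  cancels, leaving Lebesgue measure in the \<open>k - 1\<close> free coordinates.\<close>

lemma emeasure_uniform_Q0:
  assumes k: "k \<ge> 1" and B: "B \<in> sets (\<Pi>\<^sub>M i\<in>{1..k}. borel)" "B \<subseteq> Q0 k"
  shows "emeasure (uniform_Q0 k) B = emeasure (slice_base k) (slice_preimage k B) / ennreal (slice_volume k)"
proof -
  let ?H = "hyperplane_lebesgue k"
  let ?c = "ennreal (sqrt (real k))"
  have sets_H: "sets ?H = sets (\<Pi>\<^sub>M i\<in>{1..k}. borel)" by (simp add: hyperplane_lebesgue_def)
  have eH: "emeasure ?H C = ?c * emeasure (slice_base k) (slice_preimage k C)"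
    if "C \<in> sets (\<Pi>\<^sub>M i\<in>{1..k}. borel)" for C
  proof -
    have "emeasure ?H C = ?c * emeasure (distr (slice_base k) (\<Pi>\<^sub>M i\<in>{1..k}. borel) (slice_embed k)) C"
      unfolding hyperplane_lebesgue_def slice_base_def slice_embed_def by simp
    also have "emeasure (distr (slice_base k) (\<Pi>\<^sub>M i\<in>{1..k}. borel) (slice_embed k)) C
      = emeasure (slice_base k) (slice_preimage k C)"
      unfolding slice_preimage_def by (rule emeasure_distr[OF slice_embed_measurable[OF k] that])
    finally show ?thesis .
  qed
  have rs: "emeasure (restrict_space ?H (Q0 k)) C = emeasure ?H C" if "C \<subseteq> Q0 k" for C
    using that Q0_sets[of k] sets_H by (intro emeasure_restrict_space) (auto simp: sets.Int_space_eq2)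
  have in_rs: "C \<in> sets (restrict_space ?H (Q0 k))"
    if "C \<in> sets (\<Pi>\<^sub>M i\<in>{1..k}. borel)" "C \<subseteq> Q0 k" for C
    using that sets_H Q0_sets[of k] by (subst sets_restrict_space_iff) (auto simp: sets.Int_space_eq2)
  have "emeasure (uniform_Q0 k) B = emeasure (restrict_space ?H (Q0 k)) (Q0 k \<inter> B) / emeasure (restrict_space ?H (Q0 k)) (Q0 k)"
    unfolding uniform_Q0_def
    by (rule emeasure_uniform_measure[OF in_rs[OF Q0_sets order_refl] in_rs[OF B]])
  also have "Q0 k \<inter> B = B" using B(2) by blast
  also have "emeasure (restrict_space ?H (Q0 k)) B / emeasure (restrict_space ?H (Q0 k)) (Q0 k)
    = (?c * emeasure (slice_base k) (slice_preimage k B)) / (?c * ennreal (slice_volume k))"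
    by (simp only: rs[OF B(2)] rs[OF order_refl] eH[OF B(1)] eH[OF Q0_sets] emeasure_slice_preimage_Q0(1)[OF k])
  also have "\<dots> = emeasure (slice_base k) (slice_preimage k B) / ennreal (slice_volume k)"
  proof -
    have "slice_preimage k B \<subseteq> slice_preimage k (Q0 k)" using B(2) by (auto simp: slice_preimage_def)
    then have "emeasure (slice_base k) (slice_preimage k B) \<le> ennreal (slice_volume k)"
      unfolding emeasure_slice_preimage_Q0(1)[OF k, symmetric]
      using slice_preimage_sets[OF k Q0_sets] by (intro emeasure_mono)
    then obtain r where r: "r \<ge> 0" "emeasure (slice_base k) (slice_preimage k B) = ennreal r"
      by (metis ennreal_cases ennreal_neq_top top.extremum_uniqueI)
    then show ?thesis
      using emeasure_slice_preimage_Q0(2)[OF k] k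
      by (simp add: divide_ennreal flip: ennreal_mult)
  qed
  finally show ?thesis .
qed

lemma prob_space_uniform_Q0:
  assumes k: "k \<ge> 1" shows "prob_space (uniform_Q0 k)"
proof (rule prob_spaceI)
  show "emeasure (uniform_Q0 k) (space (uniform_Q0 k)) = 1"
    using emeasure_uniform_Q0[OF k Q0_sets order_refl] emeasure_slice_preimage_Q0[OF k]
    by (simp add: divide_ennreal)
qed

text \<open>Rounding all \<open>k\<close> coordinates down would destroy the zero sum, so the last
  entry is determined by the others and collects up to \<open>k - 1\<close> rounding errors.\<close>

definition shift_of :: "nat \<Rightarrow> nat \<Rightarrow> (nat \<Rightarrow> real) \<Rightarrow> nat \<Rightarrow> int" where
  "shift_of N k x = restrict (\<lambda>i. if i < k then \<lfloor>real N * x i / real k\<rfloor>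
     else - (\<Sum>i = 1..<k. \<lfloor>real N * x i / real k\<rfloor>)) {1..k}"

definition cell :: "nat \<Rightarrow> nat \<Rightarrow> (nat \<Rightarrow> int) \<Rightarrow> (nat \<Rightarrow> real) set" where
  "cell N k s = {x \<in> Q0 k. shift_of N k x = s}"

text \<open>Relative volume of a full grid cell in the free coordinates; a cell cut by the boundary
  of the slice may have less.\<close>

definition cell_prob :: "nat \<Rightarrow> nat \<Rightarrow> real" where
  "cell_prob N k = (real k / real N) ^ (k - 1) / slice_volume k"

lemma shift_of_iff:
  assumes k: "k \<ge> 1" and s: "s \<in> {1..k} \<rightarrow>\<^sub>E UNIV" "(\<Sum>j = 1..k. s j) = 0"
  shows "shift_of N k x = s \<longleftrightarrow> (\<forall>i\<in>{1..<k}. \<lfloor>real N * x i / real k\<rfloor> = s i)"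
proof
  assume eq: "shift_of N k x = s"
  show "\<forall>i\<in>{1..<k}. \<lfloor>real N * x i / real k\<rfloor> = s i"
    by (auto simp: shift_of_def simp flip: eq)
next
  assume fl: "\<forall>i\<in>{1..<k}. \<lfloor>real N * x i / real k\<rfloor> = s i"
  have sk: "s k = - (\<Sum>i = 1..<k. s i)"
    using s(2) unfolding insert_atLeastLessThan[OF k] by (subst (asm) sum.union_disjoint) auto
  show "shift_of N k x = s"
  proof (rule extensionalityI[of _ "{1..k}"])
    fix i assume i: "i \<in> {1..k}"
    show "shift_of N k x i = s i"
    proof (cases "i < k")
      case True
      then show ?thesis using fl i by (simp add: shift_of_def)
    next
      case False
      then have "i = k" using i by simp
      then show ?thesis using fl i sk by (simp add: shift_of_def)
    qed
  qed (use s in \<open>auto simp: shift_of_def PiE_def\<close>)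
qed

lemma cell_sets:
  assumes k: "k \<ge> 1" and s: "s \<in> {1..k} \<rightarrow>\<^sub>E UNIV" "(\<Sum>j = 1..k. s j) = 0"
  shows "cell N k s \<in> sets (\<Pi>\<^sub>M i\<in>{1..k}. borel)"
proof -
  let ?M = "\<Pi>\<^sub>M i\<in>{1..k}. (borel :: real measure)"
  have f: "(\<lambda>x. \<lfloor>real N * x i / real k\<rfloor>) \<in> measurable ?M (count_space UNIV)" if "i \<in> {1..<k}" for i
  proof -
    have [measurable]: "(\<lambda>x. x i) \<in> borel_measurable ?M"
      by (rule component_measurable) (use that in auto)
    show ?thesis by measurable
  qed
  have "{x \<in> space ?M. \<forall>i\<in>{1..<k}. \<lfloor>real N * x i / real k\<rfloor> = s i} \<in> sets ?M"
    using f by measurable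
  moreover have "cell N k s = Q0 k \<inter> {x \<in> space ?M. \<forall>i\<in>{1..<k}. \<lfloor>real N * x i / real k\<rfloor> = s i}"
    unfolding cell_def shift_of_iff[OF assms] using sets.sets_into_space[OF Q0_sets] by auto
  ultimately show ?thesis using Q0_sets by auto
qed

lemma floor_box:
  assumes "N > 0" "k \<ge> 1"
  shows "\<lfloor>real N * y / real k\<rfloor> = m \<longleftrightarrow>
    y \<in> {real_of_int m * real k / real N..<(real_of_int m + 1) * real k / real N}"
  using assms by (auto simp: floor_eq_iff field_simps)

lemma box_prod:
  assumes "N > 0"
  shows "(\<Prod>i\<in>{1..<k}. (real_of_int (s i) + 1) * real k / real N - real_of_int (s i) * real k / real N)
    = (real k / real N) ^ (k - 1)"
proof -
  have "(real_of_int m + 1) * real k / real N - real_of_int m * real k / real N = real k / real N" for m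
    by (simp add: distrib_right add_divide_distrib)
  then show ?thesis by simp
qed

text \<open>In the free coordinates a cell is a half-open box of side \<open>k / N\<close>
  intersected with the slice, so its measure is that of the box whenever the box lies
  inside.\<close>

lemma measure_cell_le:
  assumes N: "N > 0" and k: "k \<ge> 1" and s: "s \<in> {1..k} \<rightarrow>\<^sub>E UNIV" "(\<Sum>j = 1..k. s j) = 0"
  shows "measure (uniform_Q0 k) (cell N k s) \<le> cell_prob N k"
    and "(\<Pi>\<^sub>E i\<in>{1..<k}. {real_of_int (s i) * real k / real N..<(real_of_int (s i) + 1) * real k / real N})
      \<subseteq> slice_preimage k (Q0 k) \<Longrightarrow> measure (uniform_Q0 k) (cell N k s) = cell_prob N k"
proof -
  let ?B = "\<Pi>\<^sub>E i\<in>{1..<k}. {real_of_int (s i) * real k / real N..<(real_of_int (s i) + 1) * real k / real N}"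
  have V: "slice_volume k > 0" by (rule emeasure_slice_preimage_Q0(2)[OF k])
  have eB: "emeasure (slice_base k) ?B = ennreal ((real k / real N) ^ (k - 1))"
    unfolding box_prod[OF N, where s = s and k = k, symmetric]
    by (rule emeasure_slice_box(2)) (auto intro!: divide_right_mono mult_right_mono)
  have pre: "slice_preimage k (cell N k s) = slice_preimage k (Q0 k) \<inter> ?B"
  proof -
    have "x \<in> slice_preimage k (cell N k s) \<longleftrightarrow> x \<in> slice_preimage k (Q0 k) \<inter> ?B" for x
    proof -
      have "(\<forall>i\<in>{1..<k}. \<lfloor>real N * slice_embed k x i / real k\<rfloor> = s i) \<longleftrightarrow>
        (\<forall>i\<in>{1..<k}. x i \<in> {real_of_int (s i) * real k / real N..<(real_of_int (s i) + 1) * real k / real N})"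
        unfolding floor_box[OF N k] by (auto simp: slice_embed_def)
      then show ?thesis
        unfolding slice_preimage_def cell_def shift_of_iff[OF k s]
        by (auto simp: space_slice_base PiE_def)
    qed
    then show ?thesis by blast
  qed
  have em: "emeasure (uniform_Q0 k) (cell N k s)
    = emeasure (slice_base k) (slice_preimage k (Q0 k) \<inter> ?B) / ennreal (slice_volume k)"
    using emeasure_uniform_Q0[OF k cell_sets[OF k s]] by (simp add: cell_def pre[unfolded cell_def])
  have "emeasure (uniform_Q0 k) (cell N k s) \<le> ennreal ((real k / real N) ^ (k - 1)) / ennreal (slice_volume k)"
    unfolding em eB[symmetric] by (intro divide_right_mono_ennreal emeasure_mono Int_lower2 box_sets)
  also have "\<dots> = ennreal (cell_prob N k)" using V by (simp add: cell_prob_def divide_ennreal)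
  finally show "measure (uniform_Q0 k) (cell N k s) \<le> cell_prob N k"
    unfolding measure_def using V by (intro enn2real_leI) (auto simp: cell_prob_def)
  assume "?B \<subseteq> slice_preimage k (Q0 k)"
  then have int: "slice_preimage k (Q0 k) \<inter> ?B = ?B" by blast
  have "emeasure (uniform_Q0 k) (cell N k s) = ennreal (cell_prob N k)"
    unfolding em int eB using V by (simp add: cell_prob_def divide_ennreal)
  then show "measure (uniform_Q0 k) (cell N k s) = cell_prob N k"
    unfolding measure_def using V by (simp add: cell_prob_def)
qed

lemma good_shiftsD:
  assumes "s \<in> good_shifts N k e"
  shows "s \<in> {1..k} \<rightarrow>\<^sub>E UNIV" "(\<Sum>j = 1..k. s j) = 0"
  using assms by (auto simp: good_shifts_def)

text \<open>A point of the box is off \<open>k * s / N\<close> by at most \<open>k / N\<close> in a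
  free coordinate and by at most \<open>k ^ 2 / N\<close> in the last one, where the errors add up.
  The margin in \<open>good_shifts\<close> absorbs both, so the cell is full.\<close>

lemma measure_cell_good:
  assumes N: "N > 0" and k: "k \<ge> 1" and e: "0 \<le> e" and s: "s \<in> good_shifts N k e"
  shows "measure (uniform_Q0 k) (cell N k s) = cell_prob N k"
proof (rule measure_cell_le(2)[OF N k good_shiftsD[OF s]], rule subsetI)
  fix x
  assume x: "x \<in> (\<Pi>\<^sub>E i\<in>{1..<k}. {real_of_int (s i) * real k / real N..<(real_of_int (s i) + 1) * real k / real N})"
  have bound: "real k * \<bar>real_of_int (s i)\<bar> + real k ^ 2 \<le> real N" if "i \<in> {1..k}" for i
  proof -
    have "real k * \<bar>real_of_int (s i)\<bar> + slack k * e * real N + real k ^ 2 < real N"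
      using s that by (auto simp: good_shifts_def)
    moreover have "0 \<le> slack k * e * real N" using e slack_nonneg by simp
    ultimately show ?thesis by linarith
  qed
  have k2: "real k \<le> real k ^ 2" using k by (simp add: power2_eq_square)
  have d: "\<bar>real N * x i - real k * real_of_int (s i)\<bar> \<le> real k" if "i \<in> {1..<k}" for i
  proof -
    have "x i \<in> {real_of_int (s i) * real k / real N..<(real_of_int (s i) + 1) * real k / real N}"
      using x that by (auto simp: PiE_def Pi_def)
    then have "real_of_int (s i) * real k \<le> real N * x i" "real N * x i \<le> (real_of_int (s i) + 1) * real k"
      using N by (auto simp: field_simps)
    then show ?thesis by (simp add: algebra_simps abs_le_iff)
  qed
  have small: "\<bar>x i\<bar> \<le> 1" if i: "i \<in> {1..<k}" for i
  proof -
    have "real N * \<bar>x i\<bar> = \<bar>real N * x i\<bar>" by (simp add: abs_mult)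
    also have "\<dots> \<le> \<bar>real k * real_of_int (s i)\<bar> + real k" using d[OF i] by linarith
    also have "\<dots> = real k * \<bar>real_of_int (s i)\<bar> + real k" by (simp add: abs_mult)
    also have "\<dots> \<le> real N * 1"
    proof -
      have "i \<in> {1..k}" using i by simp
      from bound[OF this] k2 show ?thesis by linarith
    qed
    finally show ?thesis using N by (simp only: mult_le_cancel_left_pos of_nat_0_less_iff)
  qed
  have sk: "(\<Sum>i = 1..<k. s i) = - s k"
    using good_shiftsD(2)[OF s] unfolding insert_atLeastLessThan[OF k] by (subst (asm) sum.union_disjoint) auto
  have "real N * \<bar>\<Sum>i = 1..<k. x i\<bar> \<le> real N * 1"
  proof -
    have "real N * (\<Sum>i = 1..<k. x i) - real k * real_of_int (- s k)
      = (\<Sum>i = 1..<k. real N * x i - real k * real_of_int (s i))"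
      unfolding sk[symmetric] by (simp add: sum_subtractf sum_distrib_left)
    also have "\<bar>\<dots>\<bar> \<le> (\<Sum>i = 1..<k. \<bar>real N * x i - real k * real_of_int (s i)\<bar>)" by (rule sum_abs)
    also have "\<dots> \<le> (\<Sum>i = 1..<k. real k)" by (intro sum_mono d)
    also have "\<dots> \<le> real k ^ 2" using k by (simp add: power2_eq_square mult_right_mono)
    finally have "\<bar>real N * (\<Sum>i = 1..<k. x i)\<bar> \<le> \<bar>real k * real_of_int (- s k)\<bar> + real k ^ 2" by linarith
    also have "\<bar>real k * real_of_int (- s k)\<bar> = real k * \<bar>real_of_int (s k)\<bar>" by (simp add: abs_mult)
    also have "\<dots> + real k ^ 2 \<le> real N * 1" using bound[of k] k by simp
    finally show ?thesis by (simp add: abs_mult)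
  qed
  then have sum: "\<bar>\<Sum>i = 1..<k. x i\<bar> \<le> 1"
    using N by (simp only: mult_le_cancel_left_pos of_nat_0_less_iff)
  have "slice_embed k x i \<in> {-1..1}" if "i \<in> {1..k}" for i
  proof (cases "i = k")
    case False
    then have "\<bar>x i\<bar> \<le> 1" using small[of i] that by simp
    then show ?thesis using False by (auto simp: slice_embed_def abs_le_iff)
  qed (use sum in \<open>auto simp: slice_embed_def abs_le_iff\<close>)
  moreover have "slice_embed k x \<in> extensional {1..k}"
    using x k by (auto simp: slice_embed_def PiE_def extensional_def)
  ultimately have "slice_embed k x \<in> Q0 k"
    using sum_slice_embed[OF k, of x] by (simp add: Q0_def PiE_def)
  then show "x \<in> slice_preimage k (Q0 k)"
    using x by (auto simp: slice_preimage_def space_slice_base PiE_def)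
qed

lemma shift_of_close:
  assumes N: "N > 0" and k: "k \<ge> 1" and x: "x \<in> Q0 k" and i: "i \<in> {1..k}"
  shows "\<bar>real N * x i - real k * real_of_int (shift_of N k x i)\<bar> \<le> real k ^ 2"
proof -
  let ?f = "\<lambda>i. \<lfloor>real N * x i / real k\<rfloor>"
  have d: "\<bar>real N * x i - real k * real_of_int (?f i)\<bar> \<le> real k" for i
  proof -
    have "real k * real_of_int (?f i) \<le> real k * (real N * x i / real k)"
      "real k * (real N * x i / real k) \<le> real k * (real_of_int (?f i) + 1)"
      by (intro mult_left_mono; linarith)+
    moreover have "real k * (real N * x i / real k) = real N * x i" using k by simp
    ultimately have "real k * real_of_int (?f i) \<le> real N * x i" "real N * x i \<le> real k * (real_of_int (?f i) + 1)"
      by simp_all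
    then show ?thesis by (simp add: algebra_simps abs_le_iff)
  qed
  show ?thesis
  proof (cases "i < k")
    case True
    have "real k \<le> real k ^ 2" using k by (simp add: power2_eq_square)
    from order_trans[OF d[of i] this] show ?thesis using True i by (simp add: shift_of_def)
  next
    case False
    then have ik: "i = k" using i by simp
    have "(\<Sum>i = 1..k. x i) = 0" using x by (simp add: Q0_def)
    then have xk: "x k = - (\<Sum>i = 1..<k. x i)"
      unfolding insert_atLeastLessThan[OF k] by (subst (asm) sum.union_disjoint) auto
    have "real N * x i - real k * real_of_int (shift_of N k x i)
      = - (\<Sum>i = 1..<k. real N * x i - real k * real_of_int (?f i))"
      unfolding ik xk using k by (simp add: shift_of_def sum_subtractf sum_distrib_left)
    also have "\<bar>\<dots>\<bar> \<le> (\<Sum>i = 1..<k. \<bar>real N * x i - real k * real_of_int (?f i)\<bar>)"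
      unfolding abs_minus_cancel by (rule sum_abs)
    also have "\<dots> \<le> (\<Sum>i = 1..<k. real k)" by (intro sum_mono d)
    also have "\<dots> \<le> real k ^ 2" using k by (simp add: power2_eq_square mult_right_mono)
    finally show ?thesis .
  qed
qed

lemma shift_of_all_shifts:
  assumes N: "N > 0" and k: "k \<ge> 1" and e: "0 \<le> e" and x: "x \<in> Q0 k"
  shows "shift_of N k x \<in> all_shifts N k e"
  unfolding all_shifts_def
proof (intro CollectI conjI ballI)
  show "shift_of N k x \<in> {1..k} \<rightarrow>\<^sub>E UNIV" by (simp add: shift_of_def)
  show "(\<Sum>j = 1..k. shift_of N k x j) = 0"
    unfolding insert_atLeastLessThan[OF k] shift_of_def using k by (subst sum.union_disjoint) auto
  fix j assume j: "j \<in> {1..k}"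
  have "real N * \<bar>x j\<bar> \<le> real N * 1" using Q0_bounds[OF x j] by (intro mult_left_mono) auto
  moreover have "\<bar>real N * x j\<bar> = real N * \<bar>x j\<bar>" by (simp add: abs_mult)
  moreover have "\<bar>real k * real_of_int (shift_of N k x j)\<bar> = real k * \<bar>real_of_int (shift_of N k x j)\<bar>"
    by (simp add: abs_mult)
  moreover have "0 \<le> slack k * e * real N" using e slack_nonneg by simp
  ultimately show "real k * \<bar>real_of_int (shift_of N k x j)\<bar> \<le> real N + slack k * e * real N + real k ^ 2"
    using shift_of_close[OF N k x j] by linarith
qed

lemma cell_sets_uniform:
  assumes "k \<ge> 1" "s \<in> {1..k} \<rightarrow>\<^sub>E UNIV" "(\<Sum>j = 1..k. s j) = 0"
  shows "cell N k s \<in> sets (uniform_Q0 k)"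
proof -
  have "cell N k s = Q0 k \<inter> cell N k s" by (auto simp: cell_def)
  then show ?thesis unfolding sets_uniform_Q0 sets_restrict_space using cell_sets[OF assms] by blast
qed

text \<open>The cells of \<open>all_shifts\<close> cover the slice and none exceeds
  \<open>cell_prob\<close>. This bounds lattice points from below in units of cells, with no formula
  for the volume of the slice.\<close>

lemma card_all_shifts_ge:
  assumes N: "N > 0" and k: "k \<ge> 1" and e: "0 \<le> e" and fin: "finite (all_shifts N k e)"
  shows "1 \<le> cell_prob N k * real (card (all_shifts N k e))"
proof -
  interpret prob_space "uniform_Q0 k" by (rule prob_space_uniform_Q0[OF k])
  have s: "s \<in> {1..k} \<rightarrow>\<^sub>E UNIV" "(\<Sum>j = 1..k. s j) = 0" if "s \<in> all_shifts N k e" for s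
    using that by (auto simp: all_shifts_def)
  have "Q0 k = (\<Union>s\<in>all_shifts N k e. cell N k s)"
    using shift_of_all_shifts[OF N k e] by (auto simp: cell_def)
  then have "1 = prob (\<Union>s\<in>all_shifts N k e. cell N k s)" using prob_space by simp
  also have "\<dots> \<le> (\<Sum>s\<in>all_shifts N k e. prob (cell N k s))"
    using fin cell_sets_uniform[OF k s] by (intro finite_measure_subadditive_finite) auto
  also have "\<dots> \<le> (\<Sum>s\<in>all_shifts N k e. cell_prob N k)"
    using s by (intro sum_mono measure_cell_le(1)[OF N k]) auto
  finally show ?thesis by (simp add: mult.commute)
qed

text \<open>Good cells are full and pairwise disjoint, so the left side is the probability of their
  union.\<close>

lemma card_good_shifts_le:
  assumes N: "N > 0" and k: "k \<ge> 1" and e: "0 \<le> e" and fin: "finite (good_shifts N k e)"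
  shows "cell_prob N k * real (card (good_shifts N k e)) \<le> 1"
proof -
  interpret prob_space "uniform_Q0 k" by (rule prob_space_uniform_Q0[OF k])
  have "cell_prob N k * real (card (good_shifts N k e)) = (\<Sum>s\<in>good_shifts N k e. prob (cell N k s))"
    using measure_cell_good[OF N k e] by simp
  also have "\<dots> = prob (\<Union>s\<in>good_shifts N k e. cell N k s)"
    using fin cell_sets_uniform[OF k good_shiftsD]
    by (intro finite_measure_finite_Union[symmetric]) (auto simp: disjoint_family_on_def cell_def)
  also have "\<dots> \<le> 1" by (rule prob_le_1)
  finally show ?thesis .
qed

section \<open>Coupling permutations with segments\<close>

text \<open>The time error \<open>k * e + k / N\<close> counts twice, as it affects both
  coordinates; \<open>slack k * e + k ^ 2 / N\<close> is the error of the vertical offset; the rest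
  is the diameter 4 times the unmatched mass.\<close>

definition matching_error :: "nat \<Rightarrow> nat \<Rightarrow> real \<Rightarrow> real" where
  "matching_error N k e = 2 * (real k * e + real k / real N) + slack k * e + real k ^ 2 / real N
     + 4 * (real k * e + 2 / real N)"

lemma measure_strand_rectangle:
  assumes k: "k > 0" and j: "j \<in> {1..k}" and ab: "0 \<le> a" "a \<le> b" "b \<le> 1"
  shows "{j} \<times> {a..<b} \<in> sets (strand_space k)"
    "measure (strand_space k) ({j} \<times> {a..<b}) = (b - a) / real k"
proof -
  interpret B: prob_space unit_lebesgue by (rule prob_space_unit_lebesgue)
  let ?U = "uniform_count_measure {1..k}"
  have L: "{a..<b} \<in> sets unit_lebesgue" "emeasure unit_lebesgue {a..<b} = ennreal (b - a)"
  proof -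
    have sub: "{a..<b} \<subseteq> {0..1}" using ab by auto
    then show "{a..<b} \<in> sets unit_lebesgue"
      unfolding unit_lebesgue_def by (subst sets_restrict_space_iff) auto
    show "emeasure unit_lebesgue {a..<b} = ennreal (b - a)"
      unfolding unit_lebesgue_def using sub ab by (subst emeasure_restrict_space) auto
  qed
  have U: "{j} \<in> sets ?U" "emeasure ?U {j} = ennreal (1 / real k)"
    using j by (auto simp: sets_uniform_count_measure emeasure_uniform_count_measure)
  show "{j} \<times> {a..<b} \<in> sets (strand_space k)"
    unfolding strand_space_def using U L by auto
  have "emeasure (strand_space k) ({j} \<times> {a..<b}) = ennreal (1 / real k) * ennreal (b - a)"
    unfolding strand_space_def using B.emeasure_pair_measure_Times[OF U(1) L(1)] U L by simp
  also have "\<dots> = ennreal ((b - a) / real k)" using ab by (simp flip: ennreal_mult)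
  finally show "measure (strand_space k) ({j} \<times> {a..<b}) = (b - a) / real k"
    using ab unfolding measure_def by simp
qed

text \<open>In a good word the \<open>m\<close>-th letter \<open>j\<close> sits near
  \<open>k * m\<close>, so times agree, and its displacement is near \<open>k * s j\<close>, as is
  \<open>N * x j\<close> because \<open>x\<close> rounds to \<open>s\<close>. The first order of
  arguments enters the cost of the outer coupling, the second describes neighbourhoods of a segment
  measure.\<close>

lemma Wass1_matched_le:
  assumes N: "N > 0" and k: "k \<ge> 1" and e: "e \<le> 1 / (2 * real k)" "0 \<le> e"
    and t: "(p, v, s) \<in> good_triples N k e" and \<sigma>: "\<sigma> = perm_of N (p, v, s)"
    and x: "x \<in> cell N k s"
  shows "Wass1 (mu_hat N \<sigma>) (segments_measure k x) \<le> matching_error N k e"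
    "Wass1 (segments_measure k x) (mu_hat N \<sigma>) \<le> matching_error N k e"
proof -
  let ?I = "{1..int N}"
  have Np: "real N > 0" and kp: "real k > 0" using N k by simp_all
  have pv: "(p, v) \<in> good_pairs N k e" and s: "s \<in> good_shifts N k e"
    using t by (auto simp: good_triples_def)
  have p: "p \<in> good_words N k e" using pv by (simp add: good_pairs_def)
  have xQ: "x \<in> Q0 k" and sx: "shift_of N k x = s" using x by (auto simp: cell_def)
  have pj: "p i \<in> {1..k}" if "i \<in> ?I" for i
    using good_words_words[OF p] that by (auto simp: words_def)
  \<comment> \<open>Strictly below 1, which makes \<open>M < 1\<close> as
    \<open>partial_coupling\<close> requires; the loss is at most \<open>1 / N\<close>.\<close>
  define c where "c = real N / (real N + 1)"
  have c: "0 < c" "c < 1" using Np by (auto simp: c_def)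
  define m where "m i = real (cnt p (p i) i)" for i
  have m1: "1 \<le> m i" if "i \<in> ?I" for i
  proof -
    have "i \<in> {a \<in> {1..i}. p a = p i}" using that by simp
    then have "cnt p (p i) i > 0" unfolding cnt_def by (subst card_gt_0_iff) auto
    then show ?thesis by (simp add: m_def)
  qed
  \<comment> \<open>An interval that would pass time 1 is dropped; this happens when a colour has
    more than \<open>N / k\<close> letters.\<close>
  define S where "S i = (if m i * real k \<le> real N
    then {p i} \<times> {(m i - 1) * real k / real N..<m i * real k / real N} else {})" for i
  have S: "S i \<in> sets (strand_space k)" "measure (strand_space k) (S i) = (if m i * real k \<le> real N then 1 / real N else 0)"
    if i: "i \<in> ?I" for i
  proof -
    have "S i \<in> sets (strand_space k) \<and> measure (strand_space k) (S i) = (if m i * real k \<le> real N then 1 / real N else 0)"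
    proof (cases "m i * real k \<le> real N")
      case True
      have ab: "0 \<le> (m i - 1) * real k / real N" "(m i - 1) * real k / real N \<le> m i * real k / real N"
        "m i * real k / real N \<le> 1"
        using m1[OF i] True Np by (auto intro!: divide_right_mono mult_right_mono)
      have "m i * real k / real N - (m i - 1) * real k / real N = real k / real N"
        by (simp add: left_diff_distrib diff_divide_distrib)
      then have "(m i * real k / real N - (m i - 1) * real k / real N) / real k = 1 / real N"
        using kp by simp
      then show ?thesis
        using measure_strand_rectangle[OF _ pj[OF i] ab] k True unfolding S_def by simp
    qed (simp add: S_def)
    then show "S i \<in> sets (strand_space k)" "measure (strand_space k) (S i) = (if m i * real k \<le> real N then 1 / real N else 0)"
      by simp_all
  qed
  \<comment> \<open>A rectangle has mass \<open>1 / N\<close>, so this density couples mass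
    \<open>c\<close> of position \<open>i\<close> with it.\<close>
  define u where "u i w = c * real N * indicator (S i) w" for i w
  interpret Q: prob_space "strand_space k" using k by (intro prob_space_strand_space) simp
  have u_int: "(\<integral>w. u i w \<partial>strand_space k) = (if m i * real k \<le> real N then c else 0)" if i: "i \<in> ?I" for i
    unfolding u_def using N
    by (simp add: sets.Int_space_eq2[OF S(1)[OF i]] S(2)[OF i] del: space_strand_space)
  \<comment> \<open>Rectangles that meet have the same colour and the same index \<open>m\<close>,
    so they come from letters of one colour at equal height.\<close>
  have S_unique: "i = i'" if i: "i \<in> ?I" "i' \<in> ?I" "w \<in> S i" "w \<in> S i'" for i i' w
  proof -
    have w: "fst w = p i" "fst w = p i'"
      "(m i - 1) * real k / real N \<le> snd w" "snd w < m i * real k / real N"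
      "(m i' - 1) * real k / real N \<le> snd w" "snd w < m i' * real k / real N"
      using that by (auto simp: S_def split: if_splits)
    have "(m i - 1) * real k / real N < m i' * real k / real N" using w by linarith
    then have 1: "m i - 1 < m i'" using kp Np by (simp add: divide_less_cancel)
    have "(m i' - 1) * real k / real N < m i * real k / real N" using w by linarith
    then have 2: "m i' - 1 < m i" using kp Np by (simp add: divide_less_cancel)
    have "cnt p (p i) i = cnt p (p i) i'"
      using 1 2 w(1,2) unfolding m_def by simp
    then have "height N p (p i) i = height N p (p i) i'" using i by (simp add: height_base)
    then show ?thesis
      using w i by (intro height_inj[OF N, of p i "p i" i']) (auto simp: rep_id)
  qed
  have u_sum: "(\<Sum>i\<in>?I. u i w) \<le> real (card ?I)" for w
  proof (cases "\<exists>i\<in>?I. w \<in> S i")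
    case True
    then obtain i where i: "i \<in> ?I" "w \<in> S i" by blast
    have "(\<Sum>i'\<in>?I. u i' w) = (\<Sum>i'\<in>{i}. u i' w)"
    proof (rule sum.mono_neutral_right)
      show "\<forall>i'\<in>?I - {i}. u i' w = 0"
      proof
        fix i' assume "i' \<in> ?I - {i}"
        then have "w \<notin> S i'" using S_unique[OF i(1) _ i(2)] by blast
        then show "u i' w = 0" by (simp add: u_def)
      qed
    qed (use i in auto)
    also have "\<dots> \<le> real N" using i c Np by (simp add: u_def)
    finally show ?thesis by simp
  next
    case False
    then have "(\<Sum>i\<in>?I. u i w) = 0" by (intro sum.neutral) (auto simp: u_def)
    then show ?thesis by simp
  qed
  define M where "M = (\<Sum>i\<in>?I. \<integral>w. u i w \<partial>strand_space k) / real (card ?I)"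
  define good where "good = {i \<in> ?I. m i * real k \<le> real N}"
  have M_eq: "M = c * real (card good) / real N"
  proof -
    have "(\<Sum>i\<in>?I. \<integral>w. u i w \<partial>strand_space k) = (\<Sum>i\<in>?I. if m i * real k \<le> real N then c else 0)"
      by (intro sum.cong refl u_int)
    also have "\<dots> = c * real (card good)"
      by (simp add: sum.If_cases good_def Int_def mult.commute)
    finally show ?thesis by (simp add: M_def)
  qed
  have good_le: "real (card good) \<le> real N"
  proof -
    have "good \<subseteq> ?I" by (auto simp: good_def)
    from card_mono[OF _ this] show ?thesis by simp
  qed
  have mi: "\<bar>m i - real_of_int i / real k\<bar> \<le> e * real N" if "i \<in> ?I" for i
    unfolding m_def by (rule good_wordD[OF p pj[OF that] that])
  \<comment> \<open>A dropped position has \<open>k * m > N\<close>, while \<open>k * m\<close>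
    exceeds \<open>i\<close> by at most \<open>k * e * N\<close>; so it lies within
    \<open>k * e * N\<close> of the end of the period.\<close>
  have good_ge: "real N - (real k * e * real N + 1) \<le> real (card good)"
  proof -
    have "?I - good \<subseteq> {y :: int. real N - real k * e * real N \<le> real_of_int y \<and> real_of_int y \<le> real N}"
    proof
      fix i assume "i \<in> ?I - good"
      then have i: "i \<in> ?I" "real N < m i * real k" by (auto simp: good_def)
      have "real k * m i \<le> real k * (real_of_int i / real k + e * real N)"
        using mi[OF i(1)] kp by (intro mult_left_mono) auto
      also have "\<dots> = real_of_int i + real k * e * real N" using k by (subst distrib_left) simp
      finally have "real N - real k * e * real N \<le> real_of_int i" using i(2) by (simp add: mult.commute)
      moreover have "real_of_int i \<le> real N" using i(1) by simp
      ultimately show "i \<in> {y :: int. real N - real k * e * real N \<le> real_of_int y \<and> real_of_int y \<le> real N}" by simp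
    qed
    moreover have le: "real N - real k * e * real N \<le> real N" using e by simp
    ultimately have "real (card (?I - good)) \<le> real N - (real N - real k * e * real N) + 1"
      using card_mono[OF card_int_interval_le(1)[OF le]] card_int_interval_le(2)[OF le]
      by (meson of_nat_le_iff order_trans)
    moreover have "card (?I - good) = N - card good" unfolding good_def by (subst card_Diff_subset) auto
    ultimately show ?thesis using good_le by (simp add: of_nat_diff)
  qed
  have M1: "M < 1"
  proof -
    have "M \<le> c" unfolding M_eq using good_le c Np by (simp add: divide_le_eq)
    then show ?thesis using c by simp
  qed
  have M2: "1 - M \<le> real k * e + 2 / real N"
  proof -
    have "c * (real N - (real k * e * real N + 1)) / real N \<le> M"
      unfolding M_eq using c Np good_ge by (intro divide_right_mono mult_left_mono) auto
    moreover have "c * (real N - (real k * e * real N + 1)) / real N = c - c * (real k * e + 1 / real N)"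
      using Np by (simp add: field_simps)
    moreover have "c * (real k * e + 1 / real N) \<le> 1 * (real k * e + 1 / real N)"
      using c e by (intro mult_right_mono) auto
    moreover have "1 - c \<le> 1 / real N" unfolding c_def using Np by (simp add: field_simps)
    ultimately show ?thesis by simp
  qed
  obtain J where J: "prob_space J" "sets J = sets (count_space ?I \<Otimes>\<^sub>M strand_space k)"
    "distr J (count_space ?I) fst = uniform_count_measure ?I" "distr J (strand_space k) snd = strand_space k"
    "emeasure J {q \<in> space J. u (fst q) (snd q) = 0} \<le> ennreal (1 - M)"
  proof (rule partial_coupling[of ?I "strand_space k" u M])
    show "?I \<noteq> {}" using N by simp
    show "u i \<in> borel_measurable (strand_space k)" if "i \<in> ?I" for i
      unfolding u_def using S(1)[OF that] by measurable
    show "0 \<le> u i w" for i w unfolding u_def using c by simp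
    show "(\<integral>w. u i w \<partial>strand_space k) \<le> 1" if "i \<in> ?I" for i
      using u_int[OF that] c by simp
  qed (use u_sum M1 M_def Q.prob_space_axioms in auto)
  have \<sigma>A: "\<sigma> \<in> bounded_avoiders N (k + 1)" and L: "lifts N p v s \<sigma>"
    using good_triple_perm[OF N e t] \<sigma> by auto
  have bd: "\<forall>i\<in>?I. \<bar>\<sigma> i - i\<bar> < int N"
    using \<sigma>A by (auto simp: bounded_avoiders_def bounded_affine_permutation_def)
  define f where "f i = (real_of_int i / real N, real_of_int (\<sigma> i) / real N)" for i
  define h where "h w = (snd w, x (fst w) + snd w)" for w :: "nat \<times> real"
  have f_diamond: "f i \<in> diamond" if "i \<in> ?I" for i
    unfolding f_def by (rule mu_hat_eq(2)[OF N bd that])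
  have fm: "f \<in> measurable (count_space ?I) diamond_borel"
    using f_diamond by (auto simp: measurable_def)
  have xb: "\<forall>j\<in>{1..k}. \<bar>x j\<bar> \<le> 1" using Q0_bounds[OF xQ] by blast
  have hm: "h \<in> measurable (strand_space k) diamond_borel"
    unfolding h_def by (rule strand_measurable[OF xb])
  have fst_m: "fst \<in> measurable J (count_space ?I)" and snd_m: "snd \<in> measurable J (strand_space k)"
    unfolding measurable_cong_sets[OF J(2) refl] by auto
  have X: "(\<lambda>q. f (fst q)) \<in> measurable J diamond_borel" by (rule measurable_compose[OF fst_m fm])
  have Y: "(\<lambda>q. h (snd q)) \<in> measurable J diamond_borel" by (rule measurable_compose[OF snd_m hm])
  have dX: "distr J diamond_borel (\<lambda>q. f (fst q)) = mu_hat N \<sigma>"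
  proof -
    have "distr J diamond_borel (\<lambda>q. f (fst q)) = distr (distr J (count_space ?I) fst) diamond_borel f"
      using fst_m fm by (simp add: distr_distr comp_def)
    then show ?thesis unfolding J(3) mu_hat_eq(1)[OF N bd] f_def .
  qed
  have dY: "distr J diamond_borel (\<lambda>q. h (snd q)) = segments_measure k x"
  proof -
    have "distr J diamond_borel (\<lambda>q. h (snd q)) = distr (distr J (strand_space k) snd) diamond_borel h"
      using snd_m hm by (simp add: distr_distr comp_def)
    then show ?thesis unfolding J(4) h_def using k xb by (subst segments_measure_eq) auto
  qed
  define Z where "Z = {q \<in> space J. u (fst q) (snd q) = 0}"
  have Zs: "Z \<in> sets J"
  proof -
    have "(\<lambda>q. u (fst q) (snd q)) \<in> borel_measurable (count_space ?I \<Otimes>\<^sub>M strand_space k)"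
    proof (rule measurable_pair_measure_countable1)
      fix i assume "i \<in> ?I"
      then show "(\<lambda>w. u (fst (i, w)) (snd (i, w))) \<in> borel_measurable (strand_space k)"
        unfolding u_def using S(1) by simp
    qed (simp add: countable_finite)
    then have "(\<lambda>q. u (fst q) (snd q)) \<in> borel_measurable J"
      using measurable_cong_sets[OF J(2) refl] by blast
    then show ?thesis unfolding Z_def by measurable
  qed
  let ?\<delta> = "2 * (real k * e + real k / real N) + slack k * e + real k ^ 2 / real N"
  have close: "dist (f (fst q)) (h (snd q)) \<le> ?\<delta>" if q: "q \<in> space J" "q \<notin> Z" for q
  proof -
    obtain i j t where q_eq: "q = (i, j, t)" by (cases q) auto
    have i: "i \<in> ?I" using measurable_space[OF fst_m q(1)] q_eq by simp
    have "(j, t) \<in> S i" using q q_eq by (auto simp: Z_def u_def indicator_def split: if_splits)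
    then have jt: "j = p i" "(m i - 1) * real k / real N \<le> t" "t < m i * real k / real N"
      by (auto simp: S_def split: if_splits)
    have j: "j \<in> {1..k}" using pj[OF i] jt by simp
    have 1: "\<bar>m i * real k / real N - real_of_int i / real N\<bar> \<le> real k * e"
    proof -
      have "m i * real k / real N - real_of_int i / real N = real k / real N * (m i - real_of_int i / real k)"
        using Np kp by (simp add: field_simps)
      then have "\<bar>m i * real k / real N - real_of_int i / real N\<bar> = real k / real N * \<bar>m i - real_of_int i / real k\<bar>"
        by (simp add: abs_mult)
      also have "\<dots> \<le> real k / real N * (e * real N)" using mi[OF i] by (intro mult_left_mono) auto
      also have "\<dots> = real k * e" using Np by simp
      finally show ?thesis .
    qed
    have "m i * real k / real N - (m i - 1) * real k / real N = real k / real N"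
      by (simp add: left_diff_distrib diff_divide_distrib)
    then have 2: "\<bar>real_of_int i / real N - t\<bar> \<le> real k * e + real k / real N"
      using 1 jt by linarith
    have "\<bar>real_of_int (\<sigma> i) - real_of_int i - real k * real_of_int (s (p i))\<bar> \<le> slack k * e * real N"
      using good_shifts_le[OF s _ e(2)] by (intro lifts_displacement[OF N pv e L _ i])
    moreover have "\<bar>real N * x j - real k * real_of_int (s j)\<bar> \<le> real k ^ 2"
      using shift_of_close[OF N k xQ j] sx by simp
    ultimately have "\<bar>real_of_int (\<sigma> i) - real_of_int i - real N * x j\<bar> \<le> slack k * e * real N + real k ^ 2"
      unfolding jt(1) by linarith
    then have "\<bar>real_of_int (\<sigma> i) - real_of_int i - real N * x j\<bar> / real N \<le> (slack k * e * real N + real k ^ 2) / real N"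
      by (intro divide_right_mono) auto
    moreover have "\<bar>real_of_int (\<sigma> i) - real_of_int i - real N * x j\<bar> / real N
      = \<bar>real_of_int (\<sigma> i) / real N - real_of_int i / real N - x j\<bar>"
    proof -
      have "real_of_int (\<sigma> i) / real N - real_of_int i / real N - x j
        = (real_of_int (\<sigma> i) - real_of_int i - real N * x j) / real N"
        using Np by (simp add: field_simps)
      then show ?thesis by simp
    qed
    moreover have "(slack k * e * real N + real k ^ 2) / real N = slack k * e + real k ^ 2 / real N"
      using Np by (simp add: add_divide_distrib)
    ultimately have 3: "\<bar>real_of_int (\<sigma> i) / real N - real_of_int i / real N - x j\<bar> \<le> slack k * e + real k ^ 2 / real N"
      by simp
    have "dist (f (fst q)) (h (snd q)) \<le> \<bar>real_of_int i / real N - t\<bar> + \<bar>real_of_int (\<sigma> i) / real N - (x j + t)\<bar>"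
      using dist_prod_le[of "f (fst q)" "h (snd q)"] unfolding q_eq f_def h_def by simp
    also have "\<bar>real_of_int (\<sigma> i) / real N - (x j + t)\<bar>
      \<le> \<bar>real_of_int (\<sigma> i) / real N - real_of_int i / real N - x j\<bar> + \<bar>real_of_int i / real N - t\<bar>"
      by linarith
    also note 3
    also note 2
    finally show ?thesis by (simp add: algebra_simps)
  qed
  have em: "emeasure J Z \<le> ennreal (real k * e + 2 / real N)"
    using order_trans[OF J(5) ennreal_leI[OF M2]] unfolding Z_def .
  have nn: "0 \<le> ?\<delta>" "0 \<le> real k * e + 2 / real N"
    using e slack_nonneg by auto
  show "Wass1 (mu_hat N \<sigma>) (segments_measure k x) \<le> matching_error N k e"
    unfolding matching_error_def dX[symmetric] dY[symmetric]
    by (rule Wass1_distr_le[OF J(1) X Y close Zs em nn])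
  show "Wass1 (segments_measure k x) (mu_hat N \<sigma>) \<le> matching_error N k e"
    unfolding matching_error_def dX[symmetric] dY[symmetric]
    using close by (intro Wass1_distr_le[OF J(1) Y X _ Zs em nn]) (simp add: dist_commute)
qed

section \<open>Coupling avoiders with points of the slice\<close>

definition matched :: "nat \<Rightarrow> nat \<Rightarrow> real \<Rightarrow> (int \<Rightarrow> int) \<Rightarrow> (nat \<Rightarrow> real) \<Rightarrow> bool" where
  "matched N k e \<sigma> x \<longleftrightarrow> (\<exists>p v s. (p, v, s) \<in> good_triples N k e \<and> \<sigma> = perm_of N (p, v, s) \<and> x \<in> cell N k s)"

lemma triples_eq_image:
  "{(p, v, s). (p, v) \<in> X \<and> s \<in> S} = (\<lambda>z. (fst (fst z), snd (fst z), snd z)) ` (X \<times> S)"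
  by force

lemma good_triples_eq: "good_triples N k e =
    (\<lambda>z. (fst (fst z), snd (fst z), snd z)) ` (good_pairs N k e \<times> good_shifts N k e)"
  unfolding good_triples_def by (rule triples_eq_image)

lemma card_good_triples:
  assumes "finite (good_shifts N k e)"
  shows "finite (good_triples N k e)"
    "card (good_triples N k e) = card (good_pairs N k e) * card (good_shifts N k e)"
proof -
  show "finite (good_triples N k e)" unfolding good_triples_eq using assms by simp
  have "inj_on (\<lambda>z. (fst (fst z), snd (fst z), snd z)) (good_pairs N k e \<times> good_shifts N k e)"
    by (auto simp: inj_on_def)
  then show "card (good_triples N k e) = card (good_pairs N k e) * card (good_shifts N k e)"
    unfolding good_triples_eq by (subst card_image) (auto simp: card_cartesian_product)
qed

lemma good_shifts_subset: "0 \<le> e \<Longrightarrow> good_shifts N k e \<subseteq> all_shifts N k e"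
proof
  fix s assume e: "0 \<le> e" and s: "s \<in> good_shifts N k e"
  have "0 \<le> slack k * e * real N" "0 \<le> real k ^ 2" using e slack_nonneg by simp_all
  then have "real k * \<bar>real_of_int (s j)\<bar> \<le> real N + slack k * e * real N + real k ^ 2" if "j \<in> {1..k}" for j
  proof -
    have "real k * \<bar>real_of_int (s j)\<bar> + slack k * e * real N + real k ^ 2 < real N"
      using s that by (auto simp: good_shifts_def)
    then show ?thesis using \<open>0 \<le> slack k * e * real N\<close> \<open>0 \<le> real k ^ 2\<close> by linarith
  qed
  then show "s \<in> all_shifts N k e" using good_shiftsD[OF s] by (simp add: all_shifts_def)
qed

lemma finite_bad_pairs: "finite (bad_pairs N k e)"
  by (rule finite_subset[of _ "words N k \<times> words N k"]) (auto simp: bad_pairs_def)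

lemma card_bad_triples_le:
  assumes fin: "finite (all_shifts N k e)"
  shows "finite (bad_triples N k e)"
    "card (bad_triples N k e) \<le> card (bad_pairs N k e) * (2 * N + 1) ^ k
      + card (good_pairs N k e) * card (all_shifts N k e - good_shifts N k e)"
proof -
  let ?X = "bad_pairs N k e \<times> ({1..k} \<rightarrow>\<^sub>E {- int N..int N})"
  let ?Y = "good_pairs N k e \<times> (all_shifts N k e - good_shifts N k e)"
  let ?f = "\<lambda>z. (fst (fst z), snd (fst z), snd z)"
  have eq: "bad_triples N k e = ?f ` (?X \<union> ?Y)"
    unfolding bad_triples_def triples_eq_image image_Un ..
  have fX: "finite ?X" using finite_bad_pairs by (simp add: finite_PiE)
  have fY: "finite ?Y" using fin by simp
  show "finite (bad_triples N k e)" unfolding eq using fX fY by blast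
  have c: "card ({1..k} \<rightarrow>\<^sub>E {- int N..int N}) = (2 * N + 1) ^ k"
  proof -
    have "card {- int N..int N} = 2 * N + 1" by simp
    then show ?thesis by (simp only: card_PiE finite_atLeastAtMost prod_constant card_atLeastAtMost diff_Suc_1)
  qed
  have "card (bad_triples N k e) \<le> card (?X \<union> ?Y)" unfolding eq using fX fY by (intro card_image_le) blast
  also have "\<dots> \<le> card ?X + card ?Y" by (rule card_Un_le)
  finally show "card (bad_triples N k e) \<le> card (bad_pairs N k e) * (2 * N + 1) ^ k
      + card (good_pairs N k e) * card (all_shifts N k e - good_shifts N k e)"
    by (simp only: card_cartesian_product c)
qed

text \<open>Each avoider with a good encoding has exactly \<open>fact k\<close> of them, and each
  remaining avoider comes from at least one bad triple.\<close>

lemma card_avoiders: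
  assumes N: "N > 0" and e: "e \<le> 1 / (2 * real k)" "0 \<le> e" and fin: "finite (all_shifts N k e)"
  shows "finite (bounded_avoiders N (k + 1))"
    "card (good_triples N k e) \<le> fact k * card (bounded_avoiders N (k + 1))"
    "fact k * card (bounded_avoiders N (k + 1)) \<le> card (good_triples N k e) + fact k * card (bad_triples N k e)"
proof -
  have finS: "finite (good_shifts N k e)" using finite_good_shifts[OF e(2)] .
  note fG = card_good_triples(1)[OF finS] and fB = card_bad_triples_le(1)[OF fin]
  note sub = bounded_avoiders_subset[OF N e]
  show fA: "finite (bounded_avoiders N (k + 1))" by (rule finite_subset[OF sub]) (use fG fB in blast)
  have "card (good_triples N k e) = (\<Sum>\<sigma>\<in>perm_of N ` good_triples N k e. card {t \<in> good_triples N k e. perm_of N t = \<sigma>})"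
    using sum.image_gen[OF fG, of "\<lambda>_. 1 :: nat" "perm_of N"] by simp
  also have "\<dots> = fact k * card (perm_of N ` good_triples N k e)"
    using card_fibre[OF N e] by simp
  finally have G: "card (good_triples N k e) = fact k * card (perm_of N ` good_triples N k e)" .
  have "perm_of N ` good_triples N k e \<subseteq> bounded_avoiders N (k + 1)"
    using good_triple_perm(2)[OF N e] by auto
  then show "card (good_triples N k e) \<le> fact k * card (bounded_avoiders N (k + 1))"
    unfolding G using fA by (intro mult_left_mono card_mono) auto
  have "card (bounded_avoiders N (k + 1)) \<le> card (perm_of N ` good_triples N k e \<union> perm_of N ` bad_triples N k e)"
    using fG fB by (intro card_mono sub) blast
  also have "\<dots> \<le> card (perm_of N ` good_triples N k e) + card (perm_of N ` bad_triples N k e)"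
    by (rule card_Un_le)
  also have "\<dots> \<le> card (perm_of N ` good_triples N k e) + card (bad_triples N k e)"
    using card_image_le[OF fB] by simp
  finally have "fact k * card (bounded_avoiders N (k + 1))
    \<le> fact k * (card (perm_of N ` good_triples N k e) + card (bad_triples N k e))"
    by (rule mult_left_mono) simp
  then show "fact k * card (bounded_avoiders N (k + 1)) \<le> card (good_triples N k e) + fact k * card (bad_triples N k e)"
    unfolding G by (simp add: distrib_left)
qed

text \<open>The three factors are the strictness factor, the share of the slice lying in good cells,
  and the share of avoiders that have a good encoding.\<close>

definition matched_mass :: "nat \<Rightarrow> nat \<Rightarrow> real \<Rightarrow> real" where
  "matched_mass N k e = real N / (real N + 1) * (cell_prob N k * real (card (good_shifts N k e)))
     * (real (card (good_triples N k e)) / (fact k * real (card (bounded_avoiders N (k + 1)))))"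

lemma cell_prob_nonneg: "k \<ge> 1 \<Longrightarrow> 0 \<le> cell_prob N k"
  unfolding cell_prob_def using emeasure_slice_preimage_Q0(2)[of k] by simp

text \<open>Every good encoding of an avoider spreads the same density over the cell of its shifts.
  Where the resulting density is positive, some encoding has \<open>x\<close> in its cell, which is
  the relation \<open>matched\<close>; the rest is left to \<open>partial_coupling\<close>.\<close>

lemma matched_coupling:
  assumes N: "N > 0" and k: "k \<ge> 1" and e: "e \<le> 1 / (2 * real k)" "0 \<le> e"
    and fin: "finite (all_shifts N k e)" and ne: "good_triples N k e \<noteq> {}"
  obtains J Z where "prob_space J"
    "sets J = sets (count_space (bounded_avoiders N (k + 1)) \<Otimes>\<^sub>M uniform_Q0 k)"
    "distr J (count_space (bounded_avoiders N (k + 1))) fst = uniform_count_measure (bounded_avoiders N (k + 1))"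
    "distr J (uniform_Q0 k) snd = uniform_Q0 k"
    "Z \<in> sets J" "emeasure J Z \<le> ennreal (1 - matched_mass N k e)"
    "\<And>q. q \<in> space J \<Longrightarrow> q \<notin> Z \<Longrightarrow> matched N k e (fst q) (snd q)"
proof -
  let ?A = "bounded_avoiders N (k + 1)" and ?G = "good_triples N k e" and ?S = "good_shifts N k e"
  let ?q = "cell_prob N k"
  interpret Q: prob_space "uniform_Q0 k" by (rule prob_space_uniform_Q0[OF k])
  have finS: "finite ?S" using finite_good_shifts[OF e(2)] .
  note fG = card_good_triples[OF finS] and A = card_avoiders[OF N e fin]
  have sub: "perm_of N ` ?G \<subseteq> ?A" using good_triple_perm(2)[OF N e] by auto
  then have Ane: "?A \<noteq> {}" using ne by auto
  have a: "real (card ?A) > 0" using A(1) Ane by (simp add: card_gt_0_iff)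
  have qS: "?q * real (card ?S) \<le> 1" by (rule card_good_shifts_le[OF N k e(2) finS])
  have q0: "0 \<le> ?q" by (rule cell_prob_nonneg[OF k])
  define c where "c = real N / (real N + 1)"
  have c: "0 < c" "c < 1" using N by (auto simp: c_def)
  \<comment> \<open>Normalised for both marginals. With \<open>fact k\<close> encodings an avoider
    gets mass \<open>c\<close> times the share of good cells, at most 1; at a fixed \<open>x\<close>
    the density totals at most \<open>c\<close> times \<open>card good_triples / fact k\<close>,
    which is at most the number of avoiders.\<close>
  define \<rho> where "\<rho> = c * real (card ?S) / fact k"
  have \<rho>: "0 \<le> \<rho>" using c by (simp add: \<rho>_def)
  define F where "F \<sigma> = {t \<in> ?G. perm_of N t = \<sigma>}" for \<sigma>
  have fF: "finite (F \<sigma>)" for \<sigma> using fG(1) by (simp add: F_def)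
  define u where "u \<sigma> x = \<rho> * (\<Sum>t\<in>F \<sigma>. indicator (cell N k (snd (snd t))) x :: real)" for \<sigma> x
  have shift: "snd (snd t) \<in> ?S" if "t \<in> ?G" for t using that by (auto simp: good_triples_def)
  have cs: "cell N k (snd (snd t)) \<in> sets (uniform_Q0 k)" if "t \<in> ?G" for t
    using cell_sets_uniform[OF k good_shiftsD[OF shift[OF that]]] .
  have u_meas: "u \<sigma> \<in> borel_measurable (uniform_Q0 k)" for \<sigma>
    unfolding u_def using cs by (intro borel_measurable_times borel_measurable_const borel_measurable_sum borel_measurable_indicator) (auto simp: F_def)
  have u_nonneg: "0 \<le> u \<sigma> x" for \<sigma> x
    unfolding u_def using \<rho> by (intro mult_nonneg_nonneg sum_nonneg) auto
  have u_int: "(\<integral>x. u \<sigma> x \<partial>uniform_Q0 k) = \<rho> * (real (card (F \<sigma>)) * ?q)" for \<sigma>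
  proof -
    have "(\<integral>x. (\<Sum>t\<in>F \<sigma>. indicator (cell N k (snd (snd t))) x :: real) \<partial>uniform_Q0 k)
      = (\<Sum>t\<in>F \<sigma>. \<integral>x. indicator (cell N k (snd (snd t))) x \<partial>uniform_Q0 k)"
    proof (rule Bochner_Integration.integral_sum)
      fix t assume "t \<in> F \<sigma>"
      then have "t \<in> ?G" by (simp add: F_def)
      then show "integrable (uniform_Q0 k) (indicator (cell N k (snd (snd t))) :: _ \<Rightarrow> real)"
        by (intro integrable_real_indicator cs)
          (simp_all add: less_top[symmetric] Q.emeasure_finite[unfolded infinity_ennreal_def])
    qed
    also have "\<dots> = (\<Sum>t\<in>F \<sigma>. ?q)"
    proof (intro sum.cong refl)
      fix t assume "t \<in> F \<sigma>"
      then have t: "t \<in> ?G" by (simp add: F_def)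
      have "(\<integral>x. indicator (cell N k (snd (snd t))) x \<partial>uniform_Q0 k) = measure (uniform_Q0 k) (cell N k (snd (snd t)))"
        by (simp add: sets.Int_space_eq2[OF cs[OF t]] del: space_uniform_Q0)
      then show "(\<integral>x. indicator (cell N k (snd (snd t))) x \<partial>uniform_Q0 k) = ?q"
        using measure_cell_good[OF N k e(2) shift[OF t]] by simp
    qed
    finally show ?thesis unfolding u_def by simp
  qed
  have card_F: "card (F \<sigma>) \<le> fact k" for \<sigma>
  proof (cases "\<sigma> \<in> perm_of N ` ?G")
    case False
    then have "F \<sigma> = {}" by (auto simp: F_def)
    then show ?thesis by simp
  qed (use card_fibre[OF N e, of \<sigma>] in \<open>simp add: F_def\<close>)
  have u_le: "(\<integral>x. u \<sigma> x \<partial>uniform_Q0 k) \<le> 1" for \<sigma>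
  proof -
    have "real (card (F \<sigma>)) \<le> real (fact k)" using card_F[of \<sigma>] by (simp only: of_nat_le_iff)
    then have "real (card (F \<sigma>)) \<le> fact k" by simp
    then have "\<rho> * (real (card (F \<sigma>)) * ?q) \<le> \<rho> * (fact k * ?q)"
      by (intro mult_left_mono mult_right_mono \<rho> q0)
    also have "\<dots> = c * (?q * real (card ?S))" by (simp add: \<rho>_def)
    also have "\<dots> \<le> 1 * 1" by (rule mult_mono) (use c q0 qS in simp_all)
    finally show ?thesis unfolding u_int by simp
  qed
  have u_sum: "(\<Sum>\<sigma>\<in>?A. u \<sigma> x) \<le> real (card ?A)" for x
  proof -
    have "(\<Sum>\<sigma>\<in>?A. \<Sum>t\<in>F \<sigma>. indicator (cell N k (snd (snd t))) x :: real)
      = (\<Sum>t\<in>?G. indicator (cell N k (snd (snd t))) x)"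
      unfolding F_def using sum.group[OF fG(1) A(1) sub] .
    also have "\<dots> \<le> real (card (good_pairs N k e))"
    proof -
      have "(\<Sum>t\<in>?G. indicator (cell N k (snd (snd t))) x :: real)
        = (\<Sum>t\<in>{t \<in> ?G. x \<in> cell N k (snd (snd t))}. 1)"
        using fG(1) by (intro sum.mono_neutral_cong_right) (auto simp: indicator_def)
      also have "\<dots> = real (card {t \<in> ?G. x \<in> cell N k (snd (snd t))})" by simp
      \<comment> \<open>The point \<open>x\<close> determines the shifts, so encodings whose cell
        contains it differ only in their words.\<close>
      also have "card {t \<in> ?G. x \<in> cell N k (snd (snd t))}
        \<le> card ((\<lambda>z. (fst z, snd z, shift_of N k x)) ` good_pairs N k e)"
        by (intro card_mono) (force simp: good_triples_def cell_def)+
      also have "\<dots> \<le> card (good_pairs N k e)" by (rule card_image_le) simp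
      finally show ?thesis by simp
    qed
    finally have "(\<Sum>\<sigma>\<in>?A. u \<sigma> x) \<le> \<rho> * real (card (good_pairs N k e))"
      unfolding u_def sum_distrib_left[symmetric] using \<rho> by (rule mult_left_mono)
    also have "\<dots> = c * (real (card ?G) / fact k)" unfolding \<rho>_def fG(2) by simp
    also have "\<dots> \<le> 1 * real (card ?A)"
    proof (rule mult_mono)
      have "real (card ?G) \<le> fact k * real (card ?A)"
        using A(2) by (metis of_nat_fact of_nat_le_iff of_nat_mult)
      then show "real (card ?G) / fact k \<le> real (card ?A)" by (simp add: divide_le_eq mult.commute)
    qed (use c in auto)
    finally show ?thesis by simp
  qed
  have m_eq: "matched_mass N k e = (\<Sum>\<sigma>\<in>?A. \<integral>x. u \<sigma> x \<partial>uniform_Q0 k) / real (card ?A)"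
  proof -
    have "(\<Sum>\<sigma>\<in>?A. card (F \<sigma>)) = card ?G"
      unfolding F_def using sum.group[OF fG(1) A(1) sub, of "\<lambda>_. 1 :: nat"] by simp
    then have "(\<Sum>\<sigma>\<in>?A. real (card (F \<sigma>))) = real (card ?G)" by (metis of_nat_sum)
    then have "(\<Sum>\<sigma>\<in>?A. \<integral>x. u \<sigma> x \<partial>uniform_Q0 k) = \<rho> * (real (card ?G) * ?q)"
      unfolding u_int by (simp flip: sum_distrib_left sum_distrib_right)
    then show ?thesis using a by (simp add: matched_mass_def \<rho>_def c_def mult_ac)
  qed
  have m1: "matched_mass N k e < 1"
  proof -
    have "real (card ?G) \<le> fact k * real (card ?A)"
      using A(2) by (metis of_nat_fact of_nat_le_iff of_nat_mult)
    then have r1: "real (card ?G) / (fact k * real (card ?A)) \<le> 1" using a by (simp add: divide_le_eq)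
    have r2: "c * (?q * real (card ?S)) \<le> c * 1" using qS c by (intro mult_left_mono) auto
    have "c * (?q * real (card ?S)) * (real (card ?G) / (fact k * real (card ?A))) \<le> c * 1 * 1"
      by (rule mult_mono[OF r2 r1]) (use c in simp_all)
    then have "matched_mass N k e \<le> c * 1 * 1" unfolding matched_mass_def c_def .
    then show ?thesis using c by simp
  qed
  obtain J where J: "prob_space J" "sets J = sets (count_space ?A \<Otimes>\<^sub>M uniform_Q0 k)"
    "distr J (count_space ?A) fst = uniform_count_measure ?A" "distr J (uniform_Q0 k) snd = uniform_Q0 k"
    "emeasure J {q \<in> space J. u (fst q) (snd q) = 0} \<le> ennreal (1 - matched_mass N k e)"
    by (rule partial_coupling[OF A(1) Ane Q.prob_space_axioms u_meas u_nonneg u_le u_sum m_eq m1])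
  have Zs: "{q \<in> space J. u (fst q) (snd q) = 0} \<in> sets J"
  proof -
    have "(\<lambda>q. u (fst q) (snd q)) \<in> borel_measurable (count_space ?A \<Otimes>\<^sub>M uniform_Q0 k)"
      using A(1) u_meas by (intro measurable_pair_measure_countable1) (auto simp: countable_finite)
    then have "(\<lambda>q. u (fst q) (snd q)) \<in> borel_measurable J"
      using measurable_cong_sets[OF J(2) refl] by blast
    then show ?thesis by measurable
  qed
  have mt: "matched N k e (fst q) (snd q)" if "u (fst q) (snd q) \<noteq> 0" for q
  proof -
    have "(\<Sum>t\<in>F (fst q). indicator (cell N k (snd (snd t))) (snd q) :: real) \<noteq> 0"
      using that by (auto simp: u_def)
    then obtain t where t: "t \<in> F (fst q)" "indicator (cell N k (snd (snd t))) (snd q) \<noteq> (0 :: real)"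
      by (metis (no_types, lifting) sum.neutral)
    then show ?thesis unfolding matched_def F_def
      by (intro exI[of _ "fst t"] exI[of _ "fst (snd t)"] exI[of _ "snd (snd t)"]) (auto simp: indicator_def split: if_splits)
  qed
  show thesis
    by (rule that[OF J(1-4) Zs J(5)]) (use mt in blast)
qed

section \<open>Convergence\<close>

lemma card_good_words_ge:
  assumes "real (card (words N k - good_words N k e)) \<le> real k ^ N / 2"
  shows "real k ^ N / 2 \<le> real (card (good_words N k e))"
proof -
  have "good_words N k e \<subseteq> words N k" by (auto simp: good_words_def)
  then have "card (words N k - good_words N k e) = k ^ N - card (good_words N k e)"
    "card (good_words N k e) \<le> k ^ N"
    using card_mono[of "words N k" "good_words N k e"] by (auto simp: card_Diff_subset card_words)
  then show ?thesis using assms by (simp add: of_nat_diff)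
qed

text \<open>At least half of all words are good, so there are at least
  \<open>(k ^ N / 2) ^ 2 / (N + 1) ^ k\<close> good pairs. The constant 16 is 4 from this square, 2
  for the two tails and 2 for the two words of a pair.\<close>

lemma bad_pairs_ratio_le:
  assumes k: "k \<ge> 2" and e: "0 < e" "e \<le> 1"
    and small: "2 * real k * real N * exp (- (e\<^sup>2 * real N / 2)) \<le> 1 / 2"
  shows "real (card (good_pairs N k e)) > 0"
    "real (card (bad_pairs N k e)) / real (card (good_pairs N k e))
      \<le> 16 * real k * real N * real (N + 1) ^ k * exp (- (e\<^sup>2 * real N / 2))"
proof -
  let ?E = "exp (- (e\<^sup>2 * real N / 2))" and ?K = "real k ^ N"
  have K: "?K > 0" using k by simp
  have bad: "real (card (words N k - good_words N k e)) \<le> ?K * (2 * real k * real N * ?E)"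
    using card_bad_words_le[OF k e, of N] by (simp add: mult_ac)
  also have "\<dots> \<le> ?K * (1 / 2)" by (intro mult_left_mono small) simp
  finally have "?K / 2 \<le> real (card (good_words N k e))" by (intro card_good_words_ge) simp
  then have "(?K / 2) ^ 2 \<le> real (card (good_words N k e)) ^ 2" by (intro power_mono) simp_all
  also have "\<dots> \<le> real (card (good_pairs N k e)) * real (N + 1) ^ k" by (rule card_good_pairs_ge)
  finally have low: "(?K / 2) ^ 2 \<le> real (card (good_pairs N k e)) * real (N + 1) ^ k" .
  have "0 < (?K / 2) ^ 2" using K by simp
  then have "0 < real (card (good_pairs N k e)) * real (N + 1) ^ k" using low by linarith
  then show pos: "real (card (good_pairs N k e)) > 0" by (simp add: zero_less_mult_iff)
  have "real (card (bad_pairs N k e)) \<le> 2 * ?K * (?K * (2 * real k * real N * ?E))"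
    using card_bad_pairs_le[of N k e] bad by (rule order_trans[OF _ mult_left_mono]) simp
  also have "\<dots> = 16 * real k * real N * ?E * (?K / 2) ^ 2" by (simp add: power2_eq_square field_simps)
  also have "\<dots> \<le> 16 * real k * real N * ?E * (real (card (good_pairs N k e)) * real (N + 1) ^ k)"
    by (intro mult_left_mono low) simp
  finally show "real (card (bad_pairs N k e)) / real (card (good_pairs N k e))
      \<le> 16 * real k * real N * real (N + 1) ^ k * ?E"
    using pos by (simp add: divide_le_eq mult_ac)
qed

text \<open>
  Any tolerance that tends to \<open>0\<close> more slowly than \<open>sqrt (ln N / N)\<close> would do.
\<close>

definition tolerance :: "nat \<Rightarrow> real" where
  "tolerance N = real N powr (- (1 / 4))"

lemma tolerance_power: "N > 0 \<Longrightarrow> (tolerance N)\<^sup>2 * real N = sqrt (real N)"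
proof -
  assume N: "N > 0"
  have "(tolerance N)\<^sup>2 = real N powr (- (1 / 2))"
    unfolding tolerance_def power2_eq_square by (simp flip: powr_add)
  then have "(tolerance N)\<^sup>2 * real N = real N powr (- (1 / 2)) * real N powr 1" using N by simp
  also have "\<dots> = real N powr (- (1 / 2) + 1)" by (rule powr_add[symmetric])
  also have "\<dots> = real N powr (1 / 2)" by simp
  finally show ?thesis using N by (simp add: powr_half_sqrt)
qed

lemma tolerance_pos: "N > 0 \<Longrightarrow> 0 < tolerance N"
  by (simp add: tolerance_def)

lemma tolerance_nonneg: "0 \<le> tolerance N"
  by (simp add: tolerance_def)

lemma tolerance_tendsto: "tolerance \<longlonglongrightarrow> 0"
  unfolding tolerance_def by real_asymp

lemma poly_exp_sqrt_tendsto: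
  "(\<lambda>N. C * real N ^ m * exp (- (sqrt (real N) / 2))) \<longlonglongrightarrow> 0"
proof -
  have "(\<lambda>N. real N powr real m * exp (- (sqrt (real N) / 2))) \<longlonglongrightarrow> 0"
    by real_asymp
  then have "(\<lambda>N. C * (real N powr real m * exp (- (sqrt (real N) / 2)))) \<longlonglongrightarrow> 0"
    by (rule tendsto_mult_right_zero)
  moreover have "\<forall>\<^sub>F N in sequentially. C * (real N powr real m * exp (- (sqrt (real N) / 2)))
      = C * real N ^ m * exp (- (sqrt (real N) / 2))"
    using eventually_gt_at_top[of 0] by eventually_elim (simp add: powr_realpow)
  ultimately show ?thesis by (rule Lim_transform_eventually)
qed

definition boundary_bound :: "nat \<Rightarrow> nat \<Rightarrow> real" where
  "boundary_bound N k = cell_prob N k * (real k ^ 2 * (2 * real N + 1) ^ (k - 2)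
     * (12 * (slack k * tolerance N * real N + real k ^ 2) + 3))"

text \<open>\<open>cell_prob\<close> is of order \<open>N ^ (1 - k)\<close> and the number of
  boundary shifts of order \<open>N ^ (k - 2) * (tolerance N * N + 1)\<close>, so their product is
  of order \<open>tolerance N + 1 / N\<close>.\<close>

lemma boundary_bound_tendsto:
  assumes k: "k \<ge> 2" shows "(\<lambda>N. boundary_bound N k) \<longlonglongrightarrow> 0"
proof -
  define C where "C = real k ^ (k - 1) / slice_volume k * real k ^ 2 * 3 ^ (k - 2)"
  have V: "slice_volume k > 0" using emeasure_slice_preimage_Q0(2)[of k] k by simp
  have lim: "(\<lambda>N. C * (12 * (slack k * tolerance N + real k ^ 2 / real N) + 3 / real N)) \<longlonglongrightarrow> C * (12 * (slack k * 0 + 0) + 0)"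
    by (intro tendsto_intros tolerance_tendsto lim_const_over_n)
  have lim0: "(\<lambda>N. C * (12 * (slack k * tolerance N + real k ^ 2 / real N) + 3 / real N)) \<longlonglongrightarrow> 0"
    using lim by simp
  show ?thesis
  proof (rule tendsto_sandwich[OF _ _ tendsto_const lim0])
    have nn: "0 \<le> slack k * tolerance N * real N" for N
      using slack_nonneg by (simp add: tolerance_def)
    show "\<forall>\<^sub>F N in sequentially. 0 \<le> boundary_bound N k"
      using nn k unfolding boundary_bound_def
      by (intro always_eventually allI mult_nonneg_nonneg cell_prob_nonneg) auto
    show "\<forall>\<^sub>F N in sequentially. boundary_bound N k \<le> C * (12 * (slack k * tolerance N + real k ^ 2 / real N) + 3 / real N)"
      using eventually_gt_at_top[of 0]
    proof eventually_elim
      case (elim N)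
      let ?D = "12 * (slack k * tolerance N * real N + real k ^ 2) + 3"
      have D: "0 \<le> ?D" using nn[of N] by simp
      have N1: "real N \<ge> 1" using elim by simp
      have "(2 * real N + 1) ^ (k - 2) \<le> (3 * real N) ^ (k - 2)" using N1 by (intro power_mono) auto
      then have "boundary_bound N k \<le> cell_prob N k * (real k ^ 2 * (3 * real N) ^ (k - 2) * ?D)"
        unfolding boundary_bound_def using D k cell_prob_nonneg[of k N]
        by (intro mult_left_mono mult_right_mono) auto
      also have "\<dots> = C * (?D / real N)"
      proof -
        have "k - 1 = Suc (k - 2)" using k by simp
        then have "real N ^ (k - 1) = real N * real N ^ (k - 2)" by simp
        then show ?thesis using elim V
          unfolding cell_prob_def C_def by (simp add: power_divide power_mult_distrib mult_ac)
      qed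
      also have "?D / real N = 12 * (slack k * tolerance N + real k ^ 2 / real N) + 3 / real N"
        using elim by (simp add: add_divide_distrib)
      finally show ?case .
    qed
  qed
qed

text \<open>The ratio of bad to good pairs, with its loss \<open>(N + 1) ^ k\<close> for equal
  letter counts, times the size \<open>(2 * N + 1) ^ k\<close> of the box of shifts.\<close>

definition bad_ratio_bound :: "nat \<Rightarrow> nat \<Rightarrow> real" where
  "bad_ratio_bound N k = 16 * real k * real N * real (N + 1) ^ k * exp (- (sqrt (real N) / 2)) * (2 * real N + 1) ^ k"

lemma bad_ratio_bound_tendsto: "(\<lambda>N. bad_ratio_bound N k) \<longlonglongrightarrow> 0"
proof (rule tendsto_sandwich[OF _ _ tendsto_const
      poly_exp_sqrt_tendsto[of "16 * real k * 2 ^ k * 3 ^ k" "1 + k + k"]])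
  show "\<forall>\<^sub>F N in sequentially. 0 \<le> bad_ratio_bound N k"
    by (simp add: bad_ratio_bound_def)
  show "\<forall>\<^sub>F N in sequentially. bad_ratio_bound N k
      \<le> 16 * real k * 2 ^ k * 3 ^ k * real N ^ (1 + k + k) * exp (- (sqrt (real N) / 2))"
    using eventually_gt_at_top[of 0]
  proof eventually_elim
    case (elim N)
    have a: "real (N + 1) ^ k \<le> (2 * real N) ^ k" "(2 * real N + 1) ^ k \<le> (3 * real N) ^ k"
      using elim by (intro power_mono; simp)+
    have "real (N + 1) ^ k * (2 * real N + 1) ^ k \<le> (2 * real N) ^ k * (3 * real N) ^ k"
      by (rule mult_mono[OF a]) auto
    then have "16 * real k * real N * exp (- (sqrt (real N) / 2)) * (real (N + 1) ^ k * (2 * real N + 1) ^ k)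
      \<le> 16 * real k * real N * exp (- (sqrt (real N) / 2)) * ((2 * real N) ^ k * (3 * real N) ^ k)"
      by (rule mult_left_mono) simp
    then show ?case by (simp add: bad_ratio_bound_def power_add power_mult_distrib mult_ac)
  qed
qed


text \<open>Here \<open>a \<le> (1 + r) * g\<close> and \<open>(1 - r) * (1 + r) \<le> 1\<close>;
  for \<open>r > 1\<close> the left side is negative.\<close>

lemma one_minus_le_ratio:
  fixes g a b r :: real
  assumes "0 < g" "0 < a" "0 \<le> b" "a \<le> g + b" "b / g \<le> r" shows "1 - r \<le> g / a"
proof -
  have br: "b \<le> r * g" using assms by (simp add: divide_le_eq)
  have "0 \<le> b / g" using assms by simp
  then have r: "r \<ge> 0" using assms(5) by linarith
  have "(1 - r) * a \<le> g"
  proof (cases "r \<le> 1")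
    case True
    have "(1 - r) * a \<le> (1 - r) * (g + r * g)" using True assms(4) br by (intro mult_left_mono) auto
    also have "\<dots> = g - r * r * g" by (simp add: algebra_simps)
    also have "\<dots> \<le> g" using assms(1) r by simp
    finally show ?thesis .
  next
    case False
    then have "(1 - r) * a \<le> 0" using assms(2) by (simp add: mult_le_0_iff)
    then show ?thesis using assms(1) by linarith
  qed
  then show ?thesis using assms(2) by (simp add: le_divide_eq)
qed

text \<open>Dominates \<open>fact k\<close> times bad over good triples. The summands belong to the
  two parts of \<open>bad_triples\<close>; the denominator \<open>1 - boundary_bound N k\<close>
  bounds the share of good cells from below.\<close>

definition bad_ratio :: "nat \<Rightarrow> nat \<Rightarrow> real" where
  "bad_ratio N k = fact k * (bad_ratio_bound N k + boundary_bound N k / (1 - boundary_bound N k))"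

definition unmatched_bound :: "nat \<Rightarrow> nat \<Rightarrow> real" where
  "unmatched_bound N k = 1 - real N / (real N + 1) * (1 - boundary_bound N k) * (1 - bad_ratio N k)"

lemma bad_ratio_tendsto:
  assumes "k \<ge> 2" shows "(\<lambda>N. bad_ratio N k) \<longlonglongrightarrow> 0"
proof -
  have "(\<lambda>N. bad_ratio N k) \<longlonglongrightarrow> fact k * (0 + 0 / (1 - 0))"
    unfolding bad_ratio_def
    by (intro tendsto_intros bad_ratio_bound_tendsto boundary_bound_tendsto assms) simp
  then show ?thesis by simp
qed

lemma unmatched_bound_tendsto:
  assumes "k \<ge> 2" shows "(\<lambda>N. unmatched_bound N k) \<longlonglongrightarrow> 0"
proof -
  have "(\<lambda>N. real N / (real N + 1)) \<longlonglongrightarrow> 1" by real_asymp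
  then have "(\<lambda>N. unmatched_bound N k) \<longlonglongrightarrow> 1 - 1 * (1 - 0) * (1 - 0)"
    unfolding unmatched_bound_def
    by (intro tendsto_intros bad_ratio_tendsto boundary_bound_tendsto assms)
  then show ?thesis by simp
qed

lemma matching_error_tendsto: "(\<lambda>N. matching_error N k (tolerance N)) \<longlonglongrightarrow> 0"
proof -
  have "(\<lambda>N. matching_error N k (tolerance N)) \<longlonglongrightarrow>
      2 * (real k * 0 + 0) + slack k * 0 + 0 + 4 * (real k * 0 + 0)"
    unfolding matching_error_def by (intro tendsto_intros tolerance_tendsto lim_const_over_n)
  then show ?thesis by simp
qed

lemma eventually_setup:
  assumes k: "k \<ge> 2"
  shows "\<forall>\<^sub>F N in sequentially. N > 0 \<and> tolerance N \<le> 1 / (2 * real k) \<and>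
    slack k * tolerance N * real N + real k ^ 2 \<le> real N \<and>
    boundary_bound N k \<le> 1 / 2 \<and> 0 \<le> 1 - bad_ratio N k \<and>
    2 * real k * real N * exp (- (sqrt (real N) / 2)) \<le> 1 / 2"
proof -
  have 1: "\<forall>\<^sub>F N in sequentially. tolerance N < 1 / (2 * real k)"
    using k by (intro order_tendstoD[OF tolerance_tendsto]) simp
  have "(\<lambda>N. slack k * tolerance N + real k ^ 2 / real N) \<longlonglongrightarrow> slack k * 0 + 0"
    by (intro tendsto_intros tolerance_tendsto lim_const_over_n)
  then have 2: "\<forall>\<^sub>F N in sequentially. slack k * tolerance N + real k ^ 2 / real N < 1"
    by (intro order_tendstoD(2)) auto
  have 3: "\<forall>\<^sub>F N in sequentially. boundary_bound N k < 1 / 2"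
    by (intro order_tendstoD[OF boundary_bound_tendsto[OF k]]) simp
  have 4: "\<forall>\<^sub>F N in sequentially. bad_ratio N k < 1"
    by (intro order_tendstoD[OF bad_ratio_tendsto[OF k]]) simp
  have 5: "\<forall>\<^sub>F N in sequentially. 2 * real k * real N ^ 1 * exp (- (sqrt (real N) / 2)) < 1 / 2"
    by (intro order_tendstoD[OF poly_exp_sqrt_tendsto]) simp
  show ?thesis
    using 1 2 3 4 5 eventually_gt_at_top[of 0]
  proof eventually_elim
    case (elim N)
    have "(slack k * tolerance N + real k ^ 2 / real N) * real N \<le> 1 * real N"
      using elim(2) by (intro mult_right_mono) auto
    moreover have "(slack k * tolerance N + real k ^ 2 / real N) * real N = slack k * tolerance N * real N + real k ^ 2"
      using elim(6) by (simp add: distrib_right)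
    ultimately show ?case using elim by simp
  qed
qed

lemma eventually_coupling:
  assumes k: "k \<ge> 2"
  shows "\<forall>\<^sub>F N in sequentially. N > 0 \<and> tolerance N \<le> 1 / (2 * real k) \<and> finite (bounded_avoiders N (k + 1)) \<and>
    (\<exists>J Z. prob_space J \<and>
      sets J = sets (count_space (bounded_avoiders N (k + 1)) \<Otimes>\<^sub>M uniform_Q0 k) \<and>
      distr J (count_space (bounded_avoiders N (k + 1))) fst = uniform_count_measure (bounded_avoiders N (k + 1)) \<and>
      distr J (uniform_Q0 k) snd = uniform_Q0 k \<and>
      Z \<in> sets J \<and> emeasure J Z \<le> ennreal (unmatched_bound N k) \<and>
      (\<forall>q. q \<in> space J \<longrightarrow> q \<notin> Z \<longrightarrow> matched N k (tolerance N) (fst q) (snd q)))"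
  using eventually_setup[OF k]
proof eventually_elim
  case (elim N)
  define e where "e = tolerance N"
  have N: "N > 0" and k1: "k \<ge> 1" and e: "e \<le> 1 / (2 * real k)" "0 \<le> e" "0 < e" "e \<le> 1"
    using elim k tolerance_pos[of N] order_trans[of "tolerance N" "1 / (2 * real k)" 1]
    by (auto simp: e_def divide_le_eq)
  let ?D = "slack k * e * real N + real k ^ 2"
  let ?Sg = "good_shifts N k e" and ?Sa = "all_shifts N k e" and ?q = "cell_prob N k"
  let ?bb = "boundary_bound N k"
  have D: "?D \<le> real N" using elim by (simp add: e_def)
  note Sb = card_boundary_shifts_le[OF k refl e(2) D]
  have q0: "0 \<le> ?q" by (rule cell_prob_nonneg[OF k1])
  have qSb: "?q * real (card (?Sa - ?Sg)) \<le> ?bb"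
    unfolding boundary_bound_def e_def[symmetric] by (rule mult_left_mono[OF Sb(2) q0])
  have finS: "finite ?Sg" by (rule finite_good_shifts[OF e(2)])
  have "card ?Sa = card ?Sg + card (?Sa - ?Sg)"
    using Sb(1) good_shifts_subset[OF e(2), of N k] finS by (simp add: card_Diff_subset card_mono)
  then have "1 \<le> ?q * real (card ?Sg) + ?q * real (card (?Sa - ?Sg))"
    using card_all_shifts_ge[OF N k1 e(2) Sb(1)] by (simp add: distrib_left)
  \<comment> \<open>All cells cover the slice, so the good ones account for all but the share of the
    boundary shifts.\<close>
  then have qSg: "1 - ?bb \<le> ?q * real (card ?Sg)" using qSb by linarith
  have bb: "?bb \<le> 1 / 2" using elim by simp
  then have "0 < ?q * real (card ?Sg)" using qSg by linarith
  then have Sg: "card ?Sg > 0" and qpos: "?q > 0" using q0 by (auto simp: zero_less_mult_iff)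
  have e2: "e\<^sup>2 * real N = sqrt (real N)" unfolding e_def by (rule tolerance_power[OF N])
  have small: "2 * real k * real N * exp (- (e\<^sup>2 * real N / 2)) \<le> 1 / 2" unfolding e2 using elim by simp
  note W = bad_pairs_ratio_le[OF k e(3,4) small]
  let ?g = "real (card (good_triples N k e))" and ?a = "real (card (bounded_avoiders N (k + 1)))"
    and ?b = "real (card (bad_triples N k e))" and ?W = "real (card (good_pairs N k e))"
  have g: "?g = ?W * real (card ?Sg)" using card_good_triples(2)[OF finS] by simp
  have gpos: "?g > 0" unfolding g using W(1) Sg by simp
  note A = card_avoiders[OF N e(1,2) Sb(1)]
  have ga: "?g \<le> fact k * ?a"
  proof -
    have "?g \<le> real (fact k * card (bounded_avoiders N (k + 1)))" using A(2) by (simp only: of_nat_le_iff)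
    then show ?thesis by simp
  qed
  have ab: "fact k * ?a \<le> ?g + fact k * ?b"
  proof -
    have "real (fact k * card (bounded_avoiders N (k + 1))) \<le> real (card (good_triples N k e) + fact k * card (bad_triples N k e))"
      using A(3) by (simp only: of_nat_le_iff)
    then show ?thesis by simp
  qed
  have "?b / ?g \<le> bad_ratio_bound N k + ?bb / (1 - ?bb)"
  proof -
    let ?P = "real (card (bad_pairs N k e))" and ?Sb = "real (card (?Sa - ?Sg))"
    have "?b \<le> real (card (bad_pairs N k e) * (2 * N + 1) ^ k + card (good_pairs N k e) * card (?Sa - ?Sg))"
      using card_bad_triples_le(2)[OF Sb(1)] by (simp only: of_nat_le_iff)
    then have "?b \<le> ?P * (2 * real N + 1) ^ k + ?W * ?Sb" by (simp add: add.commute)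
    then have "?b / ?g \<le> (?P * (2 * real N + 1) ^ k + ?W * ?Sb) / ?g"
      using gpos by (intro divide_right_mono) auto
    also have "\<dots> = (?P / ?W) * (2 * real N + 1) ^ k / real (card ?Sg) + ?Sb / real (card ?Sg)"
    proof -
      have "(P * X + w * S) / (w * n) = P / w * X / n + S / n" if "w > 0" "n > 0" for P X w S n :: real
        using that by (simp add: field_simps)
      then show ?thesis unfolding g using W(1) Sg by simp
    qed
    also have "(?P / ?W) * (2 * real N + 1) ^ k / real (card ?Sg) \<le> bad_ratio_bound N k"
    proof -
      \<comment> \<open>The trivial lower bound on the number of good shifts is enough against the
        exponential decay.\<close>
      have "1 \<le> real (card ?Sg)" using Sg by simp
      then have "(?P / ?W) * (2 * real N + 1) ^ k / real (card ?Sg) \<le> (?P / ?W) * (2 * real N + 1) ^ k / 1"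
        by (intro divide_left_mono) auto
      also have "\<dots> \<le> (16 * real k * real N * real (N + 1) ^ k * exp (- (e\<^sup>2 * real N / 2))) * (2 * real N + 1) ^ k"
        unfolding div_by_1 by (intro mult_right_mono W(2)) simp
      finally show ?thesis unfolding bad_ratio_bound_def e2 .
    qed
    also have "?Sb / real (card ?Sg) \<le> ?bb / (1 - ?bb)"
    proof -
      have "?Sb / real (card ?Sg) = (?q * ?Sb) / (?q * real (card ?Sg))" using qpos by simp
      also have "\<dots> \<le> ?bb / (1 - ?bb)"
        using order_trans[OF _ qSb, of 0] qSb qSg bb q0 by (intro frac_le) auto
      finally show ?thesis .
    qed
    finally show ?thesis by simp
  qed
  then have "fact k * (?b / ?g) \<le> bad_ratio N k"
    unfolding bad_ratio_def by (intro mult_left_mono) simp_all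
  then have "fact k * ?b / ?g \<le> bad_ratio N k" by simp
  moreover have "0 < fact k * ?a" using ga gpos by linarith
  ultimately have ratio: "1 - bad_ratio N k \<le> ?g / (fact k * ?a)"
    using ab gpos by (intro one_minus_le_ratio[where b = "fact k * ?b"]) auto
  have mass: "1 - matched_mass N k e \<le> unmatched_bound N k"
  proof -
    have "real N / (real N + 1) * (1 - ?bb) * (1 - bad_ratio N k)
      \<le> real N / (real N + 1) * (?q * real (card ?Sg)) * (?g / (fact k * ?a))"
    proof (rule mult_mono)
      show "real N / (real N + 1) * (1 - ?bb) \<le> real N / (real N + 1) * (?q * real (card ?Sg))"
        using qSg by (rule mult_left_mono) simp
      show "0 \<le> real N / (real N + 1) * (?q * real (card ?Sg))" using q0 by simp
    qed (use ratio elim in auto)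
    then show ?thesis unfolding matched_mass_def unmatched_bound_def by simp
  qed
  have ne: "good_triples N k e \<noteq> {}" using gpos by auto
  obtain J Z where J: "prob_space J"
    "sets J = sets (count_space (bounded_avoiders N (k + 1)) \<Otimes>\<^sub>M uniform_Q0 k)"
    "distr J (count_space (bounded_avoiders N (k + 1))) fst = uniform_count_measure (bounded_avoiders N (k + 1))"
    "distr J (uniform_Q0 k) snd = uniform_Q0 k"
    "Z \<in> sets J" "emeasure J Z \<le> ennreal (1 - matched_mass N k e)"
    and M: "\<And>q. q \<in> space J \<Longrightarrow> q \<notin> Z \<Longrightarrow> matched N k e (fst q) (snd q)"
    using matched_coupling[OF N k1 e(1,2) Sb(1) ne] by metis
  have "emeasure J Z \<le> ennreal (unmatched_bound N k)"
    using J(6) ennreal_leI[OF mass] by (rule order_trans)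
  then show ?case
    using N e(1) A(1) J(1-5) M unfolding e_def by blast
qed

text \<open>The quantifier over all matched \<open>\<sigma>\<close> makes this an event on the slice
  alone. It can then be followed as \<open>N\<close> grows on the fixed space
  \<open>uniform_Q0 k\<close>, independently of which coupling was obtained for each
  \<open>N\<close>.\<close>

definition far :: "nat \<Rightarrow> nat \<Rightarrow> ((real \<times> real) measure \<Rightarrow> real) \<Rightarrow> real \<Rightarrow> (nat \<Rightarrow> real) set" where
  "far N k F d = {x \<in> Q0 k. \<exists>\<sigma>. matched N k (tolerance N) \<sigma> x \<and>
     d \<le> \<bar>F (mu_hat N \<sigma>) - F (segments_measure k x)\<bar>}"

text \<open>There are finitely many good triples, so the existential over \<open>\<sigma>\<close> is
  a finite union of measurable parts of cells.\<close>

lemma far_sets: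
  assumes k: "k \<ge> 1" and F: "F \<in> borel_measurable PM1_borel"
  shows "far N k F d \<in> sets (uniform_Q0 k)"
proof -
  have [measurable]: "(\<lambda>x. F (segments_measure k x)) \<in> borel_measurable (uniform_Q0 k)"
    using k by (intro measurable_compose[OF segments_measure_measurable F]) simp
  have "far N k F d = (\<Union>t\<in>good_triples N k (tolerance N). cell N k (snd (snd t)) \<inter>
      {x \<in> space (uniform_Q0 k). d \<le> \<bar>F (mu_hat N (perm_of N t)) - F (segments_measure k x)\<bar>})"
    (is "_ = ?R")
  proof (intro equalityI subsetI)
    fix x assume "x \<in> far N k F d"
    then obtain p v s where "x \<in> Q0 k" "(p, v, s) \<in> good_triples N k (tolerance N)" "x \<in> cell N k s"
      "d \<le> \<bar>F (mu_hat N (perm_of N (p, v, s))) - F (segments_measure k x)\<bar>"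
      by (auto simp: far_def matched_def)
    then show "x \<in> ?R" by (intro UN_I[of "(p, v, s)"]) auto
  next
    fix x assume "x \<in> ?R"
    then obtain t where t: "t \<in> good_triples N k (tolerance N)" "x \<in> cell N k (snd (snd t))" "x \<in> Q0 k"
      "d \<le> \<bar>F (mu_hat N (perm_of N t)) - F (segments_measure k x)\<bar>" by auto
    have "matched N k (tolerance N) (perm_of N t) x"
      unfolding matched_def using t(1,2)
      by (intro exI[of _ "fst t"] exI[of _ "fst (snd t)"] exI[of _ "snd (snd t)"]) simp
    then show "x \<in> far N k F d" using t(3,4) by (auto simp: far_def)
  qed
  also have "\<dots> \<in> sets (uniform_Q0 k)"
  proof (intro sets.finite_UN sets.Int)
    show "finite (good_triples N k (tolerance N))"
      by (rule card_good_triples(1)[OF finite_good_shifts[OF tolerance_nonneg]])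
    fix t assume "t \<in> good_triples N k (tolerance N)"
    then have s: "snd (snd t) \<in> good_shifts N k (tolerance N)" by (auto simp: good_triples_def)
    show "cell N k (snd (snd t)) \<in> sets (uniform_Q0 k)"
      by (rule cell_sets_uniform[OF k good_shiftsD[OF s]])
  next
    fix t
    show "{x \<in> space (uniform_Q0 k). d \<le> \<bar>F (mu_hat N (perm_of N t)) - F (segments_measure k x)\<bar>}
      \<in> sets (uniform_Q0 k)" by measurable
  qed
  finally show ?thesis .
qed

section \<open>Consequences of a coupling for a single size\<close>

locale matched_coupling_space =
  fixes N k :: nat and J :: "((int \<Rightarrow> int) \<times> (nat \<Rightarrow> real)) measure" and Z
  assumes N: "N > 0" and k: "k \<ge> 2" and tol: "tolerance N \<le> 1 / (2 * real k)"
    and finA: "finite (bounded_avoiders N (k + 1))"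
    and prob_J: "prob_space J"
    and sets_J: "sets J = sets (count_space (bounded_avoiders N (k + 1)) \<Otimes>\<^sub>M uniform_Q0 k)"
    and fst_J: "distr J (count_space (bounded_avoiders N (k + 1))) fst = uniform_count_measure (bounded_avoiders N (k + 1))"
    and snd_J: "distr J (uniform_Q0 k) snd = uniform_Q0 k"
    and Z: "Z \<in> sets J" "emeasure J Z \<le> ennreal (unmatched_bound N k)"
    and match: "\<And>q. q \<in> space J \<Longrightarrow> q \<notin> Z \<Longrightarrow> matched N k (tolerance N) (fst q) (snd q)"
begin

abbreviation A where "A \<equiv> bounded_avoiders N (k + 1)"

abbreviation X where "X \<equiv> (\<lambda>q :: (int \<Rightarrow> int) \<times> (nat \<Rightarrow> real). mu_hat N (fst q))"

abbreviation Y where "Y \<equiv> (\<lambda>q :: (int \<Rightarrow> int) \<times> (nat \<Rightarrow> real). segments_measure k (snd q))"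

sublocale J: prob_space J by (rule prob_J)

lemma A_bounded: "\<sigma> \<in> A \<Longrightarrow> \<bar>\<sigma> i - i\<bar> < int N"
  by (simp add: bounded_avoiders_def bounded_affine_permutation_def)

lemma mu_hat_A: "\<sigma> \<in> A \<Longrightarrow> mu_hat N \<sigma> \<in> PM1"
  using A_bounded by (intro mu_hat_PM1 N) blast

lemma fst_m: "fst \<in> measurable J (count_space A)" and snd_m: "snd \<in> measurable J (uniform_Q0 k)"
  unfolding measurable_cong_sets[OF sets_J refl] by auto

lemma mu_hat_m: "mu_hat N \<in> measurable (count_space A) PM1_borel"
  using mu_hat_A by (auto simp: measurable_def)

lemma segments_m: "segments_measure k \<in> measurable (uniform_Q0 k) PM1_borel"
  using k by (intro segments_measure_measurable) simp

lemma X_m: "X \<in> measurable J PM1_borel"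
  by (rule measurable_compose[OF fst_m mu_hat_m])

lemma Y_m: "Y \<in> measurable J PM1_borel"
  by (rule measurable_compose[OF snd_m segments_m])

lemma distr_X: "mu_hat_set N A = distr J PM1_borel X"
proof -
  have "mu_hat_set N A = distr (uniform_count_measure A) PM1_borel (mu_hat N)"
    unfolding mu_hat_set_def using finA mu_hat_A by (intro average_measure_return) auto
  also have "\<dots> = distr J PM1_borel X"
    unfolding fst_J[symmetric] using fst_m mu_hat_m by (simp add: distr_distr comp_def)
  finally show ?thesis .
qed

lemma distr_Y: "lambda_Q0 k = distr J PM1_borel Y"
proof -
  have "lambda_Q0 k = distr (distr J (uniform_Q0 k) snd) PM1_borel (segments_measure k)"
    unfolding lambda_Q0_def snd_J ..
  also have "\<dots> = distr J PM1_borel Y" using snd_m segments_m by (simp add: distr_distr comp_def)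
  finally show ?thesis .
qed

lemma X_PM1: "q \<in> space J \<Longrightarrow> X q \<in> PM1" and Y_PM1: "q \<in> space J \<Longrightarrow> Y q \<in> PM1"
  using measurable_space[OF X_m, of q] measurable_space[OF Y_m, of q] by simp_all

lemma matched_Wass1:
  assumes "matched N k (tolerance N) \<sigma> x"
  shows "\<sigma> \<in> A" "x \<in> Q0 k" "Wass1 (mu_hat N \<sigma>) (segments_measure k x) \<le> matching_error N k (tolerance N)"
    "Wass1 (segments_measure k x) (mu_hat N \<sigma>) \<le> matching_error N k (tolerance N)"
proof -
  obtain p v s where t: "(p, v, s) \<in> good_triples N k (tolerance N)" "\<sigma> = perm_of N (p, v, s)" "x \<in> cell N k s"
    using assms unfolding matched_def by blast
  have k1: "k \<ge> 1" and e0: "0 \<le> tolerance N" using k tolerance_pos[OF N] by simp_all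
  show "\<sigma> \<in> A" using good_triple_perm(2)[OF N tol e0 t(1)] t(2) by simp
  show "x \<in> Q0 k" using t(3) by (simp add: cell_def)
  show "Wass1 (mu_hat N \<sigma>) (segments_measure k x) \<le> matching_error N k (tolerance N)"
    "Wass1 (segments_measure k x) (mu_hat N \<sigma>) \<le> matching_error N k (tolerance N)"
    by (rule Wass1_matched_le[OF N k1 tol e0 t])+
qed

lemma matching_error_nonneg: "0 \<le> matching_error N k (tolerance N)"
  unfolding matching_error_def using tolerance_pos[OF N] slack_nonneg[of k] by simp

lemma Wass2_le:
  "Wass2 (mu_hat_set N A) (lambda_Q0 k)
    \<le> ennreal (matching_error N k (tolerance N) + 4 * max 0 (unmatched_bound N k))"
  unfolding Wass2_def distr_X distr_Y
proof (rule Wass_distr_le_except[OF prob_J X_m Y_m _ _ Z(1) _ matching_error_nonneg])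
  show "Wass1 (X q) (Y q) \<le> matching_error N k (tolerance N)" if "q \<in> space J" "q \<notin> Z" for q
    by (rule matched_Wass1(3)[OF match[OF that]])
  show "Wass1 (X q) (Y q) \<le> 4" if "q \<in> space J" for q
    by (rule Wass1_le_4[OF X_PM1[OF that] Y_PM1[OF that]])
  \<comment> \<open>\<open>max 0\<close> provides the nonnegative real demanded by
    \<open>Wass_distr_le_except\<close>; under \<open>ennreal\<close> the value is the same.\<close>
  show "emeasure J Z \<le> ennreal (max 0 (unmatched_bound N k))"
    using order_trans[OF Z(2) ennreal_leI[OF max.cobounded2]] .
qed auto

text \<open>Off \<open>Z\<close> the pair is matched, so a difference of at least \<open>d\<close>
  puts its second component into \<open>far N k F d\<close>. On these two events the difference is
  estimated by \<open>2 * B\<close>, elsewhere by \<open>d\<close>.\<close>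

lemma integral_diff_le:
  assumes F: "F \<in> borel_measurable PM1_borel" and B: "\<And>\<mu>. \<mu> \<in> PM1 \<Longrightarrow> \<bar>F \<mu>\<bar> \<le> B" and d: "0 \<le> d"
  shows "\<bar>(\<integral>\<mu>. F \<mu> \<partial>mu_hat_set N A) - (\<integral>\<mu>. F \<mu> \<partial>lambda_Q0 k)\<bar>
    \<le> d + 2 * B * (max 0 (unmatched_bound N k) + measure (uniform_Q0 k) (far N k F d))"
proof -
  have FX: "(\<lambda>q. F (X q)) \<in> borel_measurable J" and FY: "(\<lambda>q. F (Y q)) \<in> borel_measurable J"
    using measurable_compose[OF X_m F] measurable_compose[OF Y_m F] .
  have k1: "k \<ge> 1" using k by simp
  have intX: "integrable J (\<lambda>q. F (X q))" and intY: "integrable J (\<lambda>q. F (Y q))"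
    using FX FY B X_PM1 Y_PM1 by (auto intro!: J.integrable_const_bound[where B = B])
  define E where "E = snd -` far N k F d \<inter> space J"
  have E: "E \<in> sets J" unfolding E_def by (rule measurable_sets[OF snd_m far_sets[OF k1 F]])
  have mE: "measure J E = measure (uniform_Q0 k) (far N k F d)"
  proof -
    have "measure (distr J (uniform_Q0 k) snd) (far N k F d) = measure J E"
      unfolding E_def by (rule measure_distr[OF snd_m far_sets[OF k1 F]])
    then show ?thesis unfolding snd_J by simp
  qed
  have mZ: "measure J Z \<le> max 0 (unmatched_bound N k)"
  proof -
    have "emeasure J Z \<le> ennreal (max 0 (unmatched_bound N k))"
      using order_trans[OF Z(2) ennreal_leI[OF max.cobounded2]] .
    then show ?thesis unfolding measure_def by (intro enn2real_leI) simp_all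
  qed
  have B0: "0 \<le> B"
  proof -
    obtain q where "q \<in> space J" using J.not_empty by blast
    then show ?thesis using B[OF X_PM1[of q]] by linarith
  qed
  have "(\<integral>\<mu>. F \<mu> \<partial>mu_hat_set N A) - (\<integral>\<mu>. F \<mu> \<partial>lambda_Q0 k) = (\<integral>q. F (X q) - F (Y q) \<partial>J)"
    unfolding distr_X distr_Y using intX intY by (simp add: integral_distr[OF X_m F] integral_distr[OF Y_m F])
  also have "\<bar>\<dots>\<bar> \<le> (\<integral>q. \<bar>F (X q) - F (Y q)\<bar> \<partial>J)" by (rule integral_abs_bound)
  also have "\<dots> \<le> (\<integral>q. d + 2 * B * (indicator Z q + indicator E q) \<partial>J)"
  proof (rule integral_mono)
    show "integrable J (\<lambda>q. \<bar>F (X q) - F (Y q)\<bar>)" using intX intY by auto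
    show "integrable J (\<lambda>q. d + 2 * B * (indicator Z q + indicator E q))"
      using Z(1) E by (auto intro!: integrable_real_indicator simp: less_top[symmetric])
    fix q assume q: "q \<in> space J"
    have b: "\<bar>F (X q) - F (Y q)\<bar> \<le> 2 * B" using B[OF X_PM1[OF q]] B[OF Y_PM1[OF q]] by linarith
    show "\<bar>F (X q) - F (Y q)\<bar> \<le> d + 2 * B * (indicator Z q + indicator E q)"
    proof (cases "q \<in> Z \<or> q \<in> E")
      case True
      then have "2 * B * 1 \<le> 2 * B * (indicator Z q + indicator E q)"
        using B0 by (intro mult_left_mono) (auto simp: indicator_def)
      then show ?thesis using b d by simp
    next
      case False
      then have "matched N k (tolerance N) (fst q) (snd q)" using match q by blast
      then have "\<bar>F (X q) - F (Y q)\<bar> < d"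
        using False q matched_Wass1(2) unfolding E_def far_def by force
      then show ?thesis using False by simp
    qed
  qed
  also have "\<dots> = d + 2 * B * (measure J Z + measure J E)"
    using Z(1) E by (simp add: J.prob_space less_top[symmetric])
  also have "\<dots> \<le> d + 2 * B * (max 0 (unmatched_bound N k) + measure (uniform_Q0 k) (far N k F d))"
    unfolding mE using mZ B0 by (intro add_left_mono mult_left_mono add_right_mono) auto
  finally show ?thesis .
qed

end

section \<open>The two limits\<close>

lemma eventually_matched_coupling_space:
  assumes k: "k \<ge> 2"
  shows "\<forall>\<^sub>F N in sequentially. \<exists>J Z. matched_coupling_space N k J Z"
  using eventually_coupling[OF k]
proof eventually_elim
  case (elim N)
  then show ?case unfolding matched_coupling_space_def using k
    by (elim conjE exE, intro exI conjI) assumption+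
qed

lemma Wass2_tendsto:
  assumes k: "k \<ge> 2"
  shows "(\<lambda>N. Wass2 (mu_hat_set N (bounded_avoiders N (k + 1))) (lambda_Q0 k)) \<longlonglongrightarrow> 0"
proof (rule tendsto_sandwich[OF _ _ tendsto_const])
  have "(\<lambda>N. matching_error N k (tolerance N) + 4 * max 0 (unmatched_bound N k)) \<longlonglongrightarrow> 0 + 4 * max 0 0"
    by (intro tendsto_intros tendsto_max matching_error_tendsto unmatched_bound_tendsto[OF k])
  from tendsto_ennrealI[OF this]
  show "(\<lambda>N. ennreal (matching_error N k (tolerance N) + 4 * max 0 (unmatched_bound N k))) \<longlonglongrightarrow> 0" by simp
  show "\<forall>\<^sub>F N in sequentially. Wass2 (mu_hat_set N (bounded_avoiders N (k + 1))) (lambda_Q0 k)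
    \<le> ennreal (matching_error N k (tolerance N) + 4 * max 0 (unmatched_bound N k))"
    using eventually_matched_coupling_space[OF k]
    by eventually_elim (use matched_coupling_space.Wass2_le in blast)
qed simp

text \<open>
  A weakly continuous functional need not be uniformly continuous, so the set where the coupled
  measures have distant values is shown to vanish by dominated convergence.
\<close>

lemma far_measure_tendsto:
  assumes k: "k \<ge> 2" and F: "continuous_map weak_topology euclideanreal F" and d: "d > 0"
  shows "(\<lambda>N. measure (uniform_Q0 k) (far N k F d)) \<longlonglongrightarrow> 0"
proof -
  let ?E = "\<lambda>N. far N k F d"
  have k1: "k \<ge> 1" using k by simp
  interpret Q: prob_space "uniform_Q0 k" using k by (intro prob_space_uniform_Q0) simp
  have Fm: "F \<in> borel_measurable PM1_borel" by (rule weakly_continuous_measurable[OF F])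
  have E: "?E N \<in> sets (uniform_Q0 k)" for N
    by (rule far_sets[OF k1 Fm])
  have "(\<lambda>N. \<integral>x. indicator (?E N) x \<partial>uniform_Q0 k) \<longlonglongrightarrow> (\<integral>x. (0 :: real) \<partial>uniform_Q0 k)"
  proof (rule integral_dominated_convergence[where w = "\<lambda>_. 1"])
    show "AE x in uniform_Q0 k. (\<lambda>N. indicator (?E N) x :: real) \<longlonglongrightarrow> 0"
    proof (rule AE_I2)
      fix x assume "x \<in> space (uniform_Q0 k)"
      then have x: "x \<in> Q0 k" by simp
      have \<mu>: "segments_measure k x \<in> PM1" using k Q0_bounds[OF x] by (intro segments_measure_PM1) auto
      \<comment> \<open>The radius depends on \<open>x\<close>, but the matching error does not, so
        \<open>x\<close> leaves the far sets as soon as the error drops below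
        \<open>r\<close>.\<close>
      obtain r where r: "r > 0"
        "\<And>\<nu>. \<nu> \<in> PM1 \<Longrightarrow> Wass1 (segments_measure k x) \<nu> < r \<Longrightarrow> \<bar>F \<nu> - F (segments_measure k x)\<bar> < d"
        using weakly_continuous_Wass1_close[OF F \<mu> d] by metis
      have "\<forall>\<^sub>F N in sequentially. matching_error N k (tolerance N) < r"
        by (rule order_tendstoD(2)[OF matching_error_tendsto r(1)])
      then have "\<forall>\<^sub>F N in sequentially. x \<notin> ?E N"
        using eventually_matched_coupling_space[OF k]
      proof eventually_elim
        case (elim N)
        then obtain J Z where "matched_coupling_space N k J Z" by blast
        then interpret matched_coupling_space N k J Z .
        show ?case
        proof
          assume "x \<in> ?E N"
          then obtain \<sigma> where \<sigma>: "matched N k (tolerance N) \<sigma> x"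
            "d \<le> \<bar>F (mu_hat N \<sigma>) - F (segments_measure k x)\<bar>"
            by (auto simp: far_def)
          have "\<bar>F (mu_hat N \<sigma>) - F (segments_measure k x)\<bar> < d"
            using matched_Wass1[OF \<sigma>(1)] elim(1) by (intro r(2) mu_hat_A) auto
          then show False using \<sigma>(2) by simp
        qed
      qed
      then have "\<forall>\<^sub>F N in sequentially. (indicator (?E N) x :: real) = 0"
        by eventually_elim (rule indicator_simps)
      then show "(\<lambda>N. indicator (?E N) x :: real) \<longlonglongrightarrow> 0" by (rule tendsto_eventually)
    qed
    show "(\<lambda>x. indicator (?E N) x :: real) \<in> borel_measurable (uniform_Q0 k)" for N
      by (rule borel_measurable_indicator[OF E])
  qed (auto simp: indicator_def)
  then show ?thesis
    by (simp add: sets.Int_space_eq2[OF E] del: space_uniform_Q0)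
qed

lemma converges_weakly_lambda_Q0:
  assumes k: "k \<ge> 2"
  shows "converges_weakly (\<lambda>N. mu_hat_set N (bounded_avoiders N (k + 1))) (lambda_Q0 k)"
  unfolding converges_weakly_def
proof (intro allI impI, elim conjE)
  fix F :: "(real \<times> real) measure \<Rightarrow> real"
  assume F: "continuous_map weak_topology euclideanreal F" and bdd: "bounded (F ` PM1)"
  let ?P = "\<lambda>N. mu_hat_set N (bounded_avoiders N (k + 1))"
  obtain B where B: "\<And>\<mu>. \<mu> \<in> PM1 \<Longrightarrow> \<bar>F \<mu>\<bar> \<le> B"
    using bdd unfolding bounded_iff by auto
  have Fm: "F \<in> borel_measurable PM1_borel" by (rule weakly_continuous_measurable[OF F])
  show "(\<lambda>N. \<integral>\<mu>. F \<mu> \<partial>?P N) \<longlonglongrightarrow> (\<integral>\<mu>. F \<mu> \<partial>lambda_Q0 k)"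
  proof (rule tendstoI)
    fix e :: real assume e: "e > 0"
    \<comment> \<open>Half of \<open>e\<close> is spent on pairs with close values of
      \<open>F\<close>; the rest of the bound tends to 0.\<close>
    let ?d = "e / 2"
    let ?E = "\<lambda>N. far N k F ?d"
    have "(\<lambda>N. ?d + 2 * B * (max 0 (unmatched_bound N k) + measure (uniform_Q0 k) (?E N)))
      \<longlonglongrightarrow> ?d + 2 * B * (max 0 0 + 0)"
      using e by (intro tendsto_intros tendsto_max unmatched_bound_tendsto k far_measure_tendsto F) simp
    then have "\<forall>\<^sub>F N in sequentially. ?d + 2 * B * (max 0 (unmatched_bound N k) + measure (uniform_Q0 k) (?E N)) < e"
      by (rule order_tendstoD(2)) (use e in simp)
    then show "\<forall>\<^sub>F N in sequentially. dist (\<integral>\<mu>. F \<mu> \<partial>?P N) (\<integral>\<mu>. F \<mu> \<partial>lambda_Q0 k) < e"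
      using eventually_matched_coupling_space[OF k]
    proof eventually_elim
      case (elim N)
      then obtain J Z where "matched_coupling_space N k J Z" by blast
      then interpret matched_coupling_space N k J Z .
      show ?case
        using integral_diff_le[OF Fm B, of ?d] elim(1) e by (simp add: dist_real_def)
    qed
  qed
qed

theorem theorem3p5:
  fixes k :: nat
  assumes "k \<ge> 2"
  shows "(\<lambda>N. Wass2 (mu_hat_set N (bounded_avoiders N (k + 1))) (lambda_Q0 k)) \<longlonglongrightarrow> 0 \<and>
    converges_weakly (\<lambda>N. mu_hat_set N (bounded_avoiders N (k + 1))) (lambda_Q0 k)"
  using Wass2_tendsto[OF assms] converges_weakly_lambda_Q0[OF assms] by (rule conjI)

end
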